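(* Let $0<|q|<1$, let $r\ge 1$, and let $a$, $b$, $c_1,\dots,c_r$, $x_1,\dots,x_r$ be indeterminates (generic complex parameters, so that no denominator below vanishes). Put $C:=c_1\cdots c_r$ and $|\mathbf n|:=n_1+\dots+n_r$ for $\mathbf n\in\mathbb Z^r$. For $\mathbf n,\mathbf k,\mathbf l\in\mathbb Z^r$ define \begin{multline*} f_{\mathbf n\mathbf k}= \frac{(aq/C,Cq/a)_{\infty}}{(aq,q/a)_{\infty}} \prod_{i,j=1}^r\frac{(qc_jx_i/x_j,qx_i/c_ix_j)_{\infty}} {(qc_jx_i/c_ix_j,qx_i/x_j)_{\infty}} \prod_{i=1}^r\frac{(ax_iq/b,bq/ax_i,bc_iq/Cx_i,Cx_iq/bc_i)_{\infty}} {(ax_iq/bc_i,bc_iq/ax_i,Cx_iq/b,bq/Cx_i)_{\infty}}\\\times \prod_{1\le i<j\le r}\frac {c_iq^{n_i}/x_i-c_jq^{n_j}/x_j}{c_i/x_i-c_j/x_j} \prod_{i=1}^r\frac{1-bc_iq^{n_i+|\mathbf n|}/ax_i}{1-bc_i/ax_i}\, (a/C)_{|\mathbf k|-|\mathbf n|} \prod_{i,j=1}^r\frac 1{(qc_jx_i/x_j)_{n_j+k_i}} \prod_{i=1}^r\frac{(bc_i/Cx_i)_{n_i+|\mathbf k|}} {(ax_iq/b)_{k_i-|\mathbf n|}} \end{multline*} and \begin{multline*} g_{\mathbf k \mathbf l}= \frac{(1-aq^{2|\mathbf k|})}{(1-a)} \prod_{1\le i<j\le r}\frac {x_iq^{k_i}-x_jq^{k_j}}{x_i-x_j}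 \prod_{i=1}^r\frac{1-bq^{|\mathbf k|-k_i}/Cx_i}{1-b/Cx_i}\, \frac 1{(aq/C)_{|\mathbf k|-|\mathbf l|}} \prod_{i,j=1}^r(c_jx_i/x_j)_{k_i+l_j} \prod_{i=1}^r\frac{(ax_i/b)_{k_i-|\mathbf l|}} {(bc_iq/Cx_i)_{|\mathbf k|+l_i}} \, q^{|\mathbf k|-r|\mathbf l|}. \end{multline*} Then $(f_{\mathbf n\mathbf k})_{\mathbf n,\mathbf k\in\mathbb Z^r}$ and $(g_{\mathbf k\mathbf l})_{\mathbf k,\mathbf l\in\mathbb Z^r}$ are inverses of each other, i.e. for all $\mathbf n,\mathbf l\in\mathbb Z^r$, \[ \sum_{\mathbf k\in\mathbb Z^r}f_{\mathbf n\mathbf k}g_{\mathbf k\mathbf l}=\delta_{\mathbf n\mathbf l} \qquad\text{and}\qquad \sum_{\mathbf k\in\mathbb Z^r}g_{\mathbf n\mathbf k}f_{\mathbf k\mathbf l}=\delta_{\mathbf n\mathbf l}. \]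
   Context: For $0<|q|<1$ the $q$-shifted factorial is $(a)_\infty:=\prod_{j\ge0}(1-aq^j)$ and, for every integer $k$ (positive, zero or negative), $(a)_k:=(a)_\infty/(aq^k)_\infty$; also $(a_1,\dots,a_m)_k:=(a_1)_k\cdots(a_m)_k$ for $k$ an integer or $\infty$. $\delta_{\mathbf n\mathbf l}$ is the Kronecker delta on $\mathbb Z^r$. *)

theory Defs
  imports "HOL-Analysis.Analysis"
begin

definition qinf :: "complex \<Rightarrow> complex \<Rightarrow> complex" where
  "qinf a q = (\<Prod>j. 1 - a * q ^ j)"

definition qpoch :: "complex \<Rightarrow> complex \<Rightarrow> int \<Rightarrow> complex" where
  "qpoch a q k = qinf a q / qinf (a * q powi k) q"

text \<open>Vectors in Z^r are integer lists of length r; parameters c_i, x_i are indexed by i < r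
  (i.e. c 0, ..., c (r-1) stand for c_1, ..., c_r).\<close>

definition Cprod :: "nat \<Rightarrow> (nat \<Rightarrow> complex) \<Rightarrow> complex" where
  "Cprod r c = (\<Prod>i<r. c i)"

definition fmat :: "nat \<Rightarrow> complex \<Rightarrow> complex \<Rightarrow> complex \<Rightarrow> (nat \<Rightarrow> complex) \<Rightarrow> (nat \<Rightarrow> complex)
    \<Rightarrow> int list \<Rightarrow> int list \<Rightarrow> complex" where
  "fmat r q a b c x n k =
    (let C = Cprod r c; N = sum_list n; K = sum_list k in
     qinf (a*q/C) q * qinf (C*q/a) q / (qinf (a*q) q * qinf (q/a) q)
   * (\<Prod>i<r. \<Prod>j<r. qinf (q*c j*x i/x j) q * qinf (q*x i/(c i*x j)) q
                     / (qinf (q*c j*x i/(c i*x j)) q * qinf (q*x i/x j) q))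
   * (\<Prod>i<r. qinf (a*x i*q/b) q * qinf (b*q/(a*x i)) q * qinf (b*c i*q/(C*x i)) q * qinf (C*x i*q/(b*c i)) q
             / (qinf (a*x i*q/(b*c i)) q * qinf (b*c i*q/(a*x i)) q * qinf (C*x i*q/b) q * qinf (b*q/(C*x i)) q))
   * (\<Prod>i<r. \<Prod>j\<in>{i<..<r}. (c i * q powi (n!i) / x i - c j * q powi (n!j) / x j) / (c i / x i - c j / x j))
   * (\<Prod>i<r. (1 - b * c i * q powi (n!i + N) / (a * x i)) / (1 - b * c i / (a * x i)))
   * qpoch (a/C) q (K - N)
   * (\<Prod>i<r. \<Prod>j<r. 1 / qpoch (q*c j*x i/x j) q (n!j + k!i))
   * (\<Prod>i<r. qpoch (b*c i/(C*x i)) q (n!i + K) / qpoch (a*x i*q/b) q (k!i - N)))"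

definition gmat :: "nat \<Rightarrow> complex \<Rightarrow> complex \<Rightarrow> complex \<Rightarrow> (nat \<Rightarrow> complex) \<Rightarrow> (nat \<Rightarrow> complex)
    \<Rightarrow> int list \<Rightarrow> int list \<Rightarrow> complex" where
  "gmat r q a b c x k l =
    (let C = Cprod r c; K = sum_list k; L = sum_list l in
     (1 - a * q powi (2*K)) / (1 - a)
   * (\<Prod>i<r. \<Prod>j\<in>{i<..<r}. (x i * q powi (k!i) - x j * q powi (k!j)) / (x i - x j))
   * (\<Prod>i<r. (1 - b * q powi (K - k!i) / (C * x i)) / (1 - b / (C * x i)))
   * (1 / qpoch (a*q/C) q (K - L))
   * (\<Prod>i<r. \<Prod>j<r. qpoch (c j*x i/x j) q (k!i + l!j))
   * (\<Prod>i<r. qpoch (a*x i/b) q (k!i - L) / qpoch (b*c i*q/(C*x i)) q (K + l!i))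
   * q powi (K - int r * L))"

text \<open>Genericity: all parameters nonzero and no base u occurring in a q-shifted factorial
  (or linear factor) that must be nonzero satisfies u q^m = 1 for an integer m.\<close>

definition generic_params :: "nat \<Rightarrow> complex \<Rightarrow> complex \<Rightarrow> complex \<Rightarrow> (nat \<Rightarrow> complex) \<Rightarrow> (nat \<Rightarrow> complex) \<Rightarrow> bool" where
  "generic_params r q a b c x \<longleftrightarrow>
    (let C = Cprod r c;
         S = {a, a/C}
           \<union> {c j * x i / x j | i j. i < r \<and> j < r}
           \<union> {x i / x j | i j. i < r \<and> j < r \<and> i \<noteq> j}
           \<union> {c j * x i / (c i * x j) | i j. i < r \<and> j < r \<and> i \<noteq> j}
           \<union> (\<Union>i\<in>{..<r}. {a*x i/b, a*x i/(b*c i), b*c i/(a*x i), C*x i/b, b*c i/(C*x i), b/(C*x i)})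
     in a \<noteq> 0 \<and> b \<noteq> 0 \<and> (\<forall>i<r. c i \<noteq> 0 \<and> x i \<noteq> 0)
        \<and> (\<forall>u\<in>S. \<forall>m::int. u * q powi m \<noteq> 1))"

end

theory Submission
  imports Defs "HOL-Complex_Analysis.Complex_Analysis" "Jordan_Normal_Form.Determinant"
begin

text \<open>
  Adjoin \<open>x\<^sub>0 = b/C\<close>, \<open>y\<^sub>0 = a/b\<close> and put \<open>y\<^sub>j = c\<^sub>j/x\<^sub>j\<close>. With \<open>z\<^sub>0 = x\<^sub>0 q\<^bsup>|k|\<^esup>\<close>, \<open>z\<^sub>i = x\<^sub>i q\<^bsup>k\<^sub>i\<^esup>\<close> and
  similarly \<open>y\<close> shifted by \<open>(-|n|, n)\<close>, the summand of \<open>\<Sum>\<^sub>k f\<^sub>n\<^sub>k g\<^sub>k\<^sub>l\<close> becomes a constant times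
  \<open>(1 - \<Prod>y \<Prod>z) \<Prod>\<^sub>i\<^sub><\<^sub>j(z\<^sub>j - z\<^sub>i)\<close> times a product of rational functions of the single \<open>z\<^sub>i\<close>, and the sum runs
  over a lattice of vectors of sum zero. Up to a constant, the first two factors form the determinant of
  the values at the \<open>z\<^sub>i\<close> of any \<open>r + 1\<close> independent polynomials \<open>p\<close> of degree \<open>\<le> r + 1\<close> whose leading coefficient is \<open>(-1)\<^sup>r\<^sup>+\<^sup>1 \<Prod>y\<close> times
  \<open>p(0)\<close>; both \<open>\<Prod>\<^sub>j(1 - q\<^bsup>n\<^sub>j\<^esup> y\<^sub>j z)\<close> and \<open>\<Prod>\<^sub>j(1 - q\<^bsup>l\<^sub>j\<^esup> y\<^sub>j z)\<close> are of this kind.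
  For \<open>n \<noteq> l\<close> take both of them as columns: every \<open>2 \<times> 2\<close> minor of these columns telescopes on the
  lattice, so the sum vanishes. For \<open>n = l\<close> one column becomes constant and the lattice sum
  factors into a determinant of one-dimensional bilateral sums; these are elliptic functions, and
  Liouville's theorem evaluates the determinant as a quotient of theta functions, which is the
  reciprocal of the prefactor of \<open>f\<close>. The sum \<open>\<Sum>\<^sub>k g\<^sub>n\<^sub>k f\<^sub>k\<^sub>l\<close> is treated in the same way with the roles of
  \<open>x\<close> and \<open>y\<close> exchanged.
\<close>

section \<open>Shifted factorials and theta functions\<close>

text \<open>The obstacle is convergence. Over a denominator of degree \<open>r + 1\<close>, the
  monomials \<open>z^m\<close> with \<open>0 < m < r + 1\<close> decay geometrically at both ends of
  an orbit \<open>x q^k\<close>, while \<open>z^0\<close> and \<open>z^(r+1)\<close> do not; so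
  every Leibniz term has a row without decay, the one assigned to the polynomial column. On vectors
  of sum zero this is harmless: the coordinate of that row is determined by the others, over which
  the sum converges absolutely. With two polynomial columns a single Leibniz term has two such rows
  and diverges in general, so the terms are paired by exchanging these columns. The pairs telescope
  because the weight of a row times the two denominators gives two consecutive values of one
  function of the exponent, whose limits at the two ends have the same ratio in all rows; these
  limits exist because both index vectors have the same total. Row 0 runs backwards, its exponent
  being \<open>|k| = -k_0\<close>; the two index vectors exchange roles in its weight, and
  consecutive values result again.\<close>

lemma prod_power_int: "z \<noteq> 0 \<Longrightarrow> (\<Prod>j\<in>A. z powi g j) = z powi (\<Sum>j\<in>A. g j)"
  for z :: complex and g :: "nat \<Rightarrow> int"
  by (induction A rule: infinite_finite_induct) (auto simp: power_int_add)

lemma convergent_prod_qinf: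
  assumes "norm (q::complex) < 1"
  shows "convergent_prod (\<lambda>j. 1 - a * q ^ j)"
proof -
  have "summable (\<lambda>j. norm a * norm q ^ j)"
    using assms by (intro summable_mult summable_geometric) auto
  hence "summable (\<lambda>j. norm ((1 - a * q ^ j) - 1))"
    by (simp add: norm_mult norm_power)
  thus ?thesis
    by (intro abs_convergent_prod_imp_convergent_prod summable_imp_abs_convergent_prod)
qed

locale nome =
  fixes q :: complex
  assumes q_nz [simp]: "q \<noteq> 0" and q_less: "norm q < 1"
begin

abbreviation qi :: "complex \<Rightarrow> complex" where "qi a \<equiv> qinf a q"

text \<open>The multiplicative Jacobi theta function of nome q, without the customary factor
  \<open>qi q\<close>.\<close>

definition theta :: "complex \<Rightarrow> complex" where "theta u = qi u * qi (q / u)"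

lemma qinf_LIMSEQ: "(\<lambda>n. \<Prod>j<n. 1 - a * q ^ j) \<longlonglongrightarrow> qi a"
proof -
  have "(\<lambda>n. \<Prod>j\<le>n. 1 - a * q ^ j) \<longlonglongrightarrow> qi a"
    unfolding qinf_def by (intro convergent_prod_LIMSEQ convergent_prod_qinf q_less)
  hence "(\<lambda>n. \<Prod>j<Suc n. 1 - a * q ^ j) \<longlonglongrightarrow> qi a"
    by (simp add: lessThan_Suc_atMost)
  thus ?thesis by (rule LIMSEQ_imp_Suc)
qed

lemma qinf_step: "qi a = (1 - a) * qi (a * q)"
proof -
  have "(\<lambda>n. (1 - a) * (\<Prod>j<n. 1 - a * q * q ^ j)) \<longlonglongrightarrow> (1 - a) * qi (a * q)"
    by (intro tendsto_intros qinf_LIMSEQ)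
  also have "(\<lambda>n. (1 - a) * (\<Prod>j<n. 1 - a * q * q ^ j)) = (\<lambda>n. \<Prod>j<Suc n. 1 - a * q ^ j)"
    by (simp only: prod.lessThan_Suc_shift) (simp add: mult.assoc)
  finally show ?thesis
    using LIMSEQ_Suc[OF qinf_LIMSEQ[of a]] LIMSEQ_unique by blast
qed

lemma qinf_zero_iff: "qi a = 0 \<longleftrightarrow> (\<exists>j. a * q ^ j = 1)"
proof
  show "\<exists>j. a * q ^ j = 1" if "qi a = 0"
  proof (rule ccontr)
    assume "\<nexists>j. a * q ^ j = 1"
    hence "qi a \<noteq> 0"
      unfolding qinf_def by (intro prodinf_nonzero convergent_prod_qinf q_less) auto
    with that show False by simp
  qed
next
  have "qi a = 0" if "a * q ^ j = 1" for j
    using that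
  proof (induction j arbitrary: a)
    case 0
    thus ?case using qinf_step[of a] by simp
  next
    case (Suc j)
    hence "qi (a * q) = 0" by (intro Suc.IH) (simp add: mult_ac)
    thus ?case by (subst qinf_step) simp
  qed
  thus "\<exists>j. a * q ^ j = 1 \<Longrightarrow> qi a = 0" by blast
qed

lemma qinf_nonzero:
  assumes "\<And>m::int. a * q powi m \<noteq> 1"
  shows "qi a \<noteq> 0"
  using assms[of "int _"] by (auto simp: qinf_zero_iff power_int_def)

lemma qinf_one [simp]: "qi 1 = 0"
  using qinf_step[of 1] by simp

lemma qinf_zero [simp]: "qi 0 = 1"
  by (simp add: qinf_def)

text \<open>The partial products converge uniformly on every closed disc, by comparison with a
  geometric series, and the discs exhaust the plane.\<close>

lemma holomorphic_qinf: "qi holomorphic_on UNIV"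
proof -
  have "qi holomorphic_on ball 0 R" if R: "R > 0" for R
  proof -
    have "uniformly_convergent_on (cball 0 R) (\<lambda>N a. \<Prod>j<N. 1 - a * q ^ j)"
    proof (rule uniformly_convergent_on_prod')
      show "uniformly_convergent_on (cball 0 R) (\<lambda>N a. \<Sum>j<N. norm (1 - a * q ^ j - 1))"
      proof (rule Weierstrass_m_test')
        show "norm (norm (1 - a * q ^ j - 1)) \<le> R * norm q ^ j" if "a \<in> cball 0 R" for a j
          using that by (auto simp: norm_mult norm_power intro!: mult_right_mono)
        show "summable (\<lambda>j. R * norm q ^ j)"
          using q_less by (intro summable_mult summable_geometric) auto
      qed
    qed (auto intro!: continuous_intros)
    then obtain g where g: "uniform_limit (cball 0 R) (\<lambda>N a. \<Prod>j<N. 1 - a * q ^ j) g sequentially"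
      by (auto simp: uniformly_convergent_on_def)
    have "g a = qi a" if "a \<in> cball 0 R" for a
      using tendsto_uniform_limitI[OF g that] qinf_LIMSEQ LIMSEQ_unique by blast
    moreover have "g holomorphic_on ball 0 R"
      by (rule holomorphic_uniform_limit[OF _ g])
         (auto intro!: always_eventually continuous_intros holomorphic_intros)
    ultimately show ?thesis
      by (subst holomorphic_cong[OF refl, of _ qi g]) auto
  qed
  hence "qi field_differentiable at a" for a
    using holomorphic_on_imp_differentiable_at[of qi "ball 0 (norm a + 1)" a]
    by (auto simp: add_nonneg_pos)
  thus ?thesis by (simp add: holomorphic_on_def)
qed

lemma holomorphic_qinf' [holomorphic_intros]:
  "f holomorphic_on A \<Longrightarrow> (\<lambda>z. qi (f z)) holomorphic_on A"
  using holomorphic_on_compose[of f A qi, unfolded o_def] holomorphic_qinf holomorphic_on_subset by blast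

lemma tendsto_qinf [tendsto_intros]: "(f \<longlongrightarrow> l) F \<Longrightarrow> ((\<lambda>z. qi (f z)) \<longlongrightarrow> qi l) F"
proof -
  have "continuous_on UNIV qi"
    by (intro holomorphic_on_imp_continuous_on holomorphic_qinf)
  hence "isCont qi l" by (simp add: continuous_on_eq_continuous_at)
  moreover assume "(f \<longlongrightarrow> l) F"
  ultimately show ?thesis by (rule isCont_tendsto_compose)
qed

section \<open>Quasi-periodicity and zeros of theta functions\<close>

lemma holomorphic_theta [holomorphic_intros]:
  "f holomorphic_on A \<Longrightarrow> (\<And>z. z \<in> A \<Longrightarrow> f z \<noteq> 0) \<Longrightarrow> (\<lambda>z. theta (f z)) holomorphic_on A"
  unfolding theta_def by (intro holomorphic_intros) auto

text \<open>Passing from u to q u removes the factor \<open>1 - u\<close> from the first product and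
  adds \<open>1 - 1 / u\<close> to the second.\<close>

lemma theta_shift: 
  assumes "u \<noteq> 0"
  shows "theta (q * u) = - theta u / u"
proof (cases "u = 1")
  case False
  have 1: "theta u = (1 - u) * qi (u * q) * qi (q / u)"
    unfolding theta_def by (subst qinf_step) simp
  have 2: "theta (q * u) = qi (u * q) * ((1 - 1 / u) * qi (q / u))"
    unfolding theta_def using q_nz by (subst (2) qinf_step) (simp add: mult_ac)
  show ?thesis unfolding 1 2 using assms by (simp add: field_simps)
qed (use q_nz in \<open>simp add: theta_def\<close>)

lemma qpowi_add: "q powi (m + n) = q powi m * q powi n"
  using q_nz by (simp add: power_int_add)

lemma qpowi_Suc: "q powi (m + 1) = q powi m * q"
  using qpowi_add[of m 1] by simp

lemma qpowi_eq_1_iff [simp]: "q powi m = 1 \<longleftrightarrow> m = 0"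
proof
  assume *: "q powi m = 1"
  have aux: "q ^ n \<noteq> 1" if "n > 0" for n
  proof
    assume "q ^ n = 1"
    hence "norm q ^ n = 1" by (metis norm_one norm_power)
    thus False using power_less_one_iff[of "norm q" n] that q_less q_nz
      by (simp add: power_less_one_iff)
  qed
  show "m = 0"
  proof (rule ccontr)
    assume "m \<noteq> 0"
    hence "nat m > 0 \<or> nat (-m) > 0" by auto
    thus False using aux[of "nat m"] aux[of "nat (-m)"] *
      by (auto simp: power_int_def power_inverse split: if_splits)
  qed
qed simp

lemma theta_zero_iff:
  assumes "u \<noteq> 0"
  shows "theta u = 0 \<longleftrightarrow> (\<exists>m::int. u * q powi m = 1)"
proof
  assume "theta u = 0"
  show "\<exists>m::int. u * q powi m = 1"
  proof (rule ccontr)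
    assume a: "\<nexists>m::int. u * q powi m = 1"
    have "q / u * q powi m \<noteq> 1" for m
    proof
      assume "q / u * q powi m = 1"
      hence "q powi (m + 1) = u"
        using q_nz assms by (simp only: qpowi_Suc) (simp add: field_simps)
      hence "u * q powi (- (m + 1)) = 1"
        using assms by (simp only: power_int_minus) simp
      with a show False by blast
    qed
    thus False using \<open>theta u = 0\<close> a qinf_nonzero unfolding theta_def by auto
  qed
next
  assume "\<exists>m::int. u * q powi m = 1"
  then obtain m :: int where m: "u * q powi m = 1" by blast
  show "theta u = 0"
  proof (cases "m \<ge> 0")
    case True
    hence "u * q ^ nat m = 1" using m by (simp add: power_int_def)
    thus ?thesis unfolding theta_def using qinf_zero_iff by auto
  next
    case False
    have "q powi (-m) = u" using inverse_unique[of "q powi m" u] m by (simp add: power_int_minus mult.commute)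
    moreover have "q powi (-m) = q powi (-m - 1) * q" using qpowi_Suc[of "-m - 1"] by simp
    ultimately have "q / u * q powi (- m - 1) = 1" using assms by (simp add: field_simps)
    hence "q / u * q ^ nat (- m - 1) = 1" using False by (simp add: power_int_def)
    thus ?thesis unfolding theta_def using qinf_zero_iff by auto
  qed
qed

text \<open>Unwinding the recursion gives the constant \<open>(-1)^d q^(-d(d-1)/2)\<close>; what
  matters is that it is nonzero and the same for all u.\<close>

lemma theta_shift_int:
  "\<exists>C. C \<noteq> 0 \<and> (\<forall>u. u \<noteq> 0 \<longrightarrow> theta (q powi d * u) = C * u powi (-d) * theta u)"
proof (induction d rule: int_induct[where k = 0])
  case base
  show ?case by (intro exI[of _ 1]) auto
next
  case (step1 d)
  then obtain C where C: "C \<noteq> 0" "\<And>u. u \<noteq> 0 \<Longrightarrow> theta (q powi d * u) = C * u powi (-d) * theta u"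
    by blast
  show ?case
  proof (intro exI[of _ "- C / q powi d"] conjI allI impI)
    fix u :: complex assume u: "u \<noteq> 0"
    have "theta (q powi (d + 1) * u) = theta (q * (q powi d * u))"
      by (simp add: qpowi_Suc mult_ac)
    also have "\<dots> = - (C * u powi (-d) * theta u) / (q powi d * u)"
      using u q_nz by (subst theta_shift) (auto simp: C)
    also have "u powi (-d) = u powi - (d + 1) * u"
      using u power_int_add[of u "- (d + 1)" 1] by simp
    hence "- (C * u powi (-d) * theta u) / (q powi d * u) = - C / q powi d * u powi - (d + 1) * theta u"
      using u by simp
    finally show "theta (q powi (d + 1) * u) = \<dots>" .
  qed (use C q_nz in auto)
next
  case (step2 d)
  then obtain C where C: "C \<noteq> 0" "\<And>u. u \<noteq> 0 \<Longrightarrow> theta (q powi d * u) = C * u powi (-d) * theta u"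
    by blast
  show ?case
  proof (intro exI[of _ "- C * q powi (d - 1)"] conjI allI impI)
    fix u :: complex assume u: "u \<noteq> 0"
    have "theta (q powi d * u) = theta (q * (q powi (d - 1) * u))"
      using qpowi_Suc[of "d - 1"] by (simp add: mult_ac)
    also have "\<dots> = - theta (q powi (d - 1) * u) / (q powi (d - 1) * u)"
      using u q_nz by (subst theta_shift) auto
    finally have "theta (q powi (d - 1) * u) = - theta (q powi d * u) * (q powi (d - 1) * u)"
      using u q_nz by simp
    also have "theta (q powi d * u) = C * u powi (-d) * theta u"
      using u by (rule C)
    finally have "theta (q powi (d - 1) * u) = - C * u powi (-d) * theta u * (q powi (d - 1) * u)"
      by simp
    also have "u powi (-d) * u = u powi - (d - 1)"
      using u power_int_add[of u "-d" 1] by simp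
    hence "- C * u powi (-d) * theta u * (q powi (d - 1) * u) = - C * q powi (d - 1) * u powi - (d - 1) * theta u"
      by (simp add: mult_ac)
    finally show "theta (q powi (d - 1) * u) = - C * q powi (d - 1) * u powi - (d - 1) * theta u" .
  qed (use C q_nz in auto)
qed

text \<open>Theta with its zero at u = 1 divided out. This makes it invariant under inversion, and
  the prefactor of f is a quotient of such factors.\<close>

definition theta_hat :: "complex \<Rightarrow> complex" where "theta_hat u = qi (q * u) * qi (q / u)"

lemma theta_eq: "theta u = (1 - u) * theta_hat u"
  unfolding theta_def theta_hat_def by (subst qinf_step) (simp add: mult_ac)

lemma theta_hat_inverse: "theta_hat (1 / u) = theta_hat u"
  by (simp add: theta_hat_def)

lemma theta_inverse: "u \<noteq> 0 \<Longrightarrow> theta (1 / u) = - theta u / u"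
  unfolding theta_eq theta_hat_inverse by (simp add: field_simps)

lemma theta_one [simp]: "theta 1 = 0"
  by (simp add: theta_def)

lemma theta_hat_one: "theta_hat 1 = (qi q)\<^sup>2"
  by (simp add: theta_hat_def power2_eq_square)

lemma qinf_q_nonzero: "qi q \<noteq> 0"
proof -
  have "q * q ^ i \<noteq> 1" for i
    using qpowi_eq_1_iff[of "int (Suc i)"] by (simp only: power_int_of_nat power_Suc)
  thus ?thesis using qinf_zero_iff by blast
qed

section \<open>Bilateral sums of rational functions\<close>


lemma qpowi_nz [simp]: "q powi k \<noteq> 0"
  using q_nz by simp

text \<open>The common majorant of all bilateral sums: geometric in both directions.\<close>

abbreviation rho :: "int \<Rightarrow> real" where "rho k \<equiv> norm q ^ nat \<bar>k\<bar>"

lemma rho_bounds: "0 \<le> rho k" "rho k \<le> 1"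
  using q_less by (auto intro: power_le_one)

lemma summable_rho: "rho summable_on UNIV"
proof -
  have 1: "(\<lambda>n. norm q ^ n) summable_on UNIV"
    using q_less by (intro summable_on_UNIV_nonneg_real_iff[THEN iffD2] summable_geometric) auto
  have "rho summable_on range int"
    by (subst summable_on_reindex) (use 1 in \<open>auto simp: o_def\<close>)
  moreover have "rho summable_on range (\<lambda>n. - int n)"
    by (subst summable_on_reindex) (use 1 in \<open>auto simp: o_def inj_on_def\<close>)
  hence "rho summable_on (range (\<lambda>n. - int n) - range int)"
    by (rule summable_on_subset_banach) auto
  ultimately have "rho summable_on (range int \<union> (range (\<lambda>n. - int n) - range int))"
    by (intro summable_on_Un_disjoint) auto
  moreover have "k \<in> range int \<or> k \<in> range (\<lambda>n. - int n)" for k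
    by (cases k rule: int_cases2) auto
  hence "range int \<union> (range (\<lambda>n. - int n) - range int) = UNIV" by auto
  ultimately show ?thesis by simp
qed

text \<open>For large \<open>|k|\<close> one of the two terms of \<open>1 - w * q powi k\<close>
  dominates, uniformly for w in K. For each of the finitely many remaining k a continuous
  nonvanishing function on a compact set has a positive minimum.\<close>

lemma factor_lower_bound:
  assumes "compact K" "0 \<notin> K" and ne: "\<And>w k. w \<in> K \<Longrightarrow> k \<in> I \<Longrightarrow> w * q powi k \<noteq> 1"
  shows "\<exists>c>0. \<forall>w\<in>K. \<forall>k\<in>I. norm (1 - w * q powi k) \<ge> c * max 1 (norm (q powi k))"
proof (cases "K = {}")
  case False
  obtain R1 where R1: "\<And>w. w \<in> K \<Longrightarrow> norm w \<le> R1"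
    using compact_imp_bounded[OF assms(1)] by (auto simp: bounded_iff)
  have "compact (inverse ` K)"
    using assms by (intro compact_continuous_image continuous_intros) auto
  then obtain R2 where R2: "\<And>w. w \<in> K \<Longrightarrow> norm (inverse w) \<le> R2"
    using compact_imp_bounded[of "inverse ` K"] by (auto simp: bounded_iff)
  define R where "R = max 1 (max R1 R2)"
  have R: "R \<ge> 1" "\<And>w. w \<in> K \<Longrightarrow> norm w \<le> R" "\<And>w. w \<in> K \<Longrightarrow> 1 / R \<le> norm w"
  proof -
    fix w assume w: "w \<in> K"
    with assms have "w \<noteq> 0" by auto
    have "inverse (norm w) \<le> R" using R2[OF w] unfolding R_def norm_inverse by simp
    moreover have "R > 0" by (simp add: R_def)
    ultimately show "1 / R \<le> norm w" using \<open>w \<noteq> 0\<close> by (simp add: field_simps)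
  qed (use R1 in \<open>force simp: R_def\<close>)+
  have "(\<lambda>m. R * norm q ^ m) \<longlonglongrightarrow> R * 0"
    by (intro tendsto_intros LIMSEQ_power_zero) (use q_less in auto)
  hence "eventually (\<lambda>m. R * norm q ^ m < 1/2) sequentially"
    by (rule order_tendstoD) simp
  then obtain N where N: "\<And>m. m \<ge> N \<Longrightarrow> R * norm q ^ m < 1/2"
    by (auto simp: eventually_sequentially)
  have "\<exists>c>0. k \<in> I \<longrightarrow> (\<forall>w\<in>K. norm (1 - w * q powi k) \<ge> c * max 1 (norm (q powi k)))" for k
  proof (cases "k \<in> I")
    case True
    obtain w0 where w0: "w0 \<in> K" "\<And>w. w \<in> K \<Longrightarrow> norm (1 - w0 * q powi k) \<le> norm (1 - w * q powi k)"
    proof -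
      have "continuous_on K (\<lambda>w. norm (1 - w * q powi k))" by (intro continuous_intros)
      thus ?thesis using continuous_attains_inf[OF assms(1) False] that by blast
    qed
    show ?thesis
      using w0 ne[OF w0(1) True]
      by (intro exI[of _ "norm (1 - w0 * q powi k) / max 1 (norm (q powi k))"]) (auto simp: max_def)
  qed (auto intro: exI[of _ 1])
  then obtain c where c: "\<And>k. c k > 0"
    "\<And>k w. k \<in> I \<Longrightarrow> w \<in> K \<Longrightarrow> norm (1 - w * q powi k) \<ge> c k * max 1 (norm (q powi k))"
    by metis
  \<comment> \<open>\<open>1 / (2 * R)\<close> serves both tails, because R bounds
    \<open>norm w\<close> as well as its reciprocal and is at least 1; the minimum also covers the
    middle range.\<close>
  define d where "d = Min (insert (1 / (2 * R)) (c ` {-int N..int N}))"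
  have d: "d \<le> 1 / (2 * R)" "\<And>k. k \<in> {-int N..int N} \<Longrightarrow> d \<le> c k"
    unfolding d_def by (auto simp del: Min_insert intro!: Min_le)
  have "d > 0" unfolding d_def using R c by (subst Min_gr_iff) auto
  show ?thesis
  proof (intro exI[of _ d] conjI ballI)
    fix w k assume wk: "w \<in> K" "k \<in> I"
    let ?M = "max 1 (norm (q powi k))"
    consider "k \<in> {-int N..int N}" | "k > int N" | "k < -int N" by force
    thus "d * ?M \<le> norm (1 - w * q powi k)"
    proof cases
      case 1
      have "d * ?M \<le> c k * ?M" by (intro mult_right_mono d 1) auto
      also have "\<dots> \<le> norm (1 - w * q powi k)" by (intro c wk)
      finally show ?thesis .
    next
      case 2
      have eq: "norm (q powi k) = norm q ^ nat k" using 2 by (simp add: norm_power power_int_def)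
      have M: "?M = 1" unfolding eq using q_less by (intro max_absorb1 power_le_one) auto
      have "norm (w * q powi k) \<le> R * norm q ^ nat k"
        unfolding norm_mult eq by (intro mult_right_mono R wk) auto
      also have "\<dots> < 1/2" using 2 by (intro N) auto
      finally have "norm (1 - w * q powi k) \<ge> 1/2"
        using norm_triangle_ineq2[of 1 "w * q powi k"] by simp
      moreover have "d \<le> 1/2" using d(1) R(1) order.trans[of d "1/(2*R)" "1/2"] by (simp add: field_simps)
      ultimately show ?thesis unfolding M by simp
    next
      case 3
      have eq: "norm (q powi k) = inverse (norm q ^ nat (-k))"
        using 3 by (simp add: norm_divide norm_inverse norm_power power_int_def power_inverse)
      have "R * norm q ^ nat (-k) < 1/2" using 3 by (intro N) auto
      hence t: "norm (q powi k) > 2 * R" unfolding eq using q_nz by (simp add: field_simps)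
      have "norm (q powi k) / R \<le> norm (w * q powi k)"
        unfolding norm_mult using R(3)[OF wk(1)] mult_right_mono[of "1/R" "norm w" "norm (q powi k)"] by simp
      also have "\<dots> \<le> norm (1 - w * q powi k) + 1"
        using norm_triangle_ineq2[of "w * q powi k" 1] by (simp add: norm_minus_commute)
      finally have "norm (1 - w * q powi k) \<ge> norm (q powi k) / R - 1" by simp
      also have "norm (q powi k) / R - 1 \<ge> norm (q powi k) / (2 * R)" using t R(1) by (simp add: field_simps)
      finally have *: "norm (1 - w * q powi k) \<ge> 1 / (2 * R) * norm (q powi k)" by simp
      have M: "?M = norm (q powi k)" using t R(1) by simp
      have "d * ?M \<le> 1 / (2 * R) * ?M" by (intro mult_right_mono d) auto
      with * show ?thesis unfolding M by linarith
    qed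
  qed fact
qed (auto intro: exI[of _ 1])

section \<open>Bilateral sums as functions on the torus\<close>

definition den :: "(nat \<Rightarrow> complex) \<Rightarrow> nat \<Rightarrow> complex \<Rightarrow> complex" where
  "den y n z = (\<Prod>j<n. 1 - y j * z)"

text \<open>Towards z = 0 the decay comes from the numerator, by \<open>1 <= m\<close>; towards
  infinity it comes from the excess degree of the denominator, by \<open>m < n\<close>. The index
  set \<open>I\<close> is arbitrary so that the term with a pole can be left out when a residue is
  computed.\<close>

lemma quot_bound:
  assumes "compact K" "0 \<notin> K" and y: "\<And>j. j < n \<Longrightarrow> y j \<noteq> 0"
  and ne: "\<And>w k j. w \<in> K \<Longrightarrow> k \<in> I \<Longrightarrow> j < n \<Longrightarrow> y j * w * q powi k \<noteq> 1"
  and m: "1 \<le> m" "m < n"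
  shows "\<exists>C\<ge>0. \<forall>w\<in>K. \<forall>k\<in>I. norm ((w * q powi k) ^ m / den y n (w * q powi k)) \<le> C * rho k"
proof -
  have "\<exists>c>0. j < n \<longrightarrow> (\<forall>w\<in>K. \<forall>k\<in>I. norm (1 - y j * (w * q powi k)) \<ge> c * max 1 (norm (q powi k)))" for j
  proof (cases "j < n")
    case True
    have "\<exists>c>0. \<forall>w\<in>(*) (y j) ` K. \<forall>k\<in>I. norm (1 - w * q powi k) \<ge> c * max 1 (norm (q powi k))"
      using assms True by (intro factor_lower_bound compact_continuous_image continuous_intros) auto
    thus ?thesis by (auto simp: mult.assoc)
  qed (auto intro: exI[of _ 1])
  then obtain c where c: "\<And>j. c j > 0"
    "\<And>j w k. j < n \<Longrightarrow> w \<in> K \<Longrightarrow> k \<in> I \<Longrightarrow> norm (1 - y j * (w * q powi k)) \<ge> c j * max 1 (norm (q powi k))"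
    by metis
  obtain R where R: "\<And>w. w \<in> K \<Longrightarrow> norm w \<le> R" "R > 0"
    using compact_imp_bounded[OF assms(1)] by (auto simp: bounded_pos)
  define D where "D = (\<Prod>j<n. c j)"
  have D: "D > 0" unfolding D_def by (intro prod_pos c)
  show ?thesis
  proof (intro exI[of _ "R ^ m / D"] conjI ballI)
    fix w k assume wk: "w \<in> K" "k \<in> I"
    let ?t = "norm (q powi k)" let ?M = "max 1 ?t"
    have "D * ?M ^ n = (\<Prod>j<n. c j * ?M)" by (simp add: D_def prod.distrib)
    also have "\<dots> \<le> (\<Prod>j<n. norm (1 - y j * (w * q powi k)))"
      using c(1) by (intro prod_mono conjI c(2) wk) (auto intro!: mult_nonneg_nonneg less_imp_le)
    finally have den: "norm (den y n (w * q powi k)) \<ge> D * ?M ^ n"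
      unfolding den_def prod_norm by simp
    have num: "norm ((w * q powi k) ^ m) \<le> R ^ m * ?t ^ m"
      unfolding norm_power norm_mult power_mult_distrib by (intro mult_right_mono power_mono R wk) auto
    have Mn: "?M ^ n > 0" by (intro zero_less_power) auto
    have "norm ((w * q powi k) ^ m / den y n (w * q powi k)) \<le> R ^ m * ?t ^ m / (D * ?M ^ n)"
      unfolding norm_divide using D R Mn by (intro frac_le num den mult_pos_pos) auto
    also have "\<dots> = R ^ m / D * (?t ^ m / ?M ^ n)" by simp
    also have "?t ^ m / ?M ^ n \<le> rho k"
    proof (cases "k \<ge> 0")
      case True
      have t: "?t = rho k" using True by (simp add: power_int_def norm_power)
      have "?M = 1" unfolding t using rho_bounds[of k] by simp
      moreover have "?t ^ m \<le> ?t ^ 1"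
        unfolding t using rho_bounds[of k] m by (intro power_decreasing) auto
      ultimately show ?thesis unfolding t by simp
    next
      case False
      have t: "?t = 1 / rho k" using False by (simp add: norm_divide norm_power power_int_def power_inverse field_simps)
      have pos: "rho k > 0" using q_nz by simp
      have "?t \<ge> 1" unfolding t using rho_bounds[of k] pos by (simp add: field_simps)
      hence "?t ^ m * ?t \<le> ?t ^ n" "?M = ?t"
        using power_increasing[of "Suc m" n ?t] m by (auto simp: mult_ac)
      moreover have "?t ^ n > 0" "?t > 0" using q_nz by auto
      ultimately have "?t ^ m / ?M ^ n \<le> 1 / ?t" by (simp add: field_simps)
      also have "1 / ?t = rho k" unfolding t by simp
      finally show ?thesis .
    qed
    finally show "norm ((w * q powi k) ^ m / den y n (w * q powi k)) \<le> R ^ m / D * rho k"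
      using R D by (simp add: mult_left_mono del: times_divide_eq_left)
  qed (use R D in auto)
qed

text \<open>Summing over the q-orbit of w produces an elliptic function. For nonzero
  \<open>y j\<close> the sum converges exactly in the range \<open>0 < m < n\<close>.\<close>

definition qsum :: "(nat \<Rightarrow> complex) \<Rightarrow> nat \<Rightarrow> nat \<Rightarrow> complex \<Rightarrow> complex" where
  "qsum y n m w = (\<Sum>\<^sub>\<infinity>k::int. (w * q powi k) ^ m / den y n (w * q powi k))"

lemma holomorphic_partial_qsum:
  assumes A: "open A" "0 \<notin> A" and y: "\<And>j. j < n \<Longrightarrow> y j \<noteq> 0"
  and ne: "\<And>w k j. w \<in> A \<Longrightarrow> k \<in> I \<Longrightarrow> j < n \<Longrightarrow> y j * w * q powi k \<noteq> 1"
  and m: "1 \<le> m" "m < n"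
  shows "(\<lambda>w. \<Sum>\<^sub>\<infinity>k\<in>I. (w * q powi k) ^ m / den y n (w * q powi k)) holomorphic_on A" (is "?f holomorphic_on A")
proof -
  have "?f field_differentiable at w0" if w0: "w0 \<in> A" for w0
  proof -
    obtain r where r: "r > 0" "cball w0 r \<subseteq> A"
      using A(1) w0 open_contains_cball by blast
    obtain C where C: "C \<ge> 0" "\<And>w k. w \<in> cball w0 r \<Longrightarrow> k \<in> I \<Longrightarrow>
        norm ((w * q powi k) ^ m / den y n (w * q powi k)) \<le> C * rho k"
    proof -
      have "\<exists>C\<ge>0. \<forall>w\<in>cball w0 r. \<forall>k\<in>I. norm ((w * q powi k) ^ m / den y n (w * q powi k)) \<le> C * rho k"
        using r A(2) by (intro quot_bound y ne m compact_cball) (blast | assumption)+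
      thus ?thesis using that by blast
    qed
    have nz: "den y n (w * q powi k) \<noteq> 0" if "w \<in> cball w0 r" "k \<in> I" for w k
      unfolding den_def using ne[of w k] that r by (auto simp: mult.assoc)
    have "rho summable_on I" by (rule summable_on_subset_banach[OF summable_rho]) auto
    hence "(\<lambda>k. C * rho k) summable_on I" by (rule summable_on_cmult_right)
    hence lim: "uniform_limit (cball w0 r) (\<lambda>X w. \<Sum>k\<in>X. (w * q powi k) ^ m / den y n (w * q powi k)) ?f
        (finite_subsets_at_top I)"
      by (intro Weierstrass_m_test_general[where M = "\<lambda>k. C * rho k"] C(2)) auto
    have "\<forall>\<^sub>F X in finite_subsets_at_top I. continuous_on (cball w0 r) (\<lambda>w. \<Sum>k\<in>X. (w * q powi k) ^ m / den y n (w * q powi k))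
       \<and> (\<lambda>w. \<Sum>k\<in>X. (w * q powi k) ^ m / den y n (w * q powi k)) holomorphic_on ball w0 r"
    proof (rule eventually_finite_subsets_at_top_weakI)
      fix X assume X: "finite X" "X \<subseteq> I"
      have nz': "(\<Prod>j<n. 1 - y j * (w * q powi k)) \<noteq> 0" if "w \<in> cball w0 r" "k \<in> X" for w k
        using nz[of w k] X that by (auto simp: den_def)
      show "continuous_on (cball w0 r) (\<lambda>w. \<Sum>k\<in>X. (w * q powi k) ^ m / den y n (w * q powi k))
       \<and> (\<lambda>w. \<Sum>k\<in>X. (w * q powi k) ^ m / den y n (w * q powi k)) holomorphic_on ball w0 r"
        unfolding den_def
        by (intro conjI continuous_intros holomorphic_intros ballI nz') (auto dest: subsetD[OF ball_subset_cball])
    qed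
    then have "?f holomorphic_on ball w0 r"
      by (rule holomorphic_uniform_limit[OF _ lim]) auto
    thus ?thesis using r by (auto intro!: holomorphic_on_imp_differentiable_at)
  qed
  thus ?thesis by (auto simp: holomorphic_on_def field_differentiable_at_within)
qed

text \<open>A single theta factor vanishes on the whole orbit of the pole \<open>1 / y j\<close>, so
  finitely many conditions exclude all poles; the domain is open and stable under multiplication by
  q.\<close>

definition pdom :: "(nat \<Rightarrow> complex) \<Rightarrow> nat \<Rightarrow> complex set" where
  "pdom y n = {w. w \<noteq> 0 \<and> (\<forall>j<n. theta (y j * w) \<noteq> 0)}"

lemma pdomD: "w \<in> pdom y n \<Longrightarrow> j < n \<Longrightarrow> y j \<noteq> 0 \<Longrightarrow> y j * w * q powi k \<noteq> 1"
  unfolding pdom_def using theta_zero_iff[of "y j * w"] by auto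

lemma den_nonzero: "w \<in> pdom y n \<Longrightarrow> (\<And>j. j < n \<Longrightarrow> y j \<noteq> 0) \<Longrightarrow> den y n (w * q powi k) \<noteq> 0"
  using pdomD[of w y n _ k] by (auto simp: den_def mult.assoc)

lemma abs_summable_qsum:
  assumes "w \<in> pdom y n" and y: "\<And>j. j < n \<Longrightarrow> y j \<noteq> 0" and m: "1 \<le> m" "m < n"
  shows "(\<lambda>k. norm ((w * q powi k) ^ m / den y n (w * q powi k))) summable_on UNIV"
proof -
  obtain C where C: "C \<ge> 0" "\<And>k. norm ((w * q powi k) ^ m / den y n (w * q powi k)) \<le> C * rho k"
    using quot_bound[of "{w}" n y UNIV m] assms pdomD[OF assms(1)] by (auto simp: pdom_def)
  have "(\<lambda>k. C * rho k) summable_on UNIV" by (intro summable_on_cmult_right summable_rho)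
  thus ?thesis by (rule Infinite_Sum.abs_summable_on_comparison_test') (use C in auto)
qed

lemma open_nonzero_theta: "open {w. w \<noteq> 0 \<and> theta (c * w) \<noteq> 0}" if "c \<noteq> 0"
proof -
  have "continuous_on (-{0}) (\<lambda>w. theta (c * w))"
    using that by (intro holomorphic_on_imp_continuous_on holomorphic_intros) auto
  moreover have "{w. w \<noteq> 0 \<and> theta (c * w) \<noteq> 0} = (\<lambda>w. theta (c * w)) -` (-{0}) \<inter> (-{0})" by auto
  ultimately show ?thesis
    using continuous_open_preimage[of "-{0}" "\<lambda>w. theta (c * w)" "-{0}"] by (auto simp: Int_commute)
qed

lemma open_pdom:
  assumes "\<And>j. j < n \<Longrightarrow> y j \<noteq> 0"
  shows "open (pdom y n)"
proof -
  have "pdom y n = (-{0}) \<inter> (\<Inter>j\<in>{..<n}. {w. w \<noteq> 0 \<and> theta (y j * w) \<noteq> 0})"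
    by (auto simp: pdom_def)
  moreover have "open \<dots>"
    by (intro open_Int open_INT ballI open_nonzero_theta assms) auto
  ultimately show ?thesis by simp
qed

lemma holomorphic_qsum:
  assumes y: "\<And>j. j < n \<Longrightarrow> y j \<noteq> 0" and m: "1 \<le> m" "m < n"
  shows "qsum y n m holomorphic_on pdom y n"
  unfolding qsum_def using assms pdomD[of _ y n]
  by (intro holomorphic_partial_qsum open_pdom) (auto simp: pdom_def)

lemma qsum_shift: "qsum y n m (q * w) = qsum y n m w"
  unfolding qsum_def
  by (rule infsum_reindex_bij_witness[of _ "\<lambda>k. k - 1" "\<lambda>k. k + 1"]) (auto simp: qpowi_Suc mult_ac)

text \<open>Only the term \<open>k = 0\<close> contributes to the residue.\<close>

lemma qsum_residue:
  assumes y: "\<And>j. j < n \<Longrightarrow> y j \<noteq> 0" and m: "1 \<le> m" "m < n" and J: "J < n"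
  and sep: "\<And>j k. j < n \<Longrightarrow> j \<noteq> J \<Longrightarrow> y j / y J * q powi k \<noteq> 1"
  shows "((\<lambda>w. (1 - y J * w) * qsum y n m w) \<longlongrightarrow> (1 / y J) ^ m / (\<Prod>j\<in>{..<n}-{J}. 1 - y j / y J)) (at (1 / y J))"
proof -
  \<comment> \<open>\<open>theta_hat (y j * w)\<close> vanishes at the poles of every term with k
    nonzero, but not at those of the term k = 0. Hence \<open>A\<close> is a neighbourhood of
    \<open>1 / y J\<close> on which the sum without that term is holomorphic.\<close>
  define A where "A = (-{0}) \<inter> (\<Inter>j\<in>{..<n}. (\<lambda>w. theta_hat (y j * w)) -` (-{0}) \<inter> (-{0}))"
  have pole: "theta_hat u = 0" if "u * q powi k = 1" "k \<noteq> 0" for u k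
  proof (cases "k > 0")
    case True
    have "q powi k = q ^ nat k" "nat k = Suc (nat (k - 1))" using True by (auto simp: power_int_def)
    hence "q * u * q ^ nat (k - 1) = 1" using that(1) by (simp add: mult_ac)
    thus ?thesis unfolding theta_hat_def using qinf_zero_iff by auto
  next
    case False
    with that have k: "nat (-k) = Suc (nat (-k - 1))" by auto
    have "u \<noteq> 0" using that by auto
    have "q powi (-k) = u" using inverse_unique[of "q powi k" u] that by (simp add: power_int_minus mult.commute)
    moreover have "q powi (-k) = q ^ Suc (nat (-k-1))" using False k by (simp add: power_int_def)
    ultimately have "q / u * q ^ nat (-k-1) = 1" using \<open>u \<noteq> 0\<close> by (simp add: field_simps)
    thus ?thesis unfolding theta_hat_def using qinf_zero_iff by auto
  qed
  have "open ((\<lambda>w. theta_hat (y j * w)) -` (-{0}) \<inter> (-{0}))" if "j < n" for j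
  proof -
    have "continuous_on (-{0}) (\<lambda>w. theta_hat (y j * w))"
      unfolding theta_hat_def using y[OF that] by (intro holomorphic_on_imp_continuous_on holomorphic_intros) auto
    thus ?thesis using continuous_open_preimage[of "-{0}" "\<lambda>w. theta_hat (y j * w)" "-{0}"] by (auto simp: Int_commute)
  qed
  hence A: "open A" unfolding A_def by (intro open_Int open_INT) auto
  have inA: "1 / y J \<in> A"
  proof -
    have "theta_hat (y j / y J) \<noteq> 0" if j: "j < n" for j
    proof (cases "j = J")
      case True
      thus ?thesis using True y[OF J] qinf_q_nonzero by (simp add: theta_hat_def)
    next
      case False
      have "q * (y j / y J) * q ^ i \<noteq> 1" for i
        using sep[OF j False, of "int (Suc i)"] by (simp only: power_int_of_nat power_Suc) (simp add: mult_ac)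
      moreover have "q / (y j / y J) * q ^ i \<noteq> 1" for i
      proof
        assume "q / (y j / y J) * q ^ i = 1"
        hence "q ^ Suc i = y j / y J" using y[OF j] y[OF J] by (simp add: field_simps)
        hence "y j / y J * q powi (- int (Suc i)) = 1"
          using q_nz y[OF j] y[OF J] by (simp only: power_int_minus power_int_of_nat) simp
        with sep[OF j False] show False by blast
      qed
      ultimately show ?thesis unfolding theta_hat_def using qinf_zero_iff by auto
    qed
    thus ?thesis using y[OF J] by (auto simp: A_def)
  qed
  have neA: "y j * w * q powi k \<noteq> 1" if "w \<in> A" "k \<noteq> 0" "j < n" for w k j
  proof -
    have "theta_hat (y j * w) \<noteq> 0" using that unfolding A_def by blast
    thus ?thesis using pole[of "y j * w" k] that by blast
  qed
  define g where "g = (\<lambda>w. \<Sum>\<^sub>\<infinity>k\<in>-{0}. (w * q powi k) ^ m / den y n (w * q powi k))"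
  have hg: "g holomorphic_on A"
    unfolding g_def using y m neA by (intro holomorphic_partial_qsum A) (auto simp: A_def)
  hence "isCont g (1 / y J)" using A inA
    by (meson continuous_on_eq_continuous_at holomorphic_on_imp_continuous_on)
  hence "(g \<longlongrightarrow> g (1 / y J)) (at (1 / y J))" by (simp add: isCont_def)
  hence "((\<lambda>w. w ^ m / (\<Prod>j\<in>{..<n}-{J}. 1 - y j * w) + (1 - y J * w) * g w) \<longlongrightarrow>
      (1 / y J) ^ m / (\<Prod>j\<in>{..<n}-{J}. 1 - y j * (1 / y J)) + (1 - y J * (1 / y J)) * g (1 / y J)) (at (1 / y J))"
    using y[OF J] sep[where k = 0] by (intro tendsto_intros) auto
  moreover have "eventually (\<lambda>w. w ^ m / (\<Prod>j\<in>{..<n}-{J}. 1 - y j * w) + (1 - y J * w) * g w = (1 - y J * w) * qsum y n m w) (at (1 / y J))"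
  proof -
    have "eventually (\<lambda>w. w \<in> A - {1 / y J}) (at (1 / y J))"
      using A inA by (intro eventually_at_in_open) auto
    thus ?thesis
    proof eventually_elim
      case (elim w)
      obtain C where C: "C \<ge> 0" "\<And>k. k \<in> -{0} \<Longrightarrow> norm ((w * q powi k) ^ m / den y n (w * q powi k)) \<le> C * rho k"
        using quot_bound[of "{w}" n y "-{0}" m] y m neA[of w] elim by (auto simp: A_def)
      have "(\<lambda>k. C * rho k) summable_on -{0}"
        by (intro summable_on_cmult_right summable_on_subset_banach[OF summable_rho]) auto
      hence "(\<lambda>k. norm ((w * q powi k) ^ m / den y n (w * q powi k))) summable_on -{0}"
        by (rule Infinite_Sum.abs_summable_on_comparison_test') (use C in auto)
      hence "(\<lambda>k. (w * q powi k) ^ m / den y n (w * q powi k)) summable_on -{0}"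
        by (rule abs_summable_summable)
      hence "((\<lambda>k. (w * q powi k) ^ m / den y n (w * q powi k)) has_sum g w) (-{0})"
        unfolding g_def by (rule has_sum_infsum)
      hence "((\<lambda>k. (w * q powi k) ^ m / den y n (w * q powi k)) has_sum (w ^ m / den y n w + g w)) (insert 0 (-{0}))"
        using has_sum_insert[of "0::int" "-{0}" "\<lambda>k. (w * q powi k) ^ m / den y n (w * q powi k)" "g w"] by simp
      moreover have "insert (0::int) (-{0}) = UNIV" by auto
      ultimately have "qsum y n m w = w ^ m / den y n w + g w"
        unfolding qsum_def by (simp add: infsumI)
      moreover have "den y n w = (1 - y J * w) * (\<Prod>j\<in>{..<n}-{J}. 1 - y j * w)"
        unfolding den_def using J by (subst prod.remove[of _ J]) auto
      moreover have "1 - y J * w \<noteq> 0" using elim y[OF J] by (auto simp: field_simps)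
      moreover have "w ^ m / P + e * h = e * Q" if "Q = w ^ m / D + h" "D = e * P" "e \<noteq> 0" for e h Q D P :: complex
        using that by (simp add: distrib_left)
      ultimately show ?case by blast
    qed
  qed
  ultimately show ?thesis using y[OF J] by (simp add: tendsto_cong)
qed

end

section \<open>Determinants\<close>

definition detf :: "nat \<Rightarrow> (nat \<Rightarrow> nat \<Rightarrow> complex) \<Rightarrow> complex" where
  "detf n M = Determinant.det (Matrix.mat n n (\<lambda>(i, j). M i j))"

lemma detf_leibniz:
  "detf n M = (\<Sum>p | p permutes {..<n}. of_int (sign p) * (\<Prod>i<n. M i (p i)))"
  unfolding detf_def det_def'[OF mat_carrier] atLeast0LessThan
proof (rule sum.cong[OF refl])
  fix p assume "p \<in> {p. p permutes {..<n}}"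
  hence "p i < n" if "i < n" for i
    using that permutes_in_image[of p "{..<n}" i] by simp
  thus "signof p * (\<Prod>i<n. Matrix.mat n n (\<lambda>(i, j). M i j) $$ (i, p i)) =
        of_int (sign p) * (\<Prod>i<n. M i (p i))"
    by simp
qed

lemma detf_cong:
  assumes "\<And>i j. i < n \<Longrightarrow> j < n \<Longrightarrow> M i j = M' i j"
  shows "detf n M = detf n M'"
  unfolding detf_def by (intro arg_cong[of _ _ Determinant.det] eq_matI) (auto simp: assms)

text \<open>The order of the quantifiers is the point: the cofactors along row r do not see f, so
  one \<open>c\<close> serves all f, and holomorphy or limits in this row reduce to those of its
  entries.\<close>

lemma detf_row_linear:
  assumes "r < n"
  shows "\<exists>c. \<forall>f. detf n (\<lambda>i j. if i = r then f j else M i j) = (\<Sum>j<n. f j * c j)"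
proof (intro exI allI)
  fix f
  let ?A = "\<lambda>f. Matrix.mat n n (\<lambda>(i, j). if i = r then f j else M i j)"
  have del: "mat_delete (?A f) r j = mat_delete (?A (\<lambda>_. 0)) r j" if "j < n" for j
    using assms that by (intro eq_matI) (auto simp: mat_delete_def)
  have "detf n (\<lambda>i j. if i = r then f j else M i j) = (\<Sum>j<n. ?A f $$ (r, j) * cofactor (?A f) r j)"
    unfolding detf_def by (intro laplace_expansion_row[OF _ assms]) auto
  also have "\<dots> = (\<Sum>j<n. f j * cofactor (?A (\<lambda>_. 0)) r j)"
    using assms by (intro sum.cong) (auto simp: cofactor_def del)
  finally show "detf n (\<lambda>i j. if i = r then f j else M i j) = (\<Sum>j<n. f j * cofactor (?A (\<lambda>_. 0)) r j)" .
qed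

lemma detf_col_linear:
  assumes "r < n"
  shows "\<exists>c. \<forall>f. detf n (\<lambda>i j. if j = r then f i else M i j) = (\<Sum>i<n. f i * c i)"
proof (intro exI allI)
  fix f
  let ?A = "\<lambda>f. Matrix.mat n n (\<lambda>(i, j). if j = r then f i else M i j)"
  have del: "mat_delete (?A f) i r = mat_delete (?A (\<lambda>_. 0)) i r" if "i < n" for i
    using assms that by (intro eq_matI) (auto simp: mat_delete_def)
  have "detf n (\<lambda>i j. if j = r then f i else M i j) = (\<Sum>i<n. ?A f $$ (i, r) * cofactor (?A f) i r)"
    unfolding detf_def by (intro laplace_expansion_column[OF _ assms]) auto
  also have "\<dots> = (\<Sum>i<n. f i * cofactor (?A (\<lambda>_. 0)) i r)"
    using assms by (intro sum.cong) (auto simp: cofactor_def del)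
  finally show "detf n (\<lambda>i j. if j = r then f i else M i j) = (\<Sum>i<n. f i * cofactor (?A (\<lambda>_. 0)) i r)" .
qed

lemma detf_identical_rows:
  assumes "r < n" "s < n" "r \<noteq> s" "\<And>j. j < n \<Longrightarrow> M r j = M s j"
  shows "detf n M = 0"
  unfolding detf_def
  by (rule det_identical_rows[of _ n r s]) (use assms in \<open>auto intro!: eq_vecI\<close>)

lemma detf_identical_columns:
  assumes "r < n" "s < n" "r \<noteq> s" "\<And>i. i < n \<Longrightarrow> M i r = M i s"
  shows "detf n M = 0"
  unfolding detf_def
  by (rule det_identical_columns[of _ n r s]) (use assms in \<open>auto intro!: eq_vecI\<close>)

lemma detf_mult: "detf n (\<lambda>i j. \<Sum>l<n. M i l * E l j) = detf n M * detf n E"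
proof -
  have "Matrix.mat n n (\<lambda>(i, j). \<Sum>l<n. M i l * E l j) =
        Matrix.mat n n (\<lambda>(i, j). M i j) * Matrix.mat n n (\<lambda>(i, j). E i j)"
    by (intro eq_matI) (auto simp: scalar_prod_def atLeast0LessThan)
  thus ?thesis unfolding detf_def by (simp add: det_mult[of _ n])
qed

lemma detf_upper_triangular:
  assumes "\<And>i j. j < i \<Longrightarrow> i < n \<Longrightarrow> E i j = 0"
  shows "detf n E = (\<Prod>i<n. E i i)"
proof -
  have "detf n E = prod_list (diag_mat (Matrix.mat n n (\<lambda>(i, j). E i j)))"
    unfolding detf_def by (intro det_upper_triangular[of _ n]) (use assms in \<open>auto simp: upper_triangular_def\<close>)
  also have "\<dots> = (\<Prod>i<n. E i i)"
    by (subst prod.list_conv_set_nth) (auto simp: diag_mat_def atLeast0LessThan intro!: prod.cong)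
  finally show ?thesis .
qed

lemma detf_scale_rows: "detf n (\<lambda>i j. a i * M i j) = (\<Prod>i<n. a i) * detf n M"
  unfolding detf_leibniz by (simp add: prod.distrib sum_distrib_left mult_ac)

lemma detf_expand_last_column:
  assumes "\<And>i. i < n \<Longrightarrow> M i n = 0"
  shows "detf (Suc n) M = M n n * detf n M"
proof -
  let ?A = "Matrix.mat (Suc n) (Suc n) (\<lambda>(i, j). M i j)"
  have "detf (Suc n) M = (\<Sum>i<Suc n. ?A $$ (i, n) * cofactor ?A i n)"
    unfolding detf_def by (intro laplace_expansion_column) auto
  also have "\<dots> = M n n * cofactor ?A n n"
    using assms by simp
  also have "mat_delete ?A n n = Matrix.mat n n (\<lambda>(i, j). M i j)"
    by (intro eq_matI) (auto simp: mat_delete_def)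
  hence "cofactor ?A n n = detf n M"
    by (simp add: cofactor_def detf_def flip: mult_2 power_mult)
  finally show ?thesis .
qed

text \<open>Shaped for the matrix of residues, whose first row is cleared outside column 1. Deleting
  that column leaves the indices 0, 2, 3, ..., whence the renumbering.\<close>

lemma detf_expand_first_row:
  assumes "\<And>j. j < Suc n \<Longrightarrow> j \<noteq> 1 \<Longrightarrow> M 0 j = 0" and "n \<ge> 1"
  shows "detf (Suc n) M = - M 0 1 * detf n (\<lambda>i j. M (Suc i) (if j = 0 then 0 else Suc j))"
proof -
  let ?A = "Matrix.mat (Suc n) (Suc n) (\<lambda>(i, j). M i j)"
  have "detf (Suc n) M = (\<Sum>j<Suc n. ?A $$ (0, j) * cofactor ?A 0 j)"
    unfolding detf_def by (intro laplace_expansion_row) auto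
  also have "\<dots> = (\<Sum>j\<in>{1}. ?A $$ (0, j) * cofactor ?A 0 j)"
    using assms by (intro sum.mono_neutral_right) auto
  also have "\<dots> = M 0 1 * cofactor ?A 0 1" using assms(2) by simp
  also have "mat_delete ?A 0 1 = Matrix.mat n n (\<lambda>(i, j). M (Suc i) (if j = 0 then 0 else Suc j))"
    by (intro eq_matI) (auto simp: mat_delete_def)
  hence "cofactor ?A 0 1 = - detf n (\<lambda>i j. M (Suc i) (if j = 0 then 0 else Suc j))"
    by (simp add: cofactor_def detf_def)
  finally show ?thesis by simp
qed

section \<open>Vandermonde determinants with polynomial columns\<close>

definition vdm :: "nat \<Rightarrow> (nat \<Rightarrow> complex) \<Rightarrow> complex" where
  "vdm n z = (\<Prod>j<n. \<Prod>i<j. z j - z i)"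

lemma poly_eq_sum_le: "degree p \<le> n \<Longrightarrow> poly p (z::complex) = (\<Sum>i\<le>n. coeff p i * z ^ i)"
  unfolding poly_altdef by (intro sum.mono_neutral_left) (auto simp: coeff_eq_0)

definition rootpoly :: "nat \<Rightarrow> (nat \<Rightarrow> complex) \<Rightarrow> complex poly" where
  "rootpoly n z = (\<Prod>i<n. [:- z i, 1:])"

lemma rootpoly:
  "poly (rootpoly n z) w = (\<Prod>i<n. w - z i)" "degree (rootpoly n z) = n"
  "coeff (rootpoly n z) n = 1" "coeff (rootpoly n z) 0 = (\<Prod>i<n. - z i)"
proof -
  show 1: "poly (rootpoly n z) w = (\<Prod>i<n. w - z i)" for w
    by (simp add: rootpoly_def poly_prod)
  show 2: "degree (rootpoly n z) = n"
    unfolding rootpoly_def by (subst degree_prod_eq_sum_degree) auto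
  have "lead_coeff (rootpoly n z) = 1"
    unfolding rootpoly_def by (simp add: lead_coeff_prod)
  thus "coeff (rootpoly n z) n = 1" by (simp add: 2)
  show "coeff (rootpoly n z) 0 = (\<Prod>i<n. - z i)"
    using 1[of 0] by (simp add: poly_0_coeff_0)
qed

text \<open>Replacing the last column by the values of a monic polynomial of degree n does not
  change the determinant. The choice of the roots \<open>z 0\<close>, ..., \<open>z (n - 1)\<close>
  clears this column except for its last entry.\<close>

lemma detf_vandermonde: "detf n (\<lambda>i j. z i ^ j) = vdm n z"
proof (induction n)
  case 0
  show ?case by (simp add: detf_leibniz vdm_def)
next
  case (Suc n)
  let ?L = "\<lambda>f. detf (Suc n) (\<lambda>i j. if j = n then f i else z i ^ j)"
  obtain c where c: "\<And>f. ?L f = (\<Sum>i<Suc n. f i * c i)"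
    using detf_col_linear[of n "Suc n" "\<lambda>i j. z i ^ j"] by blast
  have mono: "?L (\<lambda>i. z i ^ m) = 0" if "m < n" for m
    using that by (intro detf_identical_columns[of m _ n]) auto
  have eq: "?L (\<lambda>i. poly (rootpoly n z) (z i)) = (\<Sum>m\<le>n. coeff (rootpoly n z) m * ?L (\<lambda>i. z i ^ m))"
    unfolding c by (subst sum_distrib_left, subst sum.swap)
      (simp add: poly_eq_sum_le[OF eq_refl[OF rootpoly(2)]] sum_distrib_right mult.assoc)
  have "\<dots> = (\<Sum>m\<in>{n}. coeff (rootpoly n z) m * ?L (\<lambda>i. z i ^ m))"
    using mono by (intro sum.mono_neutral_right) auto
  also have "\<dots> = detf (Suc n) (\<lambda>i j. z i ^ j)"
    by (auto simp: rootpoly(3) intro!: detf_cong)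
  finally have "detf (Suc n) (\<lambda>i j. z i ^ j) = ?L (\<lambda>i. poly (rootpoly n z) (z i))"
    using eq by simp
  also have "\<dots> = poly (rootpoly n z) (z n) * detf n (\<lambda>i j. if j = n then poly (rootpoly n z) (z i) else z i ^ j)"
    by (subst detf_expand_last_column) (auto simp: rootpoly(1))
  also have "detf n (\<lambda>i j. if j = n then poly (rootpoly n z) (z i) else z i ^ j) = detf n (\<lambda>i j. z i ^ j)"
    by (intro detf_cong) auto
  also have "poly (rootpoly n z) (z n) * \<dots> = vdm (Suc n) z"
    unfolding Suc.IH by (simp add: vdm_def rootpoly(1))
  finally show ?case .
qed

text \<open>By linearity in column 0 only the coefficients of degree 0 and n count, since every
  monomial in between repeats another column. The monic polynomial with roots \<open>z i\<close> has
  a zero column, which expresses the column \<open>z^n\<close> through \<open>z^0\<close> and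
  produces the product of the \<open>z i\<close>.\<close>

lemma detf_vandermonde_border:
  assumes p: "degree p \<le> n" "coeff p 0 = 1" "coeff p n = (-1) ^ n * Y" and n: "n \<ge> 1"
  shows "detf n (\<lambda>i j. if j = 0 then poly p (z i) else z i ^ j) = (1 - Y * (\<Prod>i<n. z i)) * vdm n z"
proof -
  let ?L = "\<lambda>f. detf n (\<lambda>i j. if j = 0 then f i else z i ^ j)"
  obtain c where c: "\<And>f. ?L f = (\<Sum>i<n. f i * c i)"
    using detf_col_linear[of 0 n "\<lambda>i j. z i ^ j"] n by auto
  have mono: "?L (\<lambda>i. z i ^ m) = 0" if "m < n" "m > 0" for m
    using that n by (intro detf_identical_columns[of m _ 0]) auto
  have eq: "?L (\<lambda>i. poly r (z i)) = coeff r 0 * vdm n z + coeff r n * ?L (\<lambda>i. z i ^ n)"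
    if r: "degree r \<le> n" for r
  proof -
    have "?L (\<lambda>i. poly r (z i)) = (\<Sum>m\<le>n. coeff r m * ?L (\<lambda>i. z i ^ m))"
      unfolding c by (subst sum_distrib_left, subst sum.swap)
        (simp add: poly_eq_sum_le[OF r] sum_distrib_right mult.assoc)
    also have "\<dots> = (\<Sum>m\<in>{0,n}. coeff r m * ?L (\<lambda>i. z i ^ m))"
      using mono by (intro sum.mono_neutral_right) auto
    also have "\<dots> = coeff r 0 * ?L (\<lambda>i. z i ^ 0) + coeff r n * ?L (\<lambda>i. z i ^ n)"
      using n by simp
    also have "?L (\<lambda>i. z i ^ 0) = vdm n z"
      unfolding detf_vandermonde[symmetric] by (intro detf_cong) auto
    finally show ?thesis .
  qed
  have "0 = ?L (\<lambda>i. poly (rootpoly n z) (z i))"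
    unfolding c by (intro sum.neutral[symmetric]) (auto simp: rootpoly(1))
  also have "\<dots> = (\<Prod>i<n. - z i) * vdm n z + ?L (\<lambda>i. z i ^ n)"
    by (subst eq) (simp_all add: rootpoly)
  also have "(\<Prod>i<n. - z i) = (-1) ^ n * (\<Prod>i<n. z i)"
    using prod.distrib[of "\<lambda>_. -1" z "{..<n}"] by simp
  finally have "?L (\<lambda>i. z i ^ n) = - ((-1) ^ n * (\<Prod>i<n. z i) * vdm n z)"
    by (simp add: eq_neg_iff_add_eq_0 add.commute)
  thus ?thesis
    by (subst eq[OF p(1)]) (simp add: p algebra_simps flip: power_mult_distrib)
qed

text \<open>Modulo column 0 the polynomial p' may be replaced by \<open>p' - p\<close>, whose
  coefficients of degree 0 and n vanish. All its remaining monomials except \<open>z^m0\<close>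
  repeat a column, so a second polynomial column only costs a constant factor.\<close>

lemma detf_vandermonde_border2:
  assumes p: "degree p \<le> n" "coeff p 0 = 1" "coeff p n = (-1) ^ n * Y"
  and p': "degree p' \<le> n" "coeff p' 0 = 1" "coeff p' n = (-1) ^ n * Y" and m0: "0 < m0" "m0 < n"
  shows "detf n (\<lambda>i j. if j = 0 then poly p (z i) else if j = m0 then poly p' (z i) else z i ^ j) =
     (coeff p' m0 - coeff p m0) * ((1 - Y * (\<Prod>i<n. z i)) * vdm n z)"
proof -
  define M where "M = (\<lambda>i j. if j = 0 then poly p (z i) else z i ^ j)"
  let ?L = "\<lambda>f. detf n (\<lambda>i j. if j = m0 then f i else M i j)"
  obtain c where c: "\<And>f. ?L f = (\<Sum>i<n. f i * c i)"
    using detf_col_linear[of m0 n M] m0 by auto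
  have mono: "?L (\<lambda>i. z i ^ m) = 0" if "m < n" "m > 0" "m \<noteq> m0" for m
    using that m0 by (intro detf_identical_columns[of m _ m0]) (auto simp: M_def)
  have Lp: "?L (\<lambda>i. poly p (z i)) = 0"
    using m0 by (intro detf_identical_columns[of 0 _ m0]) (auto simp: M_def)
  define d where "d = p' - p"
  have d: "degree d \<le> n" using p p' by (auto simp: d_def intro: degree_diff_le)
  have "?L (\<lambda>i. poly d (z i)) = (\<Sum>m\<le>n. coeff d m * ?L (\<lambda>i. z i ^ m))"
    unfolding c by (subst sum_distrib_left, subst sum.swap)
      (simp add: poly_eq_sum_le[OF d] sum_distrib_right mult.assoc)
  also have "\<dots> = (\<Sum>m\<in>{m0}. coeff d m * ?L (\<lambda>i. z i ^ m))"
  proof (intro sum.mono_neutral_right ballI)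
    fix m assume m: "m \<in> {..n} - {m0}"
    consider "m = 0" | "m = n" | "m > 0" "m < n" using m by force
    thus "coeff d m * ?L (\<lambda>i. z i ^ m) = 0"
      by cases (use m mono p p' in \<open>auto simp: d_def\<close>)
  qed (use m0 in auto)
  also have "\<dots> = coeff d m0 * ?L (\<lambda>i. z i ^ m0)" by simp
  also have "?L (\<lambda>i. z i ^ m0) = detf n M"
    using m0 by (intro detf_cong) (auto simp: M_def)
  also have "detf n M = (1 - Y * (\<Prod>i<n. z i)) * vdm n z"
    unfolding M_def using m0 by (intro detf_vandermonde_border p) auto
  finally have "?L (\<lambda>i. poly d (z i)) = coeff d m0 * ((1 - Y * (\<Prod>i<n. z i)) * vdm n z)" .
  moreover have "?L (\<lambda>i. poly d (z i)) = ?L (\<lambda>i. poly p' (z i)) - ?L (\<lambda>i. poly p (z i))"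
    unfolding c d_def by (simp add: algebra_simps sum_subtractf)
  moreover have "?L (\<lambda>i. poly p' (z i)) = detf n (\<lambda>i j. if j = 0 then poly p (z i) else if j = m0 then poly p' (z i) else z i ^ j)"
    using m0 by (intro detf_cong) (auto simp: M_def)
  ultimately show ?thesis using Lp by (simp add: d_def)
qed

lemma vdm_upd:
  assumes "I < n"
  shows "\<exists>c. \<forall>w. vdm n (x(I := w)) = c * (\<Prod>i\<in>{..<n}-{I}. x i - w)"
  using assms
proof (induction n)
  case (Suc n)
  have step: "vdm (Suc n) z = vdm n z * (\<Prod>i<n. z n - z i)" for z by (simp add: vdm_def)
  show ?case
  proof (cases "I = n")
    case True
    have "vdm (Suc n) (x(I := w)) = (vdm n x * (-1) ^ n) * (\<Prod>i\<in>{..<Suc n}-{I}. x i - w)" for w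
    proof -
      have "vdm n (x(I := w)) = vdm n x"
        unfolding vdm_def using True by (intro prod.cong) auto
      moreover have "(\<Prod>i<n. (x(I := w)) n - (x(I := w)) i) = (\<Prod>i<n. w - x i)"
        using True by (intro prod.cong) auto
      moreover have "\<dots> = (-1) ^ n * (\<Prod>i<n. x i - w)"
        using prod.distrib[of "\<lambda>_. -1" "\<lambda>i. x i - w" "{..<n}"] by simp
      moreover have "{..<Suc n} - {I} = {..<n}" using True by auto
      ultimately show ?thesis by (simp only: step) simp
    qed
    thus ?thesis by blast
  next
    case False
    then obtain c where c: "\<And>w. vdm n (x(I := w)) = c * (\<Prod>i\<in>{..<n}-{I}. x i - w)"
      using Suc by fastforce
    have "vdm (Suc n) (x(I := w)) = (c * (\<Prod>i\<in>{..<n}-{I}. x n - x i)) * (\<Prod>i\<in>{..<Suc n}-{I}. x i - w)" for w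
    proof -
      have "(\<Prod>i<n. (x(I := w)) n - (x(I := w)) i) = (x n - w) * (\<Prod>i\<in>{..<n}-{I}. x n - x i)"
        using False Suc.prems by (subst prod.remove[of _ I]) auto
      moreover have "{..<Suc n} - {I} = insert n ({..<n} - {I})" using False by auto
      ultimately show ?thesis by (simp add: step c mult_ac)
    qed
    thus ?thesis by blast
  qed
qed auto

lemma vdm_Suc_shift: "vdm (Suc n) x = (\<Prod>i<n. x (Suc i) - x 0) * vdm n (\<lambda>i. x (Suc i))"
proof -
  have "vdm (Suc n) x = (\<Prod>j<n. (x (Suc j) - x 0) * (\<Prod>i<j. x (Suc j) - x (Suc i)))"
    unfolding vdm_def prod.lessThan_Suc_shift by simp
  thus ?thesis by (simp add: vdm_def prod.distrib)
qed

section \<open>An elliptic determinant evaluation\<close>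

context nome begin

lemma theta_eventually_nonzero:
  assumes "p \<noteq> 0" "c \<noteq> 0"
  shows "eventually (\<lambda>w. theta (c * w) \<noteq> 0) (at p)"
proof (cases "theta (c * p) = 0")
  case False
  have "open {w. w \<noteq> 0 \<and> theta (c * w) \<noteq> 0}" by (rule open_nonzero_theta) fact
  hence "eventually (\<lambda>w. w \<in> {w. w \<noteq> 0 \<and> theta (c * w) \<noteq> 0}) (at p)"
    using False assms by (intro eventually_at_in_open') auto
  thus ?thesis by eventually_elim auto
next
  case True
  \<comment> \<open>Isolation of zeros requires a point where the function does not vanish. The
    point \<open>-1 / c\<close> qualifies, since \<open>q powi m = -1\<close> would give
    \<open>q powi (2 * m) = 1\<close>, hence m = 0.\<close>
  have "theta (c * (- 1 / c)) \<noteq> 0"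
  proof
    assume "theta (c * (- 1 / c)) = 0"
    then obtain m :: int where m: "- 1 * q powi m = 1"
      using theta_zero_iff[of "-1"] assms by auto
    have "q powi m = - (- 1 * q powi m)" by simp
    hence "q powi m = -1" unfolding m .
    hence "q powi m * q powi m = 1" by simp
    hence "m + m = 0" using qpowi_add[of m m] qpowi_eq_1_iff[of "m + m"] by simp
    with m show False by simp
  qed
  moreover have "(\<lambda>w. theta (c * w)) holomorphic_on -{0}"
    using assms by (intro holomorphic_intros) auto
  ultimately obtain r where r: "r > 0" "ball p r \<subseteq> -{0}" "\<And>z. z \<in> ball p r - {p} \<Longrightarrow> theta (c * z) \<noteq> 0"
    using isolated_zeros[of "\<lambda>w. theta (c * w)" "-{0}" p "-1 / c"] True assms connected_punctured_universe[of "0::complex"]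
    by (simp add: open_delete) blast
  have "eventually (\<lambda>w. w \<in> ball p r - {p}) (at p)"
    using r by (intro eventually_at_in_open) auto
  thus ?thesis by eventually_elim (use r in auto)
qed

lemma eventually_pdom:
  assumes "p \<noteq> 0" "\<And>j. j < n \<Longrightarrow> y j \<noteq> 0"
  shows "eventually (\<lambda>w. w \<in> pdom y n) (at p)"
proof -
  have "eventually (\<lambda>w. \<forall>j\<in>{..<n}. theta (y j * w) \<noteq> 0) (at p)"
    using assms by (intro eventually_ball_finite ballI theta_eventually_nonzero) auto
  moreover have "eventually (\<lambda>w. w \<noteq> 0) (at p)"
    using assms(1) by (intro eventually_neq_at_within)
  ultimately show ?thesis by eventually_elim (auto simp: pdom_def)
qed

lemma theta_qpowi_zero_iff: "u \<noteq> 0 \<Longrightarrow> theta (q powi k * u) = 0 \<longleftrightarrow> theta u = 0"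
  using theta_shift_int[of k] by auto

lemma pdom_qpowi: "w \<in> pdom y n \<Longrightarrow> (\<And>j. j < n \<Longrightarrow> y j \<noteq> 0) \<Longrightarrow> q powi k * w \<in> pdom y n"
  using theta_qpowi_zero_iff[of "y _ * w" k] q_nz by (auto simp: pdom_def mult_ac)

section \<open>Liouville's theorem on the torus\<close>

lemma annulus_representative:
  assumes "w \<noteq> 0"
  shows "\<exists>m::int. norm q \<le> norm (q powi m * w) \<and> norm (q powi m * w) \<le> 1"
proof -
  define L where "L = - ln (norm q)"
  have L: "L > 0" using q_less q_nz by (simp add: L_def)
  define m where "m = \<lceil>ln (norm w) / L\<rceil>"
  have m: "ln (norm w) / L \<le> m" "m < ln (norm w) / L + 1" unfolding m_def by linarith+
  have "norm (q powi m * w) > 0" using assms q_nz by simp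
  have ln: "ln (norm (q powi m * w)) = - of_int m * L + ln (norm w)"
    using assms q_nz
    by (simp add: norm_mult ln_mult norm_power_int ln_powr L_def flip: powr_real_of_int')
  have "ln (norm (q powi m * w)) \<le> ln 1" "ln (norm q) \<le> ln (norm (q powi m * w))"
    unfolding ln using m L by (auto simp: L_def field_simps)
  thus ?thesis using assms q_nz by (subst (asm) (1 2) ln_le_cancel_iff) auto
qed

text \<open>Liouville's theorem on the torus \<open>\<complex>\<^sup>*/q\<^sup>\<int>\<close>: the removable extension, pulled back along \<open>exp\<close>,
  is entire and bounded by its values on a closed annulus.\<close>

lemma elliptic_constant:
  assumes hol: "f holomorphic_on pdom y n"
  and per: "\<And>w. w \<in> pdom y n \<Longrightarrow> f (q * w) = f w"
  and y: "\<And>j. j < n \<Longrightarrow> y j \<noteq> 0"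
  and res: "\<And>J. J < n \<Longrightarrow> ((\<lambda>w. (1 - y J * w) * f w) \<longlongrightarrow> 0) (at (1 / y J))"
  shows "\<exists>c. \<forall>w\<in>pdom y n. f w = c"
proof -
  have per': "f (q powi k * w) = f w" if w: "w \<in> pdom y n" for w k
  proof (induction k rule: int_induct[where k = 0])
    case (step1 i)
    have "f (q powi (i + 1) * w) = f (q * (q powi i * w))" by (simp add: qpowi_Suc mult_ac)
    thus ?case using step1 per[OF pdom_qpowi[OF w y]] by simp
  next
    case (step2 i)
    have "f (q powi i * w) = f (q * (q powi (i - 1) * w))"
      using qpowi_Suc[of "i - 1"] by (simp add: mult_ac)
    thus ?case using step2 per[OF pdom_qpowi[OF w y]] by simp
  qed auto
  \<comment> \<open>Taking limits defines the extension globally, without choosing among the local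
    extensions \<open>g\<close> constructed next.\<close>
  define F where "F = (\<lambda>p. Lim (at p) f)"
  have loc: "\<exists>e g. e > 0 \<and> ball p e \<subseteq> -{0} \<and> ball p e - {p} \<subseteq> pdom y n \<and> g holomorphic_on ball p e \<and>
      (\<forall>w\<in>ball p e - {p}. g w = f w) \<and> (p \<in> pdom y n \<longrightarrow> g p = f p)" if p: "p \<noteq> 0" for p
  proof (cases "p \<in> pdom y n")
    case True
    then obtain e where e: "e > 0" "ball p e \<subseteq> pdom y n"
      using open_pdom[of n y] y open_contains_ball by blast
    moreover have "0 \<notin> pdom y n" by (simp add: pdom_def)
    ultimately show ?thesis using hol
      by (intro exI[of _ e] exI[of _ f]) (blast intro: holomorphic_on_subset)
  next
    case False
    then obtain J where J: "J < n" "theta (y J * p) = 0" using p by (auto simp: pdom_def)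
    then obtain m :: int where m: "y J * p * q powi m = 1"
      using theta_zero_iff[of "y J * p"] y p by auto
    \<comment> \<open>Residues are controlled only at the points \<open>1 / y J\<close>; periodicity
      carries any other singularity p there.\<close>
    have qp: "q powi m * p = 1 / y J" using m y[OF J(1)] by (simp add: field_simps)
    have theta_det: "eventually (\<lambda>w. w \<in> pdom y n) (at p)" by (intro eventually_pdom p y)
    then obtain e0 where e0: "e0 > 0" "\<And>w. w \<noteq> p \<Longrightarrow> dist w p < e0 \<Longrightarrow> w \<in> pdom y n"
      unfolding eventually_at by auto
    define e where "e = min e0 (norm p)"
    have "w \<in> pdom y n" if "w \<in> ball p e - {p}" for w
      using that by (intro e0(2)) (auto simp: e_def dist_commute)
    hence "ball p e - {p} \<subseteq> pdom y n" by (rule subsetI)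
    moreover have "e > 0" "ball p e \<subseteq> -{0}"
      using e0(1) p by (auto simp: e_def)
    ultimately have e: "e > 0" "ball p e - {p} \<subseteq> pdom y n" "ball p e \<subseteq> -{0}" by blast+
    have "filterlim (\<lambda>w. q powi m * w) (at (1 / y J)) (at p)"
    proof (rule filterlim_atI)
      show "((\<lambda>w. q powi m * w) \<longlongrightarrow> 1 / y J) (at p)"
        unfolding qp[symmetric] by (intro tendsto_intros)
      show "\<forall>\<^sub>F w in at p. q powi m * w \<noteq> 1 / y J"
        unfolding qp[symmetric] using q_nz by (auto simp: eventually_at intro!: exI[of _ 1])
    qed
    from filterlim_compose[OF res[OF J(1)] this]
    have "((\<lambda>w. (1 - y J * (q powi m * w)) * f (q powi m * w)) \<longlongrightarrow> 0) (at p)" .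
    hence "((\<lambda>w. - (1 / (y J * q powi m)) * ((1 - y J * (q powi m * w)) * f (q powi m * w))) \<longlongrightarrow>
       - (1 / (y J * q powi m)) * 0) (at p)" by (intro tendsto_mult tendsto_const)
    moreover have "eventually (\<lambda>w. - (1 / (y J * q powi m)) * ((1 - y J * (q powi m * w)) * f (q powi m * w)) = (w - p) * f w) (at p)"
      using theta_det
    proof eventually_elim
      case (elim w)
      have "w - p = - (1 / (y J * q powi m)) * (1 - y J * (q powi m * w))"
      proof -
        have "w - p = - (1 / t) * (1 - t * w)" if "p * t = 1" for t
          using that by (cases "t = 0") (auto simp: field_simps)
        from this[of "y J * q powi m"] show ?thesis using m by (simp add: mult_ac)
      qed
      thus ?case by (simp only: per'[OF elim] mult.assoc)
    qed
    ultimately have "((\<lambda>w. (w - p) * f w) \<longlongrightarrow> 0) (at p)" by (simp add: tendsto_cong)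
    then obtain g where "g holomorphic_on ball p e" "\<forall>w\<in>ball p e - {p}. g w = f w"
      using holomorphic_on_extend_lim[of f "ball p e" p] holomorphic_on_subset[OF hol e(2)] e(1) by auto
    thus ?thesis using e False by blast
  qed
  have Fg: "F w = g w" if "e > 0" "ball p e - {p} \<subseteq> pdom y n" "g holomorphic_on ball p e"
    "\<And>w. w \<in> ball p e - {p} \<Longrightarrow> g w = f w" "w \<in> ball p e" for e g p w
  proof -
    have "isCont g w"
      using that by (meson continuous_on_eq_continuous_at holomorphic_on_imp_continuous_on open_ball)
    hence "(g \<longlongrightarrow> g w) (at w)" by (simp add: isCont_def)
    moreover have "eventually (\<lambda>u. g u = f u) (at w)"
    proof -
      have "eventually (\<lambda>u. u \<in> ball p e - {w}) (at w)"
        using that by (intro eventually_at_in_open) auto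
      moreover have "eventually (\<lambda>u. u \<noteq> p) (at w)" by (rule eventually_neq_at_within)
      ultimately show ?thesis by eventually_elim (use that in auto)
    qed
    ultimately have "(f \<longlongrightarrow> g w) (at w)" by (simp add: tendsto_cong)
    thus ?thesis unfolding F_def by (intro tendsto_Lim) auto
  qed
  have Ff: "F w = f w" if "w \<in> pdom y n" for w
  proof -
    have "w \<noteq> 0" using that by (auto simp: pdom_def)
    from loc[OF this] obtain e g where "e > 0" "ball w e - {w} \<subseteq> pdom y n" "g holomorphic_on ball w e"
      "\<forall>u\<in>ball w e - {w}. g u = f u" "w \<in> pdom y n \<longrightarrow> g w = f w" by (elim exE conjE) (rule that)
    thus ?thesis using Fg[of e w g w] that by simp
  qed
  have F_diff: "F field_differentiable at p" if p: "p \<noteq> 0" for p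
  proof -
    from loc[OF p] obtain e g where eg: "e > 0" "ball p e - {p} \<subseteq> pdom y n" "g holomorphic_on ball p e"
      "\<forall>u\<in>ball p e - {p}. g u = f u" by blast
    have "F holomorphic_on ball p e"
      using Fg[of e p g] eg by (subst holomorphic_cong[OF refl, of _ F g]) auto
    thus ?thesis using eg(1) by (auto intro!: holomorphic_on_imp_differentiable_at)
  qed
  hence F_hol: "F holomorphic_on -{0}"
    by (auto simp: holomorphic_on_def field_differentiable_at_within)
  define K where "K = cball (0::complex) 1 - ball 0 (norm q)"
  have K: "compact K" "K \<subseteq> -{0}" using q_nz by (auto simp: K_def intro: compact_diff)
  have "bounded (F ` K)"
    using K F_hol by (intro compact_imp_bounded compact_continuous_image)
      (auto intro: continuous_on_subset holomorphic_on_imp_continuous_on)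
  then obtain M where M: "\<And>w. w \<in> K \<Longrightarrow> norm (F w) \<le> M" by (auto simp: bounded_iff)
  have M': "norm (f w) \<le> M" if w: "w \<in> pdom y n" for w
  proof -
    have "w \<noteq> 0" using w by (auto simp: pdom_def)
    then obtain m :: int where "q powi m * w \<in> K"
    proof -
      obtain m :: int where "norm q \<le> norm (q powi m * w)" "norm (q powi m * w) \<le> 1"
        using annulus_representative[OF \<open>w \<noteq> 0\<close>] by blast
      thus ?thesis using that[of m] by (simp add: K_def not_less)
    qed
    from M[OF this] show ?thesis using Ff[OF pdom_qpowi[OF w y]] per'[OF w] by simp
  qed
  have M'': "norm (F w) \<le> M" if w: "w \<noteq> 0" for w
  proof -
    have "(F \<longlongrightarrow> F w) (at w)"
      using field_differentiable_imp_continuous_at[OF F_diff[OF w]] by (simp add: isCont_def)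
    hence "((\<lambda>u. norm (F u)) \<longlongrightarrow> norm (F w)) (at w)" by (rule tendsto_norm)
    moreover have "eventually (\<lambda>u. norm (F u) \<le> M) (at w)"
    proof -
      have "eventually (\<lambda>u. u \<in> pdom y n) (at w)" by (intro eventually_pdom w y)
      thus ?thesis by eventually_elim (auto simp: Ff M')
    qed
    ultimately show ?thesis by (rule tendsto_upperbound) auto
  qed
  have "(F \<circ> exp) holomorphic_on UNIV"
    using F_hol by (intro holomorphic_on_compose holomorphic_intros) (auto intro: holomorphic_on_subset)
  moreover have "bounded (range (F \<circ> exp))" using M'' by (auto simp: bounded_iff intro!: exI[of _ M])
  ultimately have "(F \<circ> exp) constant_on UNIV" by (rule Liouville_theorem)
  then obtain c where c: "\<And>s. F (exp s) = c" by (auto simp: constant_on_def)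
  have "f w = c" if "w \<in> pdom y n" for w
  proof -
    have "w \<noteq> 0" using that by (auto simp: pdom_def)
    thus ?thesis using c[of "ln w"] Ff[OF that] by simp
  qed
  thus ?thesis by blast
qed


section \<open>The two sides of the determinant evaluation\<close>

definition qratio :: "nat set \<Rightarrow> (nat \<Rightarrow> complex) \<Rightarrow> complex" where
  "qratio S x = (\<Prod>i\<in>S. \<Prod>j\<in>S-{i}. qi (q * x i / x j))"

lemma qratio_remove:
  assumes "finite S" "I \<in> S"
  shows "qratio S x = qratio (S - {I}) x * (\<Prod>i\<in>S-{I}. theta_hat (x I / x i))"
proof -
  have "qratio S x = (\<Prod>j\<in>S-{I}. qi (q * x I / x j)) * (\<Prod>i\<in>S-{I}. \<Prod>j\<in>S-{i}. qi (q * x i / x j))"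
    unfolding qratio_def using assms by (subst prod.remove[of S I]) auto
  also have "(\<Prod>i\<in>S-{I}. \<Prod>j\<in>S-{i}. qi (q * x i / x j)) =
      (\<Prod>i\<in>S-{I}. qi (q * x i / x I) * (\<Prod>j\<in>S-{I}-{i}. qi (q * x i / x j)))"
  proof (intro prod.cong refl)
    fix i assume "i \<in> S - {I}"
    thus "(\<Prod>j\<in>S-{i}. qi (q * x i / x j)) = qi (q * x i / x I) * (\<Prod>j\<in>S-{I}-{i}. qi (q * x i / x j))"
      using assms by (subst prod.remove[of "S - {i}" I]) (auto simp: Diff_insert2[symmetric] insert_commute)
  qed
  finally show ?thesis
    by (simp add: qratio_def theta_hat_def prod.distrib mult_ac)
qed

lemma qratio_reindex:
  assumes "bij_betw h T S"
  shows "qratio S x = qratio T (x \<circ> h)"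
proof -
  have "(\<Prod>j\<in>S-{h i}. qi (q * x (h i) / x j)) = (\<Prod>j\<in>T-{i}. qi (q * x (h i) / x (h j)))" if "i \<in> T" for i
  proof -
    have "bij_betw h (T - {i}) (S - {h i})"
      using assms that by (auto simp: bij_betw_def inj_on_def)
    thus ?thesis by (rule prod.reindex_bij_betw[symmetric])
  qed
  thus ?thesis unfolding qratio_def
    by (subst prod.reindex_bij_betw[OF assms, symmetric]) auto
qed

lemma qratio_cong: "(\<And>i. i \<in> S \<Longrightarrow> x i = y i) \<Longrightarrow> qratio S x = qratio S y"
  unfolding qratio_def by (intro prod.cong refl) auto

text \<open>For nonzero x the factor \<open>vdm n x * qratio {..<n} x\<close> is the product over i
  < j of \<open>x j * theta (x i / x j)\<close>. On the side of y the Vandermonde factor is absent;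
  \<open>sym_theta_det\<close> restores it. The power of \<open>qi q\<close> reflects that each
  residue step lowers n by one and splits off \<open>theta_hat 1 = (qi q)^2\<close>.\<close>

definition theta_det :: "nat \<Rightarrow> (nat \<Rightarrow> complex) \<Rightarrow> (nat \<Rightarrow> complex) \<Rightarrow> complex" where
  "theta_det n x y = theta ((\<Prod>i<n. x i) * (\<Prod>j<n. y j)) * (vdm n x * qratio {..<n} x) * qratio {..<n} y *
     qi q ^ (2 * (n - 1)) / (\<Prod>i<n. \<Prod>j<n. theta (y j * x i))"

lemma theta_det_coord:
  assumes I: "I < n" and x: "\<And>i. i < n \<Longrightarrow> i \<noteq> I \<Longrightarrow> x i \<noteq> 0"
  shows "\<exists>K. \<forall>w. theta_det n (x(I := w)) y = K * (theta (w * ((\<Prod>i\<in>{..<n}-{I}. x i) * (\<Prod>j<n. y j))) *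
     (\<Prod>i\<in>{..<n}-{I}. theta (w / x i)) / (\<Prod>j<n. theta (y j * w)))"
proof -
  let ?S = "{..<n} - {I}"
  obtain c where c: "\<And>w. vdm n (x(I := w)) = c * (\<Prod>i\<in>?S. x i - w)"
    using vdm_upd[OF I] by metis
  define K where "K = c * (\<Prod>i\<in>?S. x i) * qratio ?S x * qratio {..<n} y * qi q ^ (2 * (n - 1)) /
    (\<Prod>i\<in>?S. \<Prod>j<n. theta (y j * x i))"
  show ?thesis
  proof (intro exI[of _ K] allI)
    fix w
    have 1: "(\<Prod>i<n. (x(I := w)) i) = w * (\<Prod>i\<in>?S. x i)"
      using I by (subst prod.remove[of _ I]) auto
    have 2: "(\<Prod>i<n. \<Prod>j<n. theta (y j * (x(I := w)) i)) =
       (\<Prod>j<n. theta (y j * w)) * (\<Prod>i\<in>?S. \<Prod>j<n. theta (y j * x i))"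
      using I by (subst prod.remove[of _ I]) auto
    have 3: "qratio {..<n} (x(I := w)) = qratio ?S x * (\<Prod>i\<in>?S. theta_hat (w / x i))"
      using I by (subst qratio_remove[of _ I]) (auto intro!: arg_cong2[of _ _ _ _ "(*)"] qratio_cong prod.cong)
    have "(\<Prod>i\<in>?S. x i - w) * (\<Prod>i\<in>?S. theta_hat (w / x i)) = (\<Prod>i\<in>?S. x i) * (\<Prod>i\<in>?S. theta (w / x i))"
      unfolding prod.distrib[symmetric]
      by (intro prod.cong) (use x in \<open>auto simp: theta_eq field_simps\<close>)
    hence 4: "vdm n (x(I := w)) * qratio {..<n} (x(I := w)) =
       c * qratio ?S x * ((\<Prod>i\<in>?S. x i) * (\<Prod>i\<in>?S. theta (w / x i)))"
      unfolding c 3 by (simp add: mult_ac)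
    show "theta_det n (x(I := w)) y = K * (theta (w * ((\<Prod>i\<in>?S. x i) * (\<Prod>j<n. y j))) *
     (\<Prod>i\<in>?S. theta (w / x i)) / (\<Prod>j<n. theta (y j * w)))"
      unfolding theta_det_def 1 2 4 K_def by (simp add: mult_ac)
  qed
qed

text \<open>As a function of one coordinate there are n theta factors above and n below, and the
  coefficients of w in their arguments have equal products, so the multipliers of
  \<open>theta_shift\<close> cancel.\<close>

lemma theta_det_shift:
  assumes I: "I < n" and x: "\<And>i. i < n \<Longrightarrow> x i \<noteq> 0" and y: "\<And>j. j < n \<Longrightarrow> y j \<noteq> 0"
  shows "theta_det n (x(I := q * x I)) y = theta_det n x y"
proof -
  let ?S = "{..<n} - {I}"
  define X Y w where "X = (\<Prod>i\<in>?S. x i)" and "Y = (\<Prod>j<n. y j)" and "w = x I"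
  have nz: "X \<noteq> 0" "Y \<noteq> 0" "w \<noteq> 0" using x y I by (auto simp: X_def Y_def w_def)
  obtain K where K: "\<And>w. theta_det n (x(I := w)) y = K * (theta (w * (X * Y)) *
     (\<Prod>i\<in>?S. theta (w / x i)) / (\<Prod>j<n. theta (y j * w)))"
    using theta_det_coord[OF I, of x y] x unfolding X_def Y_def by blast
  have 1: "theta (q * w * (X * Y)) = (-1 / (w * (X * Y))) * theta (w * (X * Y))"
    using theta_shift[of "w * (X * Y)"] nz by (simp add: mult.assoc)
  have "(\<Prod>i\<in>?S. theta (q * w / x i)) = (\<Prod>i\<in>?S. (-1 / w) * x i * theta (w / x i))"
    using theta_shift[of "w / x _"] x nz by (intro prod.cong) auto
  also have "\<dots> = (-1 / w) ^ (n - 1) * X * (\<Prod>i\<in>?S. theta (w / x i))"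
    unfolding prod.distrib X_def using I by simp
  finally have 2: "(\<Prod>i\<in>?S. theta (q * w / x i)) = \<dots>" .
  have "(\<Prod>j<n. theta (y j * (q * w))) = (\<Prod>j<n. (-1 / w) * (1 / y j) * theta (y j * w))"
    using theta_shift[of "y _ * w"] y nz by (intro prod.cong) (auto simp: mult_ac)
  also have "\<dots> = (-1 / w) ^ n * (1 / Y) * (\<Prod>j<n. theta (y j * w))"
    unfolding prod.distrib Y_def by (simp add: prod_dividef)
  also have "(-1 / w) ^ n = (-1 / w) ^ (n - 1) * (-1 / w)"
    using I by (cases n) auto
  finally have 3: "(\<Prod>j<n. theta (y j * (q * w))) = (-1 / w) ^ (n - 1) * (-1 / w) * (1 / Y) * (\<Prod>j<n. theta (y j * w))" .
  have "theta_det n (x(I := q * w)) y = theta_det n (x(I := w)) y"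
  proof -
    have "(-1 / w) ^ (n - 1) \<noteq> 0" using nz by simp
    thus ?thesis unfolding K 1 2 3 using nz by (simp add: field_simps)
  qed
  thus ?thesis by (simp add: w_def)
qed

text \<open>Column 0 stands for the polynomial column: divided by its own denominator it becomes
  constant.\<close>

definition qsum_det :: "nat \<Rightarrow> (nat \<Rightarrow> complex) \<Rightarrow> (nat \<Rightarrow> complex) \<Rightarrow> complex" where
  "qsum_det n x y = detf n (\<lambda>i m. if m = 0 then 1 else qsum y n m (x i))"

definition skip :: "nat \<Rightarrow> nat \<Rightarrow> nat" where
  "skip J j = (if j < J then j else Suc j)"

lemma bij_betw_skip: "J < Suc n \<Longrightarrow> bij_betw (skip J) {..<n} ({..<Suc n} - {J})"
  by (intro bij_betwI[of _ _ _ "\<lambda>j. if j < J then j else j - 1"]) (auto simp: skip_def split: if_splits)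

lemma den_skip:
  assumes "J < Suc n"
  shows "den y (Suc n) z = (1 - y J * z) * den (y \<circ> skip J) n z"
proof -
  have "den y (Suc n) z = (1 - y J * z) * (\<Prod>j\<in>{..<Suc n}-{J}. 1 - y j * z)"
    unfolding den_def using assms by (subst prod.remove[of _ J]) auto
  also have "(\<Prod>j\<in>{..<Suc n}-{J}. 1 - y j * z) = den (y \<circ> skip J) n z"
    unfolding den_def by (subst prod.reindex_bij_betw[OF bij_betw_skip[OF assms], symmetric]) simp
  finally show ?thesis .
qed

text \<open>In each term the numerator \<open>z^m * (1 - y J * z)\<close> cancels one factor of the
  denominator. Taken as a column operation, this leads from n + 1 parameters to n in the
  induction.\<close>

lemma qsum_skip:
  assumes w: "w \<in> pdom y (Suc n)" and y: "\<And>j. j < Suc n \<Longrightarrow> y j \<noteq> 0" and J: "J < Suc n"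
  and m: "1 \<le> m" "m < n"
  shows "qsum y (Suc n) m w - y J * qsum y (Suc n) (Suc m) w = qsum (y \<circ> skip J) n m w"
proof -
  let ?t = "\<lambda>m k. (w * q powi k) ^ m / den y (Suc n) (w * q powi k)"
  have s: "?t m summable_on UNIV" "?t (Suc m) summable_on UNIV"
    using abs_summable_summable[OF abs_summable_qsum[OF w y, of m]]
      abs_summable_summable[OF abs_summable_qsum[OF w y, of "Suc m"]] m
    by (simp_all del: power_Suc)
  have "qsum y (Suc n) m w - y J * qsum y (Suc n) (Suc m) w = (\<Sum>\<^sub>\<infinity>k. ?t m k - y J * ?t (Suc m) k)"
  proof -
    have "((\<lambda>k. ?t m k + - y J * ?t (Suc m) k) has_sum
        (qsum y (Suc n) m w + - y J * qsum y (Suc n) (Suc m) w)) UNIV"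
      unfolding qsum_def by (intro has_sum_add has_sum_cmult_right has_sum_infsum s)
    thus ?thesis by (simp add: infsumI)
  qed
  also have "\<dots> = qsum (y \<circ> skip J) n m w"
    unfolding qsum_def
  proof (rule infsum_cong)
    fix k
    define z where "z = w * q powi k"
    have "den y (Suc n) z \<noteq> 0" unfolding z_def by (intro den_nonzero w y)
    hence "1 - y J * z \<noteq> 0" "den (y \<circ> skip J) n z \<noteq> 0" unfolding den_skip[OF J] by auto
    moreover have "z ^ m / (a * d) - y J * (z ^ Suc m / (a * d)) = z ^ m / d"
      if "a \<noteq> 0" "d \<noteq> 0" "a = 1 - y J * z" for a d
    proof -
      have "z ^ m / (a * d) - y J * (z ^ Suc m / (a * d)) = (a * z ^ m) / (a * d)"
        unfolding that(3) by (simp add: algebra_simps diff_divide_distrib)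
      thus ?thesis using that(1) by simp
    qed
    ultimately show "?t m k - y J * ?t (Suc m) k = (w * q powi k) ^ m / den (y \<circ> skip J) n (w * q powi k)"
      unfolding z_def[symmetric] den_skip[OF J] by blast
  qed
  finally show ?thesis .
qed

text \<open>The matrix on the left is the residue at \<open>1 / y J\<close>, in the variable \<open>x 0\<close>, of the one defining \<open>qsum_det\<close>.\<close>

lemma detf_residue:
  assumes x: "\<And>i. i < n \<Longrightarrow> x (Suc i) \<in> pdom y (Suc n)" and y: "\<And>j. j < Suc n \<Longrightarrow> y j \<noteq> 0"
  and J: "J < Suc n" and n: "n \<ge> 1"
  shows "detf (Suc n) (\<lambda>i m. if i = 0 then (if m = 0 then 0 else \<rho> * (1 / y J) ^ m)
      else (if m = 0 then 1 else qsum y (Suc n) m (x i))) = \<rho> * (- 1 / y J) ^ n * qsum_det n (\<lambda>i. x (Suc i)) (y \<circ> skip J)"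
proof -
  define v where "v = 1 / y J"
  have v: "v \<noteq> 0" using y[OF J] by (simp add: v_def)
  define M where "M = (\<lambda>i m. if i = 0 then (if m = 0 then 0 else \<rho> * v ^ m)
      else (if m = 0 then 1 else qsum y (Suc n) m (x i)))"
  \<comment> \<open>A column operation: each column \<open>m >= 2\<close> becomes column
    \<open>m - 1\<close> minus \<open>y J\<close> times column m. The geometric first row vanishes
    there, and the other rows lose the parameter \<open>y J\<close> by
    \<open>qsum_skip\<close>.\<close>
  define E where "E = (\<lambda>l m::nat. if l = m then (if m \<le> 1 then 1 else - 1 / v) else if Suc l = m \<and> m \<ge> 2 then 1 else 0)"
  define ME where "ME = (\<lambda>i m. \<Sum>l<Suc n. M i l * E l m)"
  have ME1: "ME i m = M i m" if "m \<le> 1" "m < Suc n" for i m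
  proof -
    have "ME i m = (\<Sum>l\<in>{m}. M i l * E l m)"
      unfolding ME_def using that by (intro sum.mono_neutral_right) (auto simp: E_def)
    thus ?thesis using that by (simp add: E_def)
  qed
  have ME2: "ME i (Suc m) = M i m - M i (Suc m) / v" if "m \<ge> 1" "Suc m < Suc n" for i m
  proof -
    have "ME i (Suc m) = (\<Sum>l\<in>{m, Suc m}. M i l * E l (Suc m))"
      unfolding ME_def using that by (intro sum.mono_neutral_right) (auto simp: E_def)
    thus ?thesis using that by (simp add: E_def)
  qed
  have row0: "ME 0 m = 0" if "m < Suc n" "m \<noteq> 1" for m
  proof (cases m)
    case (Suc m')
    thus ?thesis using that ME2[of m' 0] v by (simp add: M_def)
  qed (use ME1[of 0 0] in \<open>simp add: M_def\<close>)
  have detE: "detf (Suc n) E = (- 1 / v) ^ (n - 1)"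
  proof -
    have "detf (Suc n) E = (\<Prod>i<Suc n. E i i)"
      by (intro detf_upper_triangular) (auto simp: E_def)
    also have "\<dots> = (\<Prod>i\<in>{2..<Suc n}. E i i)"
      by (intro prod.mono_neutral_right) (auto simp: E_def)
    also have "\<dots> = (\<Prod>i\<in>{2..<Suc n}. - 1 / v)"
      by (intro prod.cong) (auto simp: E_def)
    finally show ?thesis by simp
  qed
  have "detf (Suc n) M * (- 1 / v) ^ (n - 1) = detf (Suc n) ME"
    unfolding detE[symmetric] detf_mult[symmetric] ME_def ..
  also have "\<dots> = - ME 0 1 * detf n (\<lambda>i j. ME (Suc i) (if j = 0 then 0 else Suc j))"
    using n row0 by (intro detf_expand_first_row) auto
  also have "ME 0 1 = \<rho> * v" using ME1[of 1 0] n by (simp add: M_def)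
  also have "detf n (\<lambda>i j. ME (Suc i) (if j = 0 then 0 else Suc j)) = qsum_det n (\<lambda>i. x (Suc i)) (y \<circ> skip J)"
    unfolding qsum_det_def
  proof (intro detf_cong)
    fix i j assume ij: "i < n" "j < n"
    show "ME (Suc i) (if j = 0 then 0 else Suc j) = (if j = 0 then 1 else qsum (y \<circ> skip J) n j (x (Suc i)))"
    proof (cases "j = 0")
      case True
      thus ?thesis using ME1[of 0 "Suc i"] by (simp add: M_def)
    next
      case False
      thus ?thesis using ME2[of j "Suc i"] qsum_skip[OF x[OF ij(1)] y J, of j] ij
        by (simp add: M_def v_def mult.commute)
    qed
  qed
  finally have *: "detf (Suc n) M * (- 1 / v) ^ (n - 1) = - (\<rho> * v) * qsum_det n (\<lambda>i. x (Suc i)) (y \<circ> skip J)" .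
  have inv: "(- 1 / v) ^ (n - 1) * (- v) ^ (n - 1) = 1"
    using v by (simp flip: power_mult_distrib)
  have "detf (Suc n) M = detf (Suc n) M * (- 1 / v) ^ (n - 1) * (- v) ^ (n - 1)"
    using inv by (simp add: mult.assoc)
  also have "\<dots> = \<rho> * ((- v) ^ (n - 1) * (- v)) * qsum_det n (\<lambda>i. x (Suc i)) (y \<circ> skip J)"
    unfolding * by simp
  also have "(- v) ^ (n - 1) * (- v) = (- v) ^ n" using n by (cases n) auto
  finally show ?thesis unfolding M_def v_def minus_divide_left .
qed


text \<open>The same cofactors of row 0 describe the determinant as a function of \<open>x 0\<close>
  and the matrix of its residues, so limits may be taken entry by entry.\<close>

lemma qsum_det_upd0:
  obtains c where "\<And>w. qsum_det (Suc n) (x(0 := w)) y = (\<Sum>m<Suc n. (if m = 0 then 1 else qsum y (Suc n) m w) * c m)"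
    and "\<And>f. detf (Suc n) (\<lambda>i m. if i = 0 then f m else (if m = 0 then 1 else qsum y (Suc n) m (x i))) = (\<Sum>m<Suc n. f m * c m)"
proof -
  define M where "M = (\<lambda>i m. if m = 0 then 1 else qsum y (Suc n) m (x i))"
  obtain c where c: "\<And>f. detf (Suc n) (\<lambda>i m. if i = 0 then f m else M i m) = (\<Sum>m<Suc n. f m * c m)"
    using detf_row_linear[of 0 "Suc n" M] by blast
  have "qsum_det (Suc n) (x(0 := w)) y = (\<Sum>m<Suc n. (if m = 0 then 1 else qsum y (Suc n) m w) * c m)" for w
    unfolding qsum_det_def c[symmetric] by (intro detf_cong) (auto simp: M_def)
  with c show ?thesis using that unfolding M_def by blast
qed

text \<open>Written so that the factor \<open>1 - y J * w\<close>, the only source of the pole at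
  \<open>1 / y J\<close>, stands alone in the denominator.\<close>

lemma theta_det_upd0:
  assumes x: "\<And>i. i < n \<Longrightarrow> x (Suc i) \<noteq> 0" and J: "J < Suc n"
  shows "theta_det (Suc n) (x(0 := w)) y =
     theta (w * ((\<Prod>i<n. x (Suc i)) * (\<Prod>j<Suc n. y j))) * (\<Prod>i<n. x (Suc i) * theta (w / x (Suc i))) *
     (vdm n (\<lambda>i. x (Suc i)) * qratio {..<n} (\<lambda>i. x (Suc i))) * (qratio {..<n} (y \<circ> skip J) * (\<Prod>j<n. theta_hat (y J / y (skip J j)))) *
     qi q ^ (2 * n) / (((1 - y J * w) * theta_hat (y J * w) * (\<Prod>j<n. theta (y (skip J j) * w))) *
       ((\<Prod>i<n. theta (y J * x (Suc i))) * (\<Prod>i<n. \<Prod>j<n. theta (y (skip J j) * x (Suc i)))))"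
proof -
  let ?S = "{..<Suc n} - {J}"
  note bij = bij_betw_skip[OF J]
  have split: "(\<Prod>j<Suc n. g j) = g J * (\<Prod>j<n. g (skip J j))" for g :: "nat \<Rightarrow> complex"
    using J by (subst prod.remove[of _ J]) (auto simp: prod.reindex_bij_betw[OF bij, symmetric])
  have 0: "{..<Suc n} - {0} = Suc ` {..<n}"
    unfolding image_Suc_lessThan by auto
  have bij0: "bij_betw Suc {..<n} ({..<Suc n} - {0})"
    unfolding 0 by (simp add: bij_betw_def)
  have 1: "(\<Prod>i<Suc n. (x(0 := w)) i) = w * (\<Prod>i<n. x (Suc i))"
    unfolding prod.lessThan_Suc_shift by simp
  have 2: "(\<Prod>i<Suc n. \<Prod>j<Suc n. theta (y j * (x(0 := w)) i)) =
      ((1 - y J * w) * theta_hat (y J * w) * (\<Prod>j<n. theta (y (skip J j) * w))) *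
       ((\<Prod>i<n. theta (y J * x (Suc i))) * (\<Prod>i<n. \<Prod>j<n. theta (y (skip J j) * x (Suc i))))"
  proof -
    have "(\<Prod>j<Suc n. theta (y j * z)) = theta (y J * z) * (\<Prod>j<n. theta (y (skip J j) * z))" for z
      by (rule split)
    thus ?thesis
      by (simp only:) (simp only: prod.lessThan_Suc_shift, simp add: prod.distrib theta_eq[of "w * y J"] mult_ac)
  qed
  have 3: "qratio {..<Suc n} y = qratio {..<n} (y \<circ> skip J) * (\<Prod>j<n. theta_hat (y J / y (skip J j)))"
    using J by (subst qratio_remove[of _ J])
      (auto simp: qratio_reindex[OF bij] prod.reindex_bij_betw[OF bij, symmetric])
  have 4: "qratio {..<Suc n} (x(0 := w)) = qratio {..<n} (\<lambda>i. x (Suc i)) * (\<Prod>i<n. theta_hat (w / x (Suc i)))"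
    by (subst qratio_remove[of _ 0]) (auto simp: qratio_reindex[OF bij0] prod.reindex_bij_betw[OF bij0, symmetric] o_def)
  have 5: "vdm (Suc n) (x(0 := w)) = (\<Prod>i<n. x (Suc i) - w) * vdm n (\<lambda>i. x (Suc i))"
    unfolding vdm_Suc_shift by simp
  have 6: "(\<Prod>i<n. x (Suc i) - w) * (\<Prod>i<n. theta_hat (w / x (Suc i))) = (\<Prod>i<n. x (Suc i) * theta (w / x (Suc i)))"
    unfolding prod.distrib[symmetric] by (intro prod.cong) (use x in \<open>auto simp: theta_eq field_simps\<close>)
  have 7: "vdm (Suc n) (x(0 := w)) * qratio {..<Suc n} (x(0 := w)) =
     (\<Prod>i<n. x (Suc i) * theta (w / x (Suc i))) * (vdm n (\<lambda>i. x (Suc i)) * qratio {..<n} (\<lambda>i. x (Suc i)))"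
    unfolding 4 5 6[symmetric] by (simp add: mult_ac)
  show ?thesis
    unfolding theta_det_def 1 2 3 7 by (simp add: mult_ac)
qed

text \<open>At \<open>w = 1 / y J\<close> the parameter \<open>y J\<close> drops out of the theta
  factor of the full product. By inversion \<open>theta (w / x i)\<close> becomes a multiple of
  \<open>theta (y J * x i)\<close> and cancels against the denominator, and
  \<open>theta_hat 1\<close> lowers the exponent of \<open>qi q\<close> by 2. What is left is the
  expression for n with \<open>x 0\<close> and \<open>y J\<close> removed.\<close>

lemma theta_det_residue:
  assumes x: "\<And>i. i < n \<Longrightarrow> x (Suc i) \<in> pdom y (Suc n)" and y: "\<And>j. j < Suc n \<Longrightarrow> y j \<noteq> 0"
  and J: "J < Suc n" and n: "n \<ge> 1"
  and sep: "\<And>j k. j < Suc n \<Longrightarrow> j \<noteq> J \<Longrightarrow> y j / y J * q powi k \<noteq> 1"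
  shows "((\<lambda>w. (1 - y J * w) * theta_det (Suc n) (x(0 := w)) y) \<longlongrightarrow>
     1 / (\<Prod>j<n. 1 - y (skip J j) / y J) * (- 1 / y J) ^ n * theta_det n (\<lambda>i. x (Suc i)) (y \<circ> skip J)) (at (1 / y J))"
proof -
  define v where "v = 1 / y J"
  have v: "v \<noteq> 0" "y J * v = 1" using y[OF J] by (auto simp: v_def)
  have skip: "skip J j < Suc n" "skip J j \<noteq> J" if "j < n" for j using that by (auto simp: skip_def)
  have x0: "x (Suc i) \<noteq> 0" "theta (y j * x (Suc i)) \<noteq> 0" if "i < n" "j < Suc n" for i j
    using x[OF that(1)] that by (auto simp: pdom_def)
  define A where "A = (vdm n (\<lambda>i. x (Suc i)) * qratio {..<n} (\<lambda>i. x (Suc i)))"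
  define B where "B = qratio {..<n} (y \<circ> skip J)"
  define D where "D = (\<Prod>i<n. \<Prod>j<n. theta (y (skip J j) * x (Suc i)))"
  define g where "g = (\<lambda>w. theta (w * ((\<Prod>i<n. x (Suc i)) * (\<Prod>j<Suc n. y j))) * (\<Prod>i<n. x (Suc i) * theta (w / x (Suc i))) *
     A * (B * (\<Prod>j<n. theta_hat (y J / y (skip J j)))) *
     qi q ^ (2 * n) / ((theta_hat (y J * w) * (\<Prod>j<n. theta (y (skip J j) * w))) * ((\<Prod>i<n. theta (y J * x (Suc i))) * D)))"
  have thnz: "theta (y (skip J j) * v) \<noteq> 0" if "j < n" for j
    using theta_zero_iff[of "y (skip J j) * v"] sep[OF skip[OF that]] y[OF skip(1)[OF that]] v by (auto simp: v_def)
  have P0: "(\<Prod>i<n. x (Suc i)) * (\<Prod>j<Suc n. y j) \<noteq> 0" using x0 y by auto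
  have lim: "(g \<longlongrightarrow> g v) (at v)"
  proof -
    have tt: "((\<lambda>w. theta (f w)) \<longlongrightarrow> theta l) (at v)" if "(f \<longlongrightarrow> l) (at v)" "l \<noteq> 0" for f l
      unfolding theta_def using that by (intro tendsto_intros)
    have th: "((\<lambda>w. theta_hat (f w)) \<longlongrightarrow> theta_hat l) (at v)" if "(f \<longlongrightarrow> l) (at v)" "l \<noteq> 0" for f l
      unfolding theta_hat_def using that by (intro tendsto_intros)
    have "D \<noteq> 0" "(\<Prod>i<n. theta (y J * x (Suc i))) \<noteq> 0" unfolding D_def using x0 skip J by auto
    moreover have "theta_hat (y J * v) \<noteq> 0" unfolding v theta_hat_one using qinf_q_nonzero by simp
    ultimately show ?thesis
      unfolding g_def using thnz v P0 x0(1)[OF _ J] y skip J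
      by (intro tendsto_intros tt th) auto
  qed
  have "eventually (\<lambda>w. w \<noteq> v) (at v)" by (rule eventually_neq_at_within)
  hence "eventually (\<lambda>w. g w = (1 - y J * w) * theta_det (Suc n) (x(0 := w)) y) (at v)"
  proof eventually_elim
    case (elim w)
    hence nz: "1 - y J * w \<noteq> 0" using v y[OF J] by (auto simp: v_def field_simps)
    have h: "a * (p / ((a * t * s) * m)) = p / ((t * s) * m)" if "a \<noteq> 0" for a p t s m :: complex
      using that by simp
    have e: "theta_det (Suc n) (x(0 := w)) y =
     theta (w * ((\<Prod>i<n. x (Suc i)) * (\<Prod>j<Suc n. y j))) * (\<Prod>i<n. x (Suc i) * theta (w / x (Suc i))) *
     A * (B * (\<Prod>j<n. theta_hat (y J / y (skip J j)))) *
     qi q ^ (2 * n) / (((1 - y J * w) * theta_hat (y J * w) * (\<Prod>j<n. theta (y (skip J j) * w))) *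
       ((\<Prod>i<n. theta (y J * x (Suc i))) * D))"
      unfolding A_def B_def D_def using x0(1) J by (intro theta_det_upd0) auto
    show ?case unfolding g_def e by (rule h[OF nz, symmetric])
  qed
  hence lim': "((\<lambda>w. (1 - y J * w) * theta_det (Suc n) (x(0 := w)) y) \<longlongrightarrow> g v) (at v)"
    using lim by (simp add: tendsto_cong)
  have "theta (v * ((\<Prod>i<n. x (Suc i)) * (\<Prod>j<Suc n. y j))) = theta ((\<Prod>i<n. x (Suc i)) * (\<Prod>j<n. y (skip J j)))"
  proof -
    have "(\<Prod>j<Suc n. y j) = y J * (\<Prod>j<n. y (skip J j))"
      using J by (subst prod.remove[of _ J]) (auto simp: prod.reindex_bij_betw[OF bij_betw_skip[OF J], symmetric])
    thus ?thesis using v by (simp add: v_def)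
  qed
  moreover have "(\<Prod>i<n. x (Suc i) * theta (v / x (Suc i))) = (- v) ^ n * (\<Prod>i<n. theta (y J * x (Suc i)))"
  proof -
    have "x (Suc i) * theta (v / x (Suc i)) = - v * theta (y J * x (Suc i))" if "i < n" for i
      using theta_inverse[of "y J * x (Suc i)"] x0(1)[OF that J] y[OF J] by (simp add: v_def field_simps)
    hence "(\<Prod>i<n. x (Suc i) * theta (v / x (Suc i))) = (\<Prod>i<n. - v * theta (y J * x (Suc i)))"
      by (intro prod.cong) auto
    thus ?thesis unfolding prod.distrib by simp
  qed
  moreover have "(\<Prod>j<n. theta (y (skip J j) * v)) = (\<Prod>j<n. 1 - y (skip J j) / y J) * (\<Prod>j<n. theta_hat (y J / y (skip J j)))"
    unfolding prod.distrib[symmetric]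
  proof (intro prod.cong refl)
    fix j assume "j \<in> {..<n}"
    show "theta (y (skip J j) * v) = (1 - y (skip J j) / y J) * theta_hat (y J / y (skip J j))"
      using theta_hat_inverse[of "y J / y (skip J j)"] by (simp add: theta_eq v_def)
  qed
  ultimately have gv: "g v = theta ((\<Prod>i<n. x (Suc i)) * (\<Prod>j<n. y (skip J j))) * ((- v) ^ n * (\<Prod>i<n. theta (y J * x (Suc i)))) *
     A * (B * (\<Prod>j<n. theta_hat (y J / y (skip J j)))) * qi q ^ (2 * n) /
     (((qi q)\<^sup>2 * ((\<Prod>j<n. 1 - y (skip J j) / y J) * (\<Prod>j<n. theta_hat (y J / y (skip J j))))) * ((\<Prod>i<n. theta (y J * x (Suc i))) * D))"
    unfolding g_def v(2) theta_hat_one by simp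
  have nz: "(\<Prod>i<n. theta (y J * x (Suc i))) \<noteq> 0" "(\<Prod>j<n. theta_hat (y J / y (skip J j))) \<noteq> 0"
  proof -
    show "(\<Prod>i<n. theta (y J * x (Suc i))) \<noteq> 0" using x0 J by auto
    have "theta_hat (y J / y (skip J j)) \<noteq> 0" if "j < n" for j
      using thnz[OF that] theta_hat_inverse[of "y J / y (skip J j)"] by (auto simp: theta_eq v_def)
    thus "(\<Prod>j<n. theta_hat (y J / y (skip J j))) \<noteq> 0" by auto
  qed
  have Q: "qi q ^ (2 * n) = (qi q)\<^sup>2 * qi q ^ (2 * (n - 1))"
    unfolding power_add[symmetric] using n by (intro arg_cong[of _ _ "\<lambda>k. qi q ^ k"]) auto
  have "g v = 1 / (\<Prod>j<n. 1 - y (skip J j) / y J) * (- v) ^ n *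
    (theta ((\<Prod>i<n. x (Suc i)) * (\<Prod>j<n. y (skip J j))) * A * B * qi q ^ (2 * (n - 1)) / D)"
  proof -
    have "T * (vn * P) * A * (B * H) * (Q2 * Qr) / ((Q2 * (R * H)) * (P * D)) = 1 / R * vn * (T * A * B * Qr / D)"
      if "P \<noteq> 0" "H \<noteq> 0" "Q2 \<noteq> 0" for T vn P H Q2 Qr R :: complex
      using that by (cases "R = 0"; cases "D = 0") (auto simp: field_simps)
    thus ?thesis unfolding gv Q using nz qinf_q_nonzero by simp
  qed
  also have "\<dots> = 1 / (\<Prod>j<n. 1 - y (skip J j) / y J) * (- v) ^ n * theta_det n (\<lambda>i. x (Suc i)) (y \<circ> skip J)"
    unfolding theta_det_def A_def B_def D_def by simp
  finally show ?thesis using lim' unfolding v_def by simp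
qed

text \<open>An elliptic form of the Cauchy determinant: in \<open>x 0\<close> both sides are elliptic with the same
  residues at the points \<open>1 / y J\<close>, by induction, and both vanish at \<open>x 0 = x 1\<close>.\<close>

theorem qsum_det_eq_theta_det:
  assumes "n \<ge> 1" "\<And>j. j < n \<Longrightarrow> y j \<noteq> 0" "\<And>i. i < n \<Longrightarrow> x i \<in> pdom y n"
  and "\<And>i j k. i < n \<Longrightarrow> j < n \<Longrightarrow> i \<noteq> j \<Longrightarrow> y i / y j * q powi k \<noteq> 1"
  shows "qsum_det n x y = theta_det n x y"
  using assms
proof (induction n arbitrary: x y rule: dec_induct)
  case base
  have "theta (y 0 * x 0) \<noteq> 0" using base.prems by (auto simp: pdom_def)
  moreover have "qsum_det 1 x y = 1"
    unfolding qsum_det_def by (subst detf_upper_triangular) auto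
  ultimately show ?case by (simp add: theta_det_def vdm_def qratio_def lessThan_Suc mult.commute)
next
  case (step n x y)
  note y = step.prems(1) and xd = step.prems(2) and sep = step.prems(3)
  have n: "n \<ge> 1" using step.hyps by simp
  let ?D = "pdom y (Suc n)"
  have xnz: "x i \<noteq> 0" if "i < Suc n" for i using xd[OF that] by (simp add: pdom_def)
  obtain c where c: "\<And>w. qsum_det (Suc n) (x(0 := w)) y = (\<Sum>m<Suc n. (if m = 0 then 1 else qsum y (Suc n) m w) * c m)"
    and cf: "\<And>f. detf (Suc n) (\<lambda>i m. if i = 0 then f m else (if m = 0 then 1 else qsum y (Suc n) m (x i))) = (\<Sum>m<Suc n. f m * c m)"
    by (rule qsum_det_upd0[of n x y], rule that, assumption+)
  define f where "f = (\<lambda>w. qsum_det (Suc n) (x(0 := w)) y - theta_det (Suc n) (x(0 := w)) y)"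
  have "\<exists>c. \<forall>w\<in>?D. f w = c"
  proof (rule elliptic_constant)
    show "f holomorphic_on ?D"
    proof -
      have 1: "(\<lambda>w. qsum_det (Suc n) (x(0 := w)) y) holomorphic_on ?D"
        unfolding c
      proof (intro holomorphic_intros)
        fix m assume "m \<in> {..<Suc n}"
        thus "(\<lambda>w. if m = 0 then 1 else qsum y (Suc n) m w) holomorphic_on ?D"
          using holomorphic_qsum[of "Suc n" y m] y by (cases "m = 0") auto
      qed
      obtain K where K: "\<And>w. theta_det (Suc n) (x(0 := w)) y = K * (theta (w * ((\<Prod>i\<in>{..<Suc n}-{0}. x i) * (\<Prod>j<Suc n. y j))) *
         (\<Prod>i\<in>{..<Suc n}-{0}. theta (w / x i)) / (\<Prod>j<Suc n. theta (y j * w)))"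
        using theta_det_coord[of 0 "Suc n" x y] xnz by auto
      have "(\<lambda>w. theta_det (Suc n) (x(0 := w)) y) holomorphic_on ?D"
        unfolding K using xnz y by (intro holomorphic_intros) (auto simp: pdom_def)
      with 1 show ?thesis unfolding f_def by (intro holomorphic_intros)
    qed
  next
    fix w assume w: "w \<in> ?D"
    have "w \<noteq> 0" using w by (simp add: pdom_def)
    have "theta_det (Suc n) (x(0 := q * w)) y = theta_det (Suc n) (x(0 := w)) y"
      using theta_det_shift[of 0 "Suc n" "x(0 := w)" y] xnz y \<open>w \<noteq> 0\<close> by simp
    moreover have "qsum_det (Suc n) (x(0 := q * w)) y = qsum_det (Suc n) (x(0 := w)) y"
      unfolding c qsum_shift ..
    ultimately show "f (q * w) = f w" by (simp add: f_def)
  next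
    fix J assume J: "J < Suc n"
    define \<rho> where "\<rho> = 1 / (\<Prod>j<n. 1 - y (skip J j) / y J)"
    have \<rho>: "1 / (\<Prod>j\<in>{..<Suc n}-{J}. 1 - y j / y J) = \<rho>"
      unfolding \<rho>_def by (subst prod.reindex_bij_betw[OF bij_betw_skip[OF J], symmetric]) simp
    have IH: "qsum_det n (\<lambda>i. x (Suc i)) (y \<circ> skip J) = theta_det n (\<lambda>i. x (Suc i)) (y \<circ> skip J)"
    proof (rule step.IH)
      show "(y \<circ> skip J) j \<noteq> 0" if "j < n" for j using y that by (auto simp: skip_def)
      show "x (Suc i) \<in> pdom (y \<circ> skip J) n" if "i < n" for i
        using xd[of "Suc i"] that by (auto simp: pdom_def skip_def)
      show "(y \<circ> skip J) i / (y \<circ> skip J) j * q powi k \<noteq> 1" if "i < n" "j < n" "i \<noteq> j" for i j k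
        using sep[of "skip J i" "skip J j" k] that by (auto simp: skip_def split: if_splits)
    qed
    have "((\<lambda>w. \<Sum>m<Suc n. ((1 - y J * w) * (if m = 0 then 1 else qsum y (Suc n) m w)) * c m) \<longlongrightarrow>
        (\<Sum>m<Suc n. (if m = 0 then 0 else \<rho> * (1 / y J) ^ m) * c m)) (at (1 / y J))"
    proof (intro tendsto_sum tendsto_mult_right)
      fix m assume m: "m \<in> {..<Suc n}"
      show "((\<lambda>w. (1 - y J * w) * (if m = 0 then 1 else qsum y (Suc n) m w)) \<longlongrightarrow>
        (if m = 0 then 0 else \<rho> * (1 / y J) ^ m)) (at (1 / y J))"
      proof (cases "m = 0")
        case True
        have "((\<lambda>w. 1 - y J * w) \<longlongrightarrow> 1 - y J * (1 / y J)) (at (1 / y J))" by (intro tendsto_intros)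
        thus ?thesis using True y[OF J] by simp
      next
        case False
        have "((\<lambda>w. (1 - y J * w) * qsum y (Suc n) m w) \<longlongrightarrow>
          (1 / y J) ^ m / (\<Prod>j\<in>{..<Suc n}-{J}. 1 - y j / y J)) (at (1 / y J))"
          using False m J sep y by (intro qsum_residue) auto
        thus ?thesis using False by (simp add: \<rho>[symmetric])
      qed
    qed
    moreover have "(\<lambda>w. \<Sum>m<Suc n. ((1 - y J * w) * (if m = 0 then 1 else qsum y (Suc n) m w)) * c m) =
       (\<lambda>w. (1 - y J * w) * qsum_det (Suc n) (x(0 := w)) y)"
      unfolding c sum_distrib_left by (simp only: mult.assoc)
    moreover have "(\<Sum>m<Suc n. (if m = 0 then 0 else \<rho> * (1 / y J) ^ m) * c m) =
       \<rho> * (- 1 / y J) ^ n * qsum_det n (\<lambda>i. x (Suc i)) (y \<circ> skip J)"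
      unfolding cf[symmetric] using xd y J n by (intro detf_residue) auto
    ultimately have "((\<lambda>w. (1 - y J * w) * qsum_det (Suc n) (x(0 := w)) y) \<longlongrightarrow>
       \<rho> * (- 1 / y J) ^ n * theta_det n (\<lambda>i. x (Suc i)) (y \<circ> skip J)) (at (1 / y J))"
      by (simp only: IH)
    moreover have "((\<lambda>w. (1 - y J * w) * theta_det (Suc n) (x(0 := w)) y) \<longlongrightarrow>
       \<rho> * (- 1 / y J) ^ n * theta_det n (\<lambda>i. x (Suc i)) (y \<circ> skip J)) (at (1 / y J))"
      unfolding \<rho>_def using xd y J n sep by (intro theta_det_residue) auto
    ultimately have "((\<lambda>w. (1 - y J * w) * qsum_det (Suc n) (x(0 := w)) y - (1 - y J * w) * theta_det (Suc n) (x(0 := w)) y) \<longlongrightarrow>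
       \<rho> * (- 1 / y J) ^ n * theta_det n (\<lambda>i. x (Suc i)) (y \<circ> skip J) - \<rho> * (- 1 / y J) ^ n * theta_det n (\<lambda>i. x (Suc i)) (y \<circ> skip J)) (at (1 / y J))"
      by (rule tendsto_diff)
    thus "((\<lambda>w. (1 - y J * w) * f w) \<longlongrightarrow> 0) (at (1 / y J))"
      by (simp add: f_def right_diff_distrib)
  qed (use y in auto)
  then obtain C where C: "\<And>w. w \<in> ?D \<Longrightarrow> f w = C" by blast
  have x1: "x 1 \<in> ?D" using xd[of 1] n by simp
  have "qsum_det (Suc n) (x(0 := x 1)) y = 0"
    unfolding qsum_det_def using n by (intro detf_identical_rows[of 0 _ 1]) auto
  moreover have "theta_det (Suc n) (x(0 := x 1)) y = 0"
  proof -
    have "(\<Prod>i<n. x (Suc i) * theta (x 1 / x (Suc i))) = 0"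
      using n xnz[of 1] by (intro prod_zero bexI[of _ 0]) auto
    thus ?thesis using xnz by (subst theta_det_upd0[of n x 0]) auto
  qed
  ultimately have "C = 0" using C[OF x1] by (simp add: f_def)
  moreover have "x 0 \<in> ?D" using xd by simp
  ultimately have "f (x 0) = 0" using C by blast
  thus ?case by (simp add: f_def)
qed

end

section \<open>Sums over the lattice of vectors of sum zero\<close>

lemma has_sum_sum_finite:
  fixes f :: "'i \<Rightarrow> 'a \<Rightarrow> complex"
  assumes "finite I" "\<And>i. i \<in> I \<Longrightarrow> (f i has_sum s i) A"
  shows "((\<lambda>x. \<Sum>i\<in>I. f i x) has_sum (\<Sum>i\<in>I. s i)) A"
  using assms by (induction I rule: finite_induct) (auto intro: has_sum_add)

text \<open>A finite set of points lies in the box formed by its projections, and over a box the sum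
  of products factors; this bounds all partial sums.\<close>

lemma summable_on_prod_PiE:
  fixes f :: "'i \<Rightarrow> 'a \<Rightarrow> real"
  assumes A: "finite A" and f: "\<And>i. i \<in> A \<Longrightarrow> f i summable_on UNIV" "\<And>i a. i \<in> A \<Longrightarrow> f i a \<ge> 0"
  shows "(\<lambda>g. \<Prod>i\<in>A. f i (g i)) summable_on PiE A (\<lambda>_. UNIV)"
proof (rule nonneg_bounded_partial_sums_imp_summable_on)
  show "\<forall>\<^sub>F X in finite_subsets_at_top (PiE A (\<lambda>_. UNIV)). (\<Sum>g\<in>X. \<Prod>i\<in>A. f i (g i)) \<le> (\<Prod>i\<in>A. infsum (f i) UNIV)"
  proof (rule eventually_finite_subsets_at_top_weakI)
    fix X assume X: "finite X" "X \<subseteq> PiE A (\<lambda>_. UNIV :: 'a set)"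
    define B where "B = (\<lambda>i. (\<lambda>g. g i) ` X)"
    have "(\<Sum>g\<in>X. \<Prod>i\<in>A. f i (g i)) \<le> (\<Sum>g\<in>PiE A B. \<Prod>i\<in>A. f i (g i))"
      using X A f by (intro sum_mono2 finite_PiE prod_nonneg) (auto simp: B_def PiE_def)
    also have "\<dots> = (\<Prod>i\<in>A. \<Sum>a\<in>B i. f i a)"
      using X A by (subst prod_sum_PiE) (auto simp: B_def)
    also have "\<dots> \<le> (\<Prod>i\<in>A. infsum (f i) UNIV)"
      using X f by (intro prod_mono conjI sum_nonneg finite_sum_le_infsum) (auto simp: B_def)
    finally show "(\<Sum>g\<in>X. \<Prod>i\<in>A. f i (g i)) \<le> (\<Prod>i\<in>A. infsum (f i) UNIV)" .
  qed
qed (use f in \<open>auto intro: prod_nonneg\<close>)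

text \<open>Values from index n on are fixed as 0, so that each lattice vector is represented by
  exactly one function.\<close>

definition zero_sum :: "nat \<Rightarrow> (nat \<Rightarrow> int) set" where
  "zero_sum n = {k. (\<forall>i\<ge>n. k i = 0) \<and> (\<Sum>i<n. k i) = 0}"

text \<open>The eliminated coordinate p is arbitrary, because the row without decay varies with the
  permutation in the Leibniz formula.\<close>

lemma bij_betw_zero_sum:
  assumes p: "p < n"
  shows "bij_betw (\<lambda>k. restrict k ({..<n} - {p})) (zero_sum n) (PiE ({..<n} - {p}) (\<lambda>_. UNIV))"
proof (rule bij_betwI[of _ _ _ "\<lambda>g i. if i = p then - (\<Sum>j\<in>{..<n}-{p}. g j) else if i < n then g i else 0"])
  have split: "(\<Sum>i<n. k i) = k p + (\<Sum>i\<in>{..<n}-{p}. k i)" for k :: "nat \<Rightarrow> int"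
    using p by (subst sum.remove[of _ p]) auto
  show "(\<lambda>g i. if i = p then - (\<Sum>j\<in>{..<n}-{p}. g j) else if i < n then g i else 0)
    \<in> PiE ({..<n} - {p}) (\<lambda>_. UNIV) \<rightarrow> zero_sum n"
    using p by (auto simp: zero_sum_def split)
  show "(\<lambda>i. if i = p then - (\<Sum>j\<in>{..<n}-{p}. restrict k ({..<n} - {p}) j)
     else if i < n then restrict k ({..<n} - {p}) i else 0) = k" if "k \<in> zero_sum n" for k
    using that by (auto simp: zero_sum_def split fun_eq_iff)
qed (auto simp: fun_eq_iff PiE_def extensional_def)

lemma summable_on_lat_prod:
  fixes f :: "nat \<Rightarrow> int \<Rightarrow> real"
  assumes p: "p < n" and f: "\<And>i. i < n \<Longrightarrow> i \<noteq> p \<Longrightarrow> f i summable_on UNIV" "\<And>i a. i < n \<Longrightarrow> i \<noteq> p \<Longrightarrow> f i a \<ge> 0"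
  shows "(\<lambda>k. \<Prod>i\<in>{..<n}-{p}. f i (k i)) summable_on zero_sum n"
proof -
  have "(\<lambda>g. \<Prod>i\<in>{..<n}-{p}. f i (g i)) summable_on PiE ({..<n} - {p}) (\<lambda>_. UNIV)"
    using f by (intro summable_on_prod_PiE) auto
  hence "(\<lambda>k. \<Prod>i\<in>{..<n}-{p}. f i (restrict k ({..<n} - {p}) i)) summable_on zero_sum n"
    by (subst summable_on_reindex_bij_betw[OF bij_betw_zero_sum[OF p]])
  moreover have "(\<Prod>i\<in>{..<n}-{p}. f i (restrict k ({..<n} - {p}) i)) = (\<Prod>i\<in>{..<n}-{p}. f i (k i))" for k
    by (intro prod.cong) auto
  ultimately show ?thesis by (simp only:)
qed

lemma has_sum_lat_prod:
  fixes f :: "nat \<Rightarrow> int \<Rightarrow> complex"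
  assumes p: "p < n" and f: "\<And>i. i < n \<Longrightarrow> i \<noteq> p \<Longrightarrow> (\<lambda>k. norm (f i k)) summable_on UNIV"
  shows "((\<lambda>k. \<Prod>i\<in>{..<n}-{p}. f i (k i)) has_sum (\<Prod>i\<in>{..<n}-{p}. infsum (f i) UNIV)) (zero_sum n)"
proof -
  let ?P = "PiE ({..<n} - {p}) (\<lambda>_. UNIV :: int set)"
  have "(\<lambda>g. \<Prod>i\<in>{..<n}-{p}. norm (f i (g i))) summable_on ?P"
    using f by (intro summable_on_prod_PiE) auto
  hence "(\<lambda>g. norm (\<Prod>i\<in>{..<n}-{p}. f i (g i))) summable_on ?P"
    by (simp add: prod_norm)
  hence "(\<lambda>g. \<Prod>i\<in>{..<n}-{p}. f i (g i)) summable_on ?P"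
    by (rule abs_summable_summable)
  moreover have "infsum (\<lambda>g. \<Prod>i\<in>{..<n}-{p}. f i (g i)) ?P = (\<Prod>i\<in>{..<n}-{p}. infsum (f i) UNIV)"
    using f by (intro infsum_prod_PiE_abs) auto
  ultimately have "((\<lambda>g. \<Prod>i\<in>{..<n}-{p}. f i (g i)) has_sum (\<Prod>i\<in>{..<n}-{p}. infsum (f i) UNIV)) ?P"
    unfolding has_sum_iff by (rule conjI)
  hence "((\<lambda>k. \<Prod>i\<in>{..<n}-{p}. f i (restrict k ({..<n} - {p}) i)) has_sum (\<Prod>i\<in>{..<n}-{p}. infsum (f i) UNIV)) (zero_sum n)"
    by (subst has_sum_reindex_bij_betw[OF bij_betw_zero_sum[OF p]])
  moreover have "(\<Prod>i\<in>{..<n}-{p}. f i (restrict k ({..<n} - {p}) i)) = (\<Prod>i\<in>{..<n}-{p}. f i (k i))" for k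
    by (intro prod.cong) auto
  ultimately show ?thesis by (simp only:)
qed

text \<open>In each Leibniz term the row assigned to column 0 contributes 1. Eliminating its
  coordinate makes the others independent, so the sum of the product is the product of
  one-dimensional sums.\<close>

lemma has_sum_detf_border:
  fixes f :: "nat \<Rightarrow> nat \<Rightarrow> int \<Rightarrow> complex"
  assumes n: "n \<ge> 1" and f: "\<And>i m. i < n \<Longrightarrow> 0 < m \<Longrightarrow> m < n \<Longrightarrow> (\<lambda>k. norm (f i m k)) summable_on UNIV"
  shows "((\<lambda>k. detf n (\<lambda>i m. if m = 0 then 1 else f i m (k i))) has_sum
     detf n (\<lambda>i m. if m = 0 then 1 else infsum (f i m) UNIV)) (zero_sum n)"
  unfolding detf_leibniz
proof (intro has_sum_sum_finite has_sum_cmult_right)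
  show "finite {p. p permutes {..<n}}" by (simp add: finite_permutations)
  fix \<sigma> assume "\<sigma> \<in> {p. p permutes {..<n}}"
  hence \<sigma>: "\<sigma> permutes {..<n}" by simp
  define p where "p = Hilbert_Choice.inv \<sigma> 0"
  have \<sigma>p: "\<sigma> p = 0" unfolding p_def by (rule permutes_inverses(1)[OF \<sigma>])
  have p: "p < n" using n permutes_in_image[OF \<sigma>, of p] \<sigma>p by simp
  have ne: "\<sigma> i \<noteq> 0" "\<sigma> i < n" if "i < n" "i \<noteq> p" for i
    using that permutes_in_image[OF \<sigma>, of i] injD[OF permutes_inj[OF \<sigma>], of i p] unfolding \<sigma>p by auto
  have split: "(\<Prod>i<n. g i) = g p * (\<Prod>i\<in>{..<n}-{p}. g i)" for g :: "nat \<Rightarrow> complex"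
    using p by (subst prod.remove[of _ p]) auto
  have "((\<lambda>k. \<Prod>i\<in>{..<n}-{p}. f i (\<sigma> i) (k i)) has_sum (\<Prod>i\<in>{..<n}-{p}. infsum (f i (\<sigma> i)) UNIV)) (zero_sum n)"
    using f ne by (intro has_sum_lat_prod p) auto
  moreover have "(\<Prod>i\<in>{..<n}-{p}. if \<sigma> i = 0 then 1 else f i (\<sigma> i) (k i)) = (\<Prod>i\<in>{..<n}-{p}. f i (\<sigma> i) (k i))" for k
    by (intro prod.cong refl) (use ne in \<open>simp del: neq0_conv\<close>)
  moreover have "(\<Prod>i\<in>{..<n}-{p}. if \<sigma> i = 0 then 1 else infsum (f i (\<sigma> i)) UNIV) = (\<Prod>i\<in>{..<n}-{p}. infsum (f i (\<sigma> i)) UNIV)"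
    by (intro prod.cong refl) (use ne in \<open>simp del: neq0_conv\<close>)
  ultimately show "((\<lambda>k. \<Prod>i<n. if \<sigma> i = 0 then 1 else f i (\<sigma> i) (k i)) has_sum
      (\<Prod>i<n. if \<sigma> i = 0 then 1 else infsum (f i (\<sigma> i)) UNIV)) (zero_sum n)"
    unfolding split by (simp add: \<sigma>p)
qed

section \<open>Telescoping along a line of the lattice\<close>

lemma filterlim_int_diff_top: "filterlim (\<lambda>t::int. s - t) at_bot at_top"
  unfolding filterlim_at_bot eventually_at_top_linorder
proof
  fix Z show "\<exists>N. \<forall>n\<ge>N. s - n \<le> Z" by (intro exI[of _ "s - Z"]) auto
qed

lemma filterlim_int_diff_bot: "filterlim (\<lambda>t::int. s - t) at_top at_bot"
  unfolding filterlim_at_top eventually_at_bot_linorder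
proof
  fix Z show "\<exists>N. \<forall>n\<le>N. Z \<le> s - n" by (intro exI[of _ "s - Z"]) auto
qed

text \<open>Summability allows the sum to be evaluated along symmetric intervals, where it collapses
  to \<open>H (- int N) - H (int N)\<close>.\<close>

lemma infsum_telescope_int:
  fixes H :: "int \<Rightarrow> complex"
  assumes s: "(\<lambda>t. H t - H (t + 1)) summable_on UNIV" and top: "(H \<longlongrightarrow> h) at_top" and bot: "(H \<longlongrightarrow> h) at_bot"
  shows "infsum (\<lambda>t. H t - H (t + 1)) UNIV = 0"
proof -
  let ?X = "\<lambda>N::nat. {- int N..<int N}"
  have lim: "filterlim ?X (finite_subsets_at_top UNIV) sequentially"
  proof (rule filterlim_finite_subsets_at_top[THEN iffD2], intro allI impI)
    fix X :: "int set" assume X: "finite X \<and> X \<subseteq> UNIV"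
    define M where "M = Max (insert 0 (abs ` X))"
    have M: "\<bar>x\<bar> \<le> M" if "x \<in> X" for x
      unfolding M_def using X that by (intro Max_ge) auto
    show "\<forall>\<^sub>F N in sequentially. finite (?X N) \<and> X \<subseteq> ?X N \<and> ?X N \<subseteq> UNIV"
      using eventually_ge_at_top[of "nat M + 1"]
    proof eventually_elim
      case (elim N)
      have "X \<subseteq> ?X N"
      proof
        fix x assume "x \<in> X"
        from M[OF this] elim show "x \<in> ?X N" by auto
      qed
      thus ?case by simp
    qed
  qed
  have "((\<lambda>t. H t - H (t + 1)) has_sum infsum (\<lambda>t. H t - H (t + 1)) UNIV) UNIV"
    by (rule has_sum_infsum[OF s])
  hence 1: "(\<lambda>N. \<Sum>t\<in>?X N. H t - H (t + 1)) \<longlonglongrightarrow> infsum (\<lambda>t. H t - H (t + 1)) UNIV"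
    unfolding has_sum_def using lim by (rule filterlim_compose)
  have eq: "(\<Sum>t\<in>?X N. H t - H (t + 1)) = H (- int N) - H (int N)" for N
  proof -
    have "(\<Sum>t\<in>{- int N..<- int N + int k}. H t - H (t + 1)) = H (- int N) - H (- int N + int k)" for k
    proof (induction k)
      case (Suc k)
      have "{- int N..<- int N + int (Suc k)} = insert (- int N + int k) {- int N..<- int N + int k}" by auto
      thus ?case using Suc by (simp add: algebra_simps)
    qed simp
    from this[of "2 * N"] show ?thesis by simp
  qed
  have "(\<lambda>N. H (int N)) \<longlonglongrightarrow> h"
    by (rule filterlim_compose[OF top filterlim_int_sequentially])
  moreover have "filterlim (\<lambda>N. - int N) at_bot sequentially"
    unfolding filterlim_at_bot eventually_sequentially
  proof
    fix Z show "\<exists>N. \<forall>n\<ge>N. - int n \<le> Z" by (intro exI[of _ "nat (- Z)"]) auto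
  qed
  hence "(\<lambda>N. H (- int N)) \<longlonglongrightarrow> h" by (rule filterlim_compose[OF bot])
  ultimately have "(\<lambda>N. H (- int N) - H (int N)) \<longlonglongrightarrow> h - h" by (intro tendsto_diff)
  with 1 show ?thesis unfolding eq using LIMSEQ_unique by fastforce
qed

lemma bounded_range_int:
  fixes V :: "int \<Rightarrow> complex"
  assumes "(V \<longlongrightarrow> a) at_top" "(V \<longlongrightarrow> b) at_bot"
  obtains B where "B > 0" "\<And>k. norm (V k) \<le> B"
proof -
  have "eventually (\<lambda>k. dist (V k) a < 1) at_top" "eventually (\<lambda>k. dist (V k) b < 1) at_bot"
    using tendstoD[OF assms(1), of 1] tendstoD[OF assms(2), of 1] by simp_all
  then obtain N M where N: "\<And>k. k \<ge> N \<Longrightarrow> dist (V k) a < 1" and M: "\<And>k. k \<le> M \<Longrightarrow> dist (V k) b < 1"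
    unfolding eventually_at_top_linorder eventually_at_bot_linorder by blast
  have fin: "finite ((\<lambda>k. norm (V k)) ` {M..N})" by simp
  define B where "B = Max (insert 1 (insert (norm a + 1) (insert (norm b + 1) ((\<lambda>k. norm (V k)) ` {M..N}))))"
  have B: "1 \<le> B" "norm a + 1 \<le> B" "norm b + 1 \<le> B" "\<And>k. k \<in> {M..N} \<Longrightarrow> norm (V k) \<le> B"
    unfolding B_def using fin by (auto intro!: Max_ge simp del: Max_insert)
  have "norm (V k) \<le> B" for k
  proof -
    consider "k \<ge> N" | "k \<le> M" | "k \<in> {M..N}" by force
    thus ?thesis
    proof cases
      case 1
      show ?thesis using N[OF 1] B(2) norm_triangle_sub[of "V k" a] by (simp add: dist_norm)
    next
      case 2
      show ?thesis using M[OF 2] B(3) norm_triangle_sub[of "V k" b] by (simp add: dist_norm)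
    qed (rule B)
  qed
  thus ?thesis using B(1) by (intro that[of B]) auto
qed

context nome begin

text \<open>The summand of a pair of rows \<open>p\<close>, \<open>p'\<close> telescopes along the direction \<open>e\<^sub>p - e\<^sub>p\<^sub>'\<close> of the lattice,
  in which the remaining factors are constant.\<close>

lemma has_sum_telescoping_pair:
  fixes V W :: "int \<Rightarrow> complex" and \<phi> :: "nat \<Rightarrow> int \<Rightarrow> complex"
  assumes p: "p < n" "p' < n" "p \<noteq> p'"
  and V: "(V \<longlongrightarrow> a) at_top" "(V \<longlongrightarrow> b) at_bot" and W: "(W \<longlongrightarrow> a') at_top" "(W \<longlongrightarrow> b') at_bot"
  and ab: "a * b' = b * a'"
  and dV: "\<And>k. norm (V (k + 1) - V k) \<le> C * rho k" and dW: "\<And>k. norm (W (k + 1) - W k) \<le> C * rho k"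
  and \<phi>: "\<And>i k. i < n \<Longrightarrow> i \<noteq> p \<Longrightarrow> i \<noteq> p' \<Longrightarrow> norm (\<phi> i k) \<le> C * rho k" and C: "C \<ge> 0"
  shows "((\<lambda>k. (V (k p) * W (k p' + 1) - V (k p + 1) * W (k p')) * (\<Prod>i\<in>{..<n}-{p,p'}. \<phi> i (k i))) has_sum 0) (zero_sum n)"
proof -
  obtain B1 where B1: "B1 > 0" "\<And>k. norm (V k) \<le> B1" by (rule bounded_range_int[OF V], rule that, assumption+)
  obtain B2 where B2: "B2 > 0" "\<And>k. norm (W k) \<le> B2" by (rule bounded_range_int[OF W], rule that, assumption+)
  let ?R = "{..<n} - {p,p'}"
  define T where "T = (\<lambda>k. (V (k p) * W (k p' + 1) - V (k p + 1) * W (k p')) * (\<Prod>i\<in>?R. \<phi> i (k i)))"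
  define c where "c = C ^ card ?R"
  have c: "c \<ge> 0" using C by (simp add: c_def)
  \<comment> \<open>The minor is rewritten so that each part contains a difference of consecutive
    values, which decays. Each part then lacks the factor \<open>rho\<close> of a single row only,
    whose coordinate is determined by the others.\<close>
  have bound: "norm (T k) \<le> c * (B1 * C * (\<Prod>i\<in>{..<n}-{p}. rho (k i)) + C * B2 * (\<Prod>i\<in>{..<n}-{p'}. rho (k i)))" for k
  proof -
    have "V (k p) * W (k p' + 1) - V (k p + 1) * W (k p') =
        V (k p) * (W (k p' + 1) - W (k p')) - (V (k p + 1) - V (k p)) * W (k p')"
      by (simp add: algebra_simps)
    also have "norm \<dots> \<le> norm (V (k p)) * norm (W (k p' + 1) - W (k p')) + norm (V (k p + 1) - V (k p)) * norm (W (k p'))"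
      unfolding norm_mult[symmetric] by (rule norm_triangle_ineq4)
    also have "\<dots> \<le> B1 * (C * rho (k p')) + (C * rho (k p)) * B2"
      using B1 B2 C by (intro add_mono mult_mono dV dW) auto
    finally have 1: "norm (V (k p) * W (k p' + 1) - V (k p + 1) * W (k p')) \<le> B1 * (C * rho (k p')) + (C * rho (k p)) * B2" .
    have "norm (\<Prod>i\<in>?R. \<phi> i (k i)) \<le> (\<Prod>i\<in>?R. C * rho (k i))"
      unfolding prod_norm[symmetric] using \<phi> by (intro prod_mono) auto
    also have "\<dots> = c * (\<Prod>i\<in>?R. rho (k i))" by (simp add: prod.distrib c_def)
    finally have 2: "norm (\<Prod>i\<in>?R. \<phi> i (k i)) \<le> c * (\<Prod>i\<in>?R. rho (k i))" .
    have "norm (T k) \<le> (B1 * (C * rho (k p')) + (C * rho (k p)) * B2) * (c * (\<Prod>i\<in>?R. rho (k i)))"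
      unfolding T_def norm_mult using 1 2 B1 B2 C by (intro mult_mono) auto
    also have "\<dots> = c * (B1 * C * (rho (k p') * (\<Prod>i\<in>?R. rho (k i))) + C * B2 * (rho (k p) * (\<Prod>i\<in>?R. rho (k i))))"
      by (simp add: algebra_simps)
    also have "rho (k p') * (\<Prod>i\<in>?R. rho (k i)) = (\<Prod>i\<in>{..<n}-{p}. rho (k i))"
      using p by (subst prod.remove[of "{..<n}-{p}" p']) (auto simp: Diff_insert2[symmetric] insert_commute)
    also have "rho (k p) * (\<Prod>i\<in>?R. rho (k i)) = (\<Prod>i\<in>{..<n}-{p'}. rho (k i))"
      using p by (subst prod.remove[of "{..<n}-{p'}" p]) (auto simp: Diff_insert2[symmetric] insert_commute)
    finally show ?thesis .
  qed
  have "(\<lambda>k. c * (B1 * C * (\<Prod>i\<in>{..<n}-{p}. rho (k i)) + C * B2 * (\<Prod>i\<in>{..<n}-{p'}. rho (k i)))) summable_on zero_sum n"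
    using p by (intro summable_on_cmult_right summable_on_add summable_on_lat_prod summable_rho rho_bounds)
  hence "(\<lambda>k. norm (T k)) summable_on zero_sum n"
    by (rule Infinite_Sum.abs_summable_on_comparison_test') (rule bound)
  hence sT: "T summable_on zero_sum n" by (rule abs_summable_summable)
  let ?P = "PiE ?R (\<lambda>_. UNIV :: int set)"
  \<comment> \<open>Fibres the lattice into lines: g fixes the rows other than p and p', and t moves
    along the line, with row p' compensating.\<close>
  define h where "h = (\<lambda>(g, t) i. if i = p then t else if i = p' then - t - (\<Sum>j\<in>?R. g j) else if i < n then g i else (0::int))"
  have split: "(\<Sum>i<n. k i) = k p + k p' + (\<Sum>i\<in>?R. k i)" for k :: "nat \<Rightarrow> int"
  proof -
    have "(\<Sum>i<n. k i) = k p + (\<Sum>i\<in>{..<n}-{p}. k i)"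
      using p by (subst sum.remove[of _ p]) auto
    also have "(\<Sum>i\<in>{..<n}-{p}. k i) = k p' + (\<Sum>i\<in>?R. k i)"
      using p by (subst sum.remove[of _ p']) (auto simp: Diff_insert2[symmetric] insert_commute)
    finally show ?thesis by simp
  qed
  have bij: "bij_betw h (?P \<times> UNIV) (zero_sum n)"
  proof (rule bij_betwI[of _ _ _ "\<lambda>k. (restrict k ?R, k p)"])
    show "h \<in> ?P \<times> UNIV \<rightarrow> zero_sum n"
    proof
      fix gt :: "(nat \<Rightarrow> int) \<times> int"
      obtain g t where gt: "gt = (g, t)" by (cases gt)
      have "(\<Sum>i\<in>?R. h (g, t) i) = (\<Sum>i\<in>?R. g i)" by (intro sum.cong) (auto simp: h_def)
      moreover have "h (g, t) p = t" "h (g, t) p' = - t - (\<Sum>i\<in>?R. g i)" using p by (simp_all add: h_def)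
      ultimately have "(\<Sum>i<n. h (g, t) i) = 0" unfolding split[of "h (g, t)"] by linarith
      moreover have "h (g, t) i = 0" if "i \<ge> n" for i using that p by (simp add: h_def)
      ultimately show "h gt \<in> zero_sum n" by (simp add: gt zero_sum_def)
    qed
    show "(\<lambda>k. (restrict k ?R, k p)) \<in> zero_sum n \<rightarrow> ?P \<times> UNIV" by auto
    show "(restrict (h gt) ?R, h gt p) = gt" if "gt \<in> ?P \<times> UNIV" for gt
    proof -
      obtain g t where gt: "gt = (g, t)" by (cases gt)
      have "restrict (h (g, t)) ?R = restrict g ?R" by (intro restrict_ext) (auto simp: h_def)
      also have "\<dots> = g" using that unfolding gt by (intro PiE_restrict) auto
      finally show ?thesis by (simp add: gt h_def)
    qed
    show "h (restrict k ?R, k p) = k" if "k \<in> zero_sum n" for k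
    proof
      fix i
      have "(\<Sum>j\<in>?R. restrict k ?R j) = (\<Sum>j\<in>?R. k j)" by (intro sum.cong) auto
      moreover have "k p + k p' + (\<Sum>j\<in>?R. k j) = 0" "i \<ge> n \<Longrightarrow> k i = 0"
        using that split[of k] by (simp_all add: zero_sum_def)
      ultimately show "h (restrict k ?R, k p) i = k i" by (simp add: h_def)
    qed
  qed
  have s2: "(\<lambda>gt. T (h gt)) summable_on (?P \<times> UNIV)"
    using sT by (subst summable_on_reindex_bij_betw[OF bij])
  have "infsum T (zero_sum n) = infsum (\<lambda>gt. T (h gt)) (?P \<times> UNIV)"
    by (rule infsum_reindex_bij_betw[OF bij, symmetric])
  also have "\<dots> = (\<Sum>\<^sub>\<infinity>g\<in>?P. \<Sum>\<^sub>\<infinity>t. T (h (g, t)))"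
    by (rule infsum_Sigma_banach[OF s2, symmetric])
  also have "\<dots> = (\<Sum>\<^sub>\<infinity>g\<in>?P. 0)"
  proof (rule infsum_cong)
    fix g assume g: "g \<in> ?P"
    define s where "s = - (\<Sum>j\<in>?R. g j)"
    \<comment> \<open>On the line \<open>k p' = s - t\<close>, so \<open>W (k p' + 1)\<close> is
      \<open>W (s + 1 - t)\<close>, and replacing t by t + 1 yields exactly
      \<open>W (k p')\<close>.\<close>
    define H where "H = (\<lambda>t. V t * W (s + 1 - t) * (\<Prod>i\<in>?R. \<phi> i (g i)))"
    have Th: "T (h (g, t)) = H t - H (t + 1)" for t
    proof -
      have 1: "(\<Prod>i\<in>?R. \<phi> i (h (g, t) i)) = (\<Prod>i\<in>?R. \<phi> i (g i))"
        by (intro prod.cong) (auto simp: h_def)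
      have 2: "h (g, t) p = t" "h (g, t) p' = s - t" using p by (auto simp: h_def s_def)
      show ?thesis unfolding T_def H_def 1 2 by (simp add: algebra_simps)
    qed
    have "(\<lambda>(g, t). T (h (g, t))) summable_on (?P \<times> UNIV)"
      using s2 by (simp add: case_prod_unfold)
    from summable_on_SigmaD1[OF this g] have "(\<lambda>t. H t - H (t + 1)) summable_on UNIV"
      unfolding Th .
    moreover have "(H \<longlongrightarrow> a * b' * (\<Prod>i\<in>?R. \<phi> i (g i))) at_top"
      unfolding H_def by (intro tendsto_mult V tendsto_const filterlim_compose[OF W(2) filterlim_int_diff_top])
    moreover have "(H \<longlongrightarrow> b * a' * (\<Prod>i\<in>?R. \<phi> i (g i))) at_bot"
      unfolding H_def by (intro tendsto_mult V tendsto_const filterlim_compose[OF W(1) filterlim_int_diff_bot])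
    ultimately show "(\<Sum>\<^sub>\<infinity>t. T (h (g, t))) = 0"
      unfolding Th ab by (rule infsum_telescope_int)
  qed
  finally have "infsum T (zero_sum n) = 0" by simp
  with sT have "(T has_sum 0) (zero_sum n)" by (simp add: has_sum_iff)
  thus ?thesis unfolding T_def .
qed

text \<open>A single Leibniz term has two rows without decay and need not be summable. Exchanging
  columns 0 and \<open>m0\<close> changes the sign, so the determinant is half the sum of paired
  terms; each pair is a two by two minor times decaying factors, and its lattice sum telescopes to
  0.\<close>

lemma has_sum_detf_vanish:
  fixes V :: "nat \<Rightarrow> int \<Rightarrow> complex" and \<psi> :: "nat \<Rightarrow> nat \<Rightarrow> int \<Rightarrow> complex"
  assumes m0: "0 < m0" "m0 < n"
  and V: "\<And>i. i < n \<Longrightarrow> (V i \<longlongrightarrow> a i) at_top" "\<And>i. i < n \<Longrightarrow> (V i \<longlongrightarrow> b i) at_bot"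
  and ab: "\<And>i j. i < n \<Longrightarrow> j < n \<Longrightarrow> a i * b j = b i * a j"
  and dV: "\<And>i k. i < n \<Longrightarrow> norm (V i (k + 1) - V i k) \<le> C * rho k"
  and \<psi>: "\<And>i m k. i < n \<Longrightarrow> 0 < m \<Longrightarrow> m < n \<Longrightarrow> norm (\<psi> i m k) \<le> C * rho k" and C: "C \<ge> 0"
  shows "((\<lambda>k. detf n (\<lambda>i m. if m = 0 then V i (k i) else if m = m0 then V i (k i + 1) else \<psi> i m (k i))) has_sum 0) (zero_sum n)"
proof -
  define M where "M = (\<lambda>k i m. if m = 0 then V i (k i) else if m = m0 then V i (k i + 1) else \<psi> i m (k i))"
  define \<tau> where "\<tau> = Transposition.transpose 0 m0"
  have \<tau>: "\<tau> permutes {..<n}" unfolding \<tau>_def using m0 by (intro permutes_swap_id) auto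
  let ?S = "{\<sigma>. \<sigma> permutes {..<n}}"
  have det2: "detf n (M k) = (\<Sum>\<sigma>\<in>?S. of_int (sign \<sigma>) / 2 * ((\<Prod>i<n. M k i (\<sigma> i)) - (\<Prod>i<n. M k i (\<tau> (\<sigma> i)))))" for k
  proof -
    have "detf n (M k) = (\<Sum>\<sigma>\<in>?S. of_int (sign (\<tau> \<circ> \<sigma>)) * (\<Prod>i<n. M k i ((\<tau> \<circ> \<sigma>) i)))"
      unfolding detf_leibniz by (rule setum_permutations_compose_left[OF \<tau>])
    also have "\<dots> = (\<Sum>\<sigma>\<in>?S. - of_int (sign \<sigma>) * (\<Prod>i<n. M k i (\<tau> (\<sigma> i))))"
    proof (intro sum.cong refl)
      fix \<sigma> assume "\<sigma> \<in> ?S"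
      hence "permutation \<sigma>" by (auto intro: permutes_imp_permutation)
      moreover have "permutation \<tau>" using \<tau> by (auto intro: permutes_imp_permutation)
      ultimately have "sign (\<tau> \<circ> \<sigma>) = - sign \<sigma>"
        using m0 by (simp add: sign_compose \<tau>_def sign_swap_id)
      thus "of_int (sign (\<tau> \<circ> \<sigma>)) * (\<Prod>i<n. M k i ((\<tau> \<circ> \<sigma>) i)) = - of_int (sign \<sigma>) * (\<Prod>i<n. M k i (\<tau> (\<sigma> i)))"
        by simp
    qed
    finally have 1: "detf n (M k) = (\<Sum>\<sigma>\<in>?S. - of_int (sign \<sigma>) * (\<Prod>i<n. M k i (\<tau> (\<sigma> i))))" .
    have "2 * detf n (M k) = (\<Sum>\<sigma>\<in>?S. of_int (sign \<sigma>) * (\<Prod>i<n. M k i (\<sigma> i))) + detf n (M k)"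
      unfolding detf_leibniz[of n "M k"] by simp
    also have "\<dots> = 2 * (\<Sum>\<sigma>\<in>?S. of_int (sign \<sigma>) / 2 * ((\<Prod>i<n. M k i (\<sigma> i)) - (\<Prod>i<n. M k i (\<tau> (\<sigma> i)))))"
      unfolding 1 sum.distrib[symmetric] sum_distrib_left by (intro sum.cong refl) (simp add: algebra_simps)
    finally show ?thesis by simp
  qed
  have "((\<lambda>k. \<Sum>\<sigma>\<in>?S. of_int (sign \<sigma>) / 2 * ((\<Prod>i<n. M k i (\<sigma> i)) - (\<Prod>i<n. M k i (\<tau> (\<sigma> i))))) has_sum
     (\<Sum>\<sigma>\<in>?S. of_int (sign \<sigma>) / 2 * 0)) (zero_sum n)"
  proof (intro has_sum_sum_finite has_sum_cmult_right)
    show "finite ?S" by (simp add: finite_permutations)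
    fix \<sigma> assume "\<sigma> \<in> ?S"
    hence \<sigma>: "\<sigma> permutes {..<n}" by simp
    define p p' where "p = Hilbert_Choice.inv \<sigma> 0" and "p' = Hilbert_Choice.inv \<sigma> m0"
    have \<sigma>p: "\<sigma> p = 0" "\<sigma> p' = m0" unfolding p_def p'_def by (rule permutes_inverses(1)[OF \<sigma>])+
    have p: "p < n" "p' < n" "p \<noteq> p'"
      using m0 permutes_in_image[OF \<sigma>, of p] permutes_in_image[OF \<sigma>, of p'] \<sigma>p by auto
    have ne: "\<sigma> i \<noteq> 0" "\<sigma> i \<noteq> m0" "\<sigma> i < n" if "i < n" "i \<noteq> p" "i \<noteq> p'" for i
      using that permutes_in_image[OF \<sigma>, of i] injD[OF permutes_inj[OF \<sigma>], of i p]
        injD[OF permutes_inj[OF \<sigma>], of i p'] unfolding \<sigma>p by auto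
    have split: "(\<Prod>i<n. g i) = g p * (g p' * (\<Prod>i\<in>{..<n}-{p,p'}. g i))" for g :: "nat \<Rightarrow> complex"
    proof -
      have "(\<Prod>i<n. g i) = g p * (\<Prod>i\<in>{..<n}-{p}. g i)"
        using p by (subst prod.remove[of _ p]) auto
      also have "(\<Prod>i\<in>{..<n}-{p}. g i) = g p' * (\<Prod>i\<in>{..<n}-{p,p'}. g i)"
        using p by (subst prod.remove[of _ p']) (auto simp: Diff_insert2[symmetric] insert_commute)
      finally show ?thesis .
    qed
    have "(\<Prod>i<n. M k i (\<sigma> i)) - (\<Prod>i<n. M k i (\<tau> (\<sigma> i))) =
      (V p (k p) * V p' (k p' + 1) - V p (k p + 1) * V p' (k p')) * (\<Prod>i\<in>{..<n}-{p,p'}. \<psi> i (\<sigma> i) (k i))" for k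
    proof -
      have "(\<Prod>i\<in>{..<n}-{p,p'}. M k i (\<sigma> i)) = (\<Prod>i\<in>{..<n}-{p,p'}. \<psi> i (\<sigma> i) (k i))"
        by (intro prod.cong refl) (use ne in \<open>simp add: M_def del: neq0_conv\<close>)
      moreover have "(\<Prod>i\<in>{..<n}-{p,p'}. M k i (\<tau> (\<sigma> i))) = (\<Prod>i\<in>{..<n}-{p,p'}. \<psi> i (\<sigma> i) (k i))"
        by (intro prod.cong refl) (use ne in \<open>simp add: M_def \<tau>_def Transposition.transpose_def del: neq0_conv\<close>)
      ultimately show ?thesis
        unfolding split using m0 by (simp add: \<sigma>p M_def \<tau>_def algebra_simps)
    qed
    moreover have "((\<lambda>k. (V p (k p) * V p' (k p' + 1) - V p (k p + 1) * V p' (k p')) *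
        (\<Prod>i\<in>{..<n}-{p,p'}. \<psi> i (\<sigma> i) (k i))) has_sum 0) (zero_sum n)"
    proof (rule has_sum_telescoping_pair[OF p V(1)[OF p(1)] V(2)[OF p(1)] V(1)[OF p(2)] V(2)[OF p(2)]
          ab[OF p(1,2)] dV[OF p(1)] dV[OF p(2)] _ C])
      fix i k assume i: "i < n" "i \<noteq> p" "i \<noteq> p'"
      show "norm (\<psi> i (\<sigma> i) k) \<le> C * rho k" using ne[OF i] by (intro \<psi> i) auto
    qed
    ultimately show "((\<lambda>k. (\<Prod>i<n. M k i (\<sigma> i)) - (\<Prod>i<n. M k i (\<tau> (\<sigma> i)))) has_sum 0) (zero_sum n)"
      by simp
  qed
  hence "((\<lambda>k. detf n (M k)) has_sum 0) (zero_sum n)" unfolding det2 by simp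
  thus ?thesis unfolding M_def .
qed

section \<open>The two lattice sums\<close>


definition dpoly :: "nat \<Rightarrow> (nat \<Rightarrow> complex) \<Rightarrow> complex poly" where
  "dpoly n y = (\<Prod>j<n. [:1, - y j:])"

lemma poly_dpoly: "poly (dpoly n y) z = den y n z"
  by (simp add: dpoly_def den_def poly_prod mult.commute)

lemma dpoly:
  assumes y: "\<And>j. j < n \<Longrightarrow> y j \<noteq> 0"
  shows "degree (dpoly n y) = n" "coeff (dpoly n y) 0 = 1" "coeff (dpoly n y) n = (-1) ^ n * (\<Prod>j<n. y j)"
proof -
  show deg: "degree (dpoly n y) = n"
    unfolding dpoly_def using y by (subst degree_prod_eq_sum_degree) auto
  show "coeff (dpoly n y) 0 = 1"
    using poly_dpoly[of n y 0] by (simp add: poly_0_coeff_0 den_def)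
  have "lead_coeff (dpoly n y) = (\<Prod>j<n. - y j)"
    unfolding dpoly_def lead_coeff_prod using y by (intro prod.cong) auto
  also have "\<dots> = (-1) ^ n * (\<Prod>j<n. y j)"
    using prod.distrib[of "\<lambda>_. -1" y "{..<n}"] by simp
  finally show "coeff (dpoly n y) n = (-1) ^ n * (\<Prod>j<n. y j)" by (simp add: deg)
qed

lemma bij_sign_mult: "s \<in> {1, -1::int} \<Longrightarrow> bij_betw (\<lambda>k. s * k) UNIV UNIV"
  by (rule bij_betwI[of _ _ _ "\<lambda>k. s * k"]) auto

text \<open>Dividing each row by the denominator turns the polynomial column into the constant 1. A
  sign \<open>s i = -1\<close> merely reverses the order of a bilateral sum, so the value is the
  same for all sign patterns.\<close>

lemma has_sum_diag:
  fixes s :: "nat \<Rightarrow> int"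
  assumes n: "n \<ge> 1" and y: "\<And>j. j < n \<Longrightarrow> y j \<noteq> 0" and x: "\<And>i. i < n \<Longrightarrow> x i \<in> pdom y n"
  and sep: "\<And>i j k. i < n \<Longrightarrow> j < n \<Longrightarrow> i \<noteq> j \<Longrightarrow> y i / y j * q powi k \<noteq> 1"
  and s: "\<And>i. i < n \<Longrightarrow> s i \<in> {1, -1}"
  shows "((\<lambda>k. (1 - (\<Prod>j<n. y j) * (\<Prod>i<n. x i * q powi (s i * k i))) * vdm n (\<lambda>i. x i * q powi (s i * k i)) *
     (\<Prod>i<n. 1 / den y n (x i * q powi (s i * k i)))) has_sum theta_det n x y) (zero_sum n)"
proof -
  define f where "f = (\<lambda>i m k. (x i * q powi (s i * k)) ^ m / den y n (x i * q powi (s i * k)))"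
  have "((\<lambda>k. detf n (\<lambda>i m. if m = 0 then 1 else f i m (k i))) has_sum
     detf n (\<lambda>i m. if m = 0 then 1 else infsum (f i m) UNIV)) (zero_sum n)"
  proof (intro has_sum_detf_border n)
    fix i m assume im: "i < n" "0 < m" "m < n"
    have "(\<lambda>k. norm ((x i * q powi k) ^ m / den y n (x i * q powi k))) summable_on UNIV"
      using im by (intro abs_summable_qsum x y) auto
    thus "(\<lambda>k. norm (f i m k)) summable_on UNIV"
      unfolding f_def by (subst summable_on_reindex_bij_betw[OF bij_sign_mult[OF s[OF im(1)]]])
  qed
  moreover have "detf n (\<lambda>i m. if m = 0 then 1 else infsum (f i m) UNIV) = theta_det n x y"
  proof -
    have "infsum (f i m) UNIV = qsum y n m (x i)" if "i < n" for i m
      unfolding f_def qsum_def by (rule infsum_reindex_bij_betw[OF bij_sign_mult[OF s[OF that]]])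
    hence "detf n (\<lambda>i m. if m = 0 then 1 else infsum (f i m) UNIV) = qsum_det n x y"
      unfolding qsum_det_def by (intro detf_cong) auto
    also have "\<dots> = theta_det n x y" by (intro qsum_det_eq_theta_det n y x sep)
    finally show ?thesis .
  qed
  moreover have "detf n (\<lambda>i m. if m = 0 then 1 else f i m (k i)) =
     (1 - (\<Prod>j<n. y j) * (\<Prod>i<n. x i * q powi (s i * k i))) * vdm n (\<lambda>i. x i * q powi (s i * k i)) *
     (\<Prod>i<n. 1 / den y n (x i * q powi (s i * k i)))" for k
  proof -
    define z where "z = (\<lambda>i. x i * q powi (s i * k i))"
    have "detf n (\<lambda>i m. if m = 0 then 1 else f i m (k i)) =
       detf n (\<lambda>i m. (1 / den y n (z i)) * (if m = 0 then poly (dpoly n y) (z i) else z i ^ m))"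
      using den_nonzero[OF x y] by (intro detf_cong) (auto simp: f_def z_def poly_dpoly)
    also have "\<dots> = (\<Prod>i<n. 1 / den y n (z i)) * ((1 - (\<Prod>j<n. y j) * (\<Prod>i<n. z i)) * vdm n z)"
      unfolding detf_scale_rows using dpoly[of n y] y n by (subst detf_vandermonde_border) auto
    finally show ?thesis by (simp add: z_def mult_ac)
  qed
  ultimately show ?thesis by simp
qed

section \<open>Row weights and the off-diagonal sums\<close>

lemma tendsto_qpowi_top: "((\<lambda>k::int. x * q powi k) \<longlongrightarrow> 0) at_top"
proof -
  have "((\<lambda>k. q powi k) \<longlongrightarrow> 0) (at_top :: int filter)"
  proof (rule tendsto_norm_zero_cancel, rule tendstoI)
    fix e :: real assume e: "e > 0"
    have "(\<lambda>n. norm q ^ n) \<longlonglongrightarrow> 0" using q_less by (intro LIMSEQ_power_zero) auto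
    hence "eventually (\<lambda>n. norm q ^ n < e) sequentially" by (rule order_tendstoD) (rule e)
    then obtain N where N: "\<And>n. n \<ge> N \<Longrightarrow> norm q ^ n < e" by (auto simp: eventually_sequentially)
    show "eventually (\<lambda>k::int. dist (norm (q powi k)) 0 < e) at_top"
      using eventually_ge_at_top[of "int N"]
    proof eventually_elim
      case (elim k)
      hence "norm (q powi k) = norm q ^ nat k" by (simp add: power_int_def norm_power)
      thus ?case using N[of "nat k"] elim by simp
    qed
  qed
  thus ?thesis using tendsto_mult_right_zero by blast
qed

definition shiftv :: "(nat \<Rightarrow> complex) \<Rightarrow> (nat \<Rightarrow> int) \<Rightarrow> nat \<Rightarrow> complex" where
  "shiftv y k j = y j * q powi k j"

text \<open>Chosen for its step: away from poles and zeros, \<open>Uq n u v (z * q)\<close> is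
  \<open>Uq n u v z\<close> times \<open>den v n z / den u n z\<close>.\<close>

definition Uq :: "nat \<Rightarrow> (nat \<Rightarrow> complex) \<Rightarrow> (nat \<Rightarrow> complex) \<Rightarrow> complex \<Rightarrow> complex" where
  "Uq n u v z = (\<Prod>j<n. qi (u j * z) / qi (v j * z))"

lemma shiftv_nonzero: "y j \<noteq> 0 \<Longrightarrow> shiftv y k j \<noteq> 0"
  by (simp add: shiftv_def)

lemma shiftv_pole:
  assumes "x \<in> pdom y n" "\<And>j. j < n \<Longrightarrow> y j \<noteq> 0" "j < n"
  shows "shiftv y k j * (x * q powi t) * q powi m \<noteq> 1"
proof -
  have eq: "shiftv y k j * (x * q powi t) * q powi m = y j * x * q powi (k j + t + m)"
    by (simp add: shiftv_def qpowi_add mult_ac)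
  show ?thesis unfolding eq using assms by (intro pdomD)
qed

lemma pdom_shiftv:
  assumes "x \<in> pdom y n" "\<And>j. j < n \<Longrightarrow> y j \<noteq> 0"
  shows "x \<in> pdom (shiftv y k) n"
proof -
  have "theta (shiftv y k j * x) \<noteq> 0" if "j < n" for j
    using theta_qpowi_zero_iff[of "y j * x" "k j"] assms that by (auto simp: pdom_def shiftv_def mult_ac)
  thus ?thesis using assms(1) by (auto simp: pdom_def)
qed

lemma Uq_top:
  shows "((\<lambda>t. Uq n u v (x * q powi t)) \<longlongrightarrow> 1) at_top"
proof -
  have "((\<lambda>t. Uq n u v (x * q powi t)) \<longlongrightarrow> (\<Prod>j<n. qi (u j * 0) / qi (v j * 0))) at_top"
    unfolding Uq_def by (intro tendsto_intros tendsto_qpowi_top) auto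
  thus ?thesis by simp
qed

text \<open>The value at infinity does not depend on \<open>x\<close> because the total degree \<open>\<Sum>(k j - l j)\<close> vanishes.\<close>

lemma Uq_bot:
  assumes y: "\<And>j. j < n \<Longrightarrow> y j \<noteq> 0" and kl: "(\<Sum>j<n. k j) = (\<Sum>j<n. l j)"
  shows "\<exists>\<kappa>. \<kappa> \<noteq> 0 \<and> (\<forall>x\<in>pdom y n. ((\<lambda>t. Uq n (shiftv y k) (shiftv y l) (x * q powi t)) \<longlongrightarrow> \<kappa>) at_bot)"
proof -
  obtain c where c: "\<And>d. c d \<noteq> 0" "\<And>d u. u \<noteq> 0 \<Longrightarrow> theta (q powi d * u) = c d * u powi (-d) * theta u"
    using theta_shift_int by metis
  define \<kappa> where "\<kappa> = (\<Prod>j<n. c (k j) / c (l j) * y j powi (l j - k j))"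
  have "\<kappa> \<noteq> 0" unfolding \<kappa>_def using c(1) y by auto
  moreover have "((\<lambda>t. Uq n (shiftv y k) (shiftv y l) (x * q powi t)) \<longlongrightarrow> \<kappa>) at_bot" if x: "x \<in> pdom y n" for x
  proof -
    have x0: "x \<noteq> 0" using x by (simp add: pdom_def)
    \<comment> \<open>Near infinity \<open>qi (u * z)\<close> is replaced by
      \<open>theta (u * z) / qi (q / (u * z))\<close>. The theta quotients reduce to monomials in z
      whose exponents add up to 0, and the remaining products tend to 1.\<close>
    have eq: "Uq n (shiftv y k) (shiftv y l) z = \<kappa> * (\<Prod>j<n. qi (q / shiftv y l j * inverse z) / qi (q / shiftv y k j * inverse z))"
      if z: "z = x * q powi t" for z t
    proof -
      have z0: "z \<noteq> 0" using z x0 by simp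
      have th: "theta (y j * z) \<noteq> 0" if "j < n" for j
        using theta_qpowi_zero_iff[of "y j * x" t] x y[OF that] x0 that z by (auto simp: pdom_def mult_ac)
      have "qi (shiftv y k j * z) / qi (shiftv y l j * z) =
         c (k j) / c (l j) * y j powi (l j - k j) * z powi (l j - k j) *
         (qi (q / shiftv y l j * inverse z) / qi (q / shiftv y k j * inverse z))" if j: "j < n" for j
      proof -
        have nz: "qi (q / (shiftv y m j * z)) \<noteq> 0" for m
        proof -
          have "theta (shiftv y m j * z) \<noteq> 0"
            using theta_qpowi_zero_iff[of "y j * z" "m j"] th[OF j] y[OF j] z0 by (simp add: shiftv_def mult_ac)
          thus ?thesis by (auto simp: theta_def)
        qed
        have t: "theta (shiftv y m j * z) = c (m j) * (y j * z) powi (- m j) * theta (y j * z)" for m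
          using c(2)[of "y j * z" "m j"] y[OF j] z0 by (simp add: shiftv_def mult_ac)
        have q1: "qi (shiftv y m j * z) = theta (shiftv y m j * z) / qi (q / (shiftv y m j * z))" for m
          using nz[of m] by (simp add: theta_def)
        have "qi (shiftv y k j * z) / qi (shiftv y l j * z) =
           (theta (shiftv y k j * z) / theta (shiftv y l j * z)) * (qi (q / (shiftv y l j * z)) / qi (q / (shiftv y k j * z)))"
          unfolding q1 by simp
        also have "theta (shiftv y k j * z) / theta (shiftv y l j * z) = c (k j) / c (l j) * ((y j * z) powi (- k j) / (y j * z) powi (- l j))"
          unfolding t using th[OF j] by simp
        also have "(y j * z) powi (- k j) / (y j * z) powi (- l j) = (y j * z) powi (l j - k j)"
          using y[OF j] z0 power_int_diff[of "y j * z" "- k j" "- l j"] by simp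
        also have "\<dots> = y j powi (l j - k j) * z powi (l j - k j)"
          by (rule power_int_mult_distrib)
        finally show ?thesis by (simp add: divide_inverse mult_ac)
      qed
      hence "Uq n (shiftv y k) (shiftv y l) z = \<kappa> * (\<Prod>j<n. z powi (l j - k j)) *
         (\<Prod>j<n. qi (q / shiftv y l j * inverse z) / qi (q / shiftv y k j * inverse z))"
        unfolding Uq_def \<kappa>_def prod.distrib[symmetric] by (intro prod.cong) auto
      also have "(\<Prod>j<n. z powi (l j - k j)) = z powi (\<Sum>j<n. l j - k j)"
        by (rule prod_power_int[OF z0])
      also have "(\<Sum>j<n. l j - k j) = 0" using kl by (simp add: sum_subtractf)
      finally show ?thesis by simp
    qed
    have inv: "((\<lambda>t. inverse (x * q powi t)) \<longlongrightarrow> 0) at_bot"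
    proof -
      have "((\<lambda>t. inverse x * q powi (0 - t)) \<longlongrightarrow> 0) at_bot"
        by (rule filterlim_compose[OF tendsto_qpowi_top filterlim_int_diff_bot])
      thus ?thesis by (simp add: power_int_minus)
    qed
    have "((\<lambda>t. \<kappa> * (\<Prod>j<n. qi (q / shiftv y l j * inverse (x * q powi t)) / qi (q / shiftv y k j * inverse (x * q powi t)))) \<longlongrightarrow>
        \<kappa> * (\<Prod>j<n. qi (q / shiftv y l j * 0) / qi (q / shiftv y k j * 0))) at_bot"
      by (intro tendsto_intros inv) auto
    thus ?thesis unfolding eq[OF refl] by simp
  qed
  ultimately show ?thesis by blast
qed

text \<open>The weight of a row whose variable is \<open>x q\<^bsup>k\<^esup>\<close> (for \<open>s = 1\<close>) or \<open>x q\<^bsup>-k\<^esup>\<close> (for \<open>s = -1\<close>).\<close>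

definition row_weight :: "nat \<Rightarrow> (nat \<Rightarrow> complex) \<Rightarrow> (nat \<Rightarrow> complex) \<Rightarrow> int \<Rightarrow> complex \<Rightarrow> complex" where
  "row_weight n u v s z = (if s = 1 then \<Prod>j<n. qi (q * (u j * z)) / qi (v j * z) else \<Prod>j<n. qi (q * (v j * z)) / qi (u j * z))"

text \<open>A weight times the two denominators gives the values of \<open>Uq\<close> at z and at z
  q, or for s = -1 their reciprocals in reverse order. This is the origin of the
  telescoping.\<close>

lemma row_weight_eq:
  assumes u: "\<And>j m. j < n \<Longrightarrow> u j * z * q powi m \<noteq> 1" and v: "\<And>j m. j < n \<Longrightarrow> v j * z * q powi m \<noteq> 1"
  shows "row_weight n u v 1 z = Uq n u v z / den u n z" "row_weight n u v (-1) z = 1 / Uq n u v z / den v n z"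
    "row_weight n u v 1 z * den v n z = Uq n u v (z * q)" "row_weight n u v (-1) z * den u n z = 1 / Uq n u v (z * q)"
    "den u n z \<noteq> 0" "den v n z \<noteq> 0"
proof -
  have nz: "1 - u j * z \<noteq> 0" "1 - v j * z \<noteq> 0" if "j < n" for j
    using u[OF that, of 0] v[OF that, of 0] by auto
  thus "den u n z \<noteq> 0" "den v n z \<noteq> 0" by (auto simp: den_def)
  have wt1: "row_weight n u v 1 z = (\<Prod>j<n. qi (q * (u j * z)) / qi (v j * z))"
    and wtm: "row_weight n u v (-1) z = (\<Prod>j<n. qi (q * (v j * z)) / qi (u j * z))"
    by (simp_all add: row_weight_def)
  have st: "qi (w * z) = (1 - w * z) * qi (q * (w * z))" for w
    using qinf_step[of "w * z"] by (simp add: mult_ac)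
  have "qi (q * (u j * z)) / qi (v j * z) = qi (u j * z) / qi (v j * z) / (1 - u j * z)" if "j < n" for j
    unfolding st[of "u j"] using nz[OF that] by simp
  thus "row_weight n u v 1 z = Uq n u v z / den u n z"
    unfolding wt1 Uq_def den_def prod_dividef[symmetric] by (intro prod.cong refl) auto
  have "qi (q * (v j * z)) / qi (u j * z) = 1 / (qi (u j * z) / qi (v j * z)) / (1 - v j * z)" if "j < n" for j
    unfolding st[of "v j"] using nz[OF that] by simp
  moreover have "1 / Uq n u v z = (\<Prod>j<n. 1 / (qi (u j * z) / qi (v j * z)))"
    unfolding Uq_def by (simp only: prod_dividef) simp
  ultimately show "row_weight n u v (-1) z = 1 / Uq n u v z / den v n z"
    unfolding wtm den_def by (simp only: prod_dividef[symmetric]) (intro prod.cong refl, auto)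
  have "qi (q * (u j * z)) / qi (v j * z) * (1 - v j * z) = qi (u j * (z * q)) / qi (v j * (z * q))" if "j < n" for j
    unfolding st[of "v j"] using nz[OF that] by (simp add: mult_ac)
  thus "row_weight n u v 1 z * den v n z = Uq n u v (z * q)"
    unfolding wt1 Uq_def den_def prod.distrib[symmetric] by (intro prod.cong refl) auto
  have "qi (q * (v j * z)) / qi (u j * z) * (1 - u j * z) = 1 / (qi (u j * (z * q)) / qi (v j * (z * q)))" if "j < n" for j
    unfolding st[of "u j"] using nz[OF that] by (simp add: mult_ac)
  moreover have "1 / Uq n u v (z * q) = (\<Prod>j<n. 1 / (qi (u j * (z * q)) / qi (v j * (z * q))))"
    unfolding Uq_def by (simp only: prod_dividef) simp
  ultimately show "row_weight n u v (-1) z * den u n z = 1 / Uq n u v (z * q)"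
    unfolding wtm den_def prod.distrib[symmetric] by (simp only:) (intro prod.cong refl, auto)
qed

text \<open>A common zero would make some quotient \<open>y i / y j\<close> an integral power of q;
  for i = j it would force equal exponents.\<close>

lemma dpoly_shiftv_neq:
  assumes y: "\<And>j. j < n \<Longrightarrow> y j \<noteq> 0"
  and sep: "\<And>i j k. i < n \<Longrightarrow> j < n \<Longrightarrow> i \<noteq> j \<Longrightarrow> y i / y j * q powi k \<noteq> 1"
  and kl: "j < n" "k j \<noteq> l j"
  shows "dpoly n (shiftv y k) \<noteq> dpoly n (shiftv y l)"
proof
  assume "dpoly n (shiftv y k) = dpoly n (shiftv y l)"
  hence "den (shiftv y k) n z = den (shiftv y l) n z" for z by (metis poly_dpoly)
  moreover have "den (shiftv y k) n (1 / shiftv y k j) = 0"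
    unfolding den_def using kl y by (intro prod_zero bexI[of _ j]) (auto simp: shiftv_def)
  ultimately have "den (shiftv y l) n (1 / shiftv y k j) = 0" by simp
  then obtain i where i: "i < n" "shiftv y l i / shiftv y k j = 1"
    by (auto simp: den_def)
  hence "y i / y j * q powi (l i - k j) = 1"
    using y[OF kl(1)] by (simp add: shiftv_def power_int_diff[OF disjI1[OF q_nz]])
  thus False using sep[OF i(1) kl(1)] kl y[OF kl(1)] by (cases "i = j") auto
qed

text \<open>Both denominators have constant term 1 and, by \<open>sum_eq\<close>, the same leading
  coefficient, so they can occupy two columns at once. The weights turn these columns into
  consecutive values of \<open>V\<close>, and the lattice sum vanishes up to a nonzero coefficient
  difference, which is divided out.\<close>

theorem has_sum_offdiag:
  fixes s :: "nat \<Rightarrow> int"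
  assumes y: "\<And>j. j < n \<Longrightarrow> y j \<noteq> 0" and x: "\<And>i. i < n \<Longrightarrow> x i \<in> pdom y n"
  and sep: "\<And>i j k. i < n \<Longrightarrow> j < n \<Longrightarrow> i \<noteq> j \<Longrightarrow> y i / y j * q powi k \<noteq> 1"
  and s: "\<And>i. i < n \<Longrightarrow> s i \<in> {1, -1}"
  and sum_eq: "(\<Sum>j<n. N j) = (\<Sum>j<n. L j)" and neq: "\<exists>j<n. N j \<noteq> L j"
  shows "((\<lambda>k. (1 - (\<Prod>j<n. shiftv y N j) * (\<Prod>i<n. x i * q powi (s i * k i))) * vdm n (\<lambda>i. x i * q powi (s i * k i)) *
     (\<Prod>i<n. row_weight n (shiftv y N) (shiftv y L) (s i) (x i * q powi (s i * k i)))) has_sum 0) (zero_sum n)"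
proof -
  let ?u = "shiftv y N" and ?v = "shiftv y L"
  have unz: "?u j \<noteq> 0" "?v j \<noteq> 0" if "j < n" for j using y[OF that] by (auto simp: shiftv_def)
  have prods: "(\<Prod>j<n. ?u j) = (\<Prod>j<n. ?v j)"
    using sum_eq by (simp add: shiftv_def prod.distrib prod_power_int)
  define P where "P = dpoly n ?u"
  define P' where "P' = dpoly n ?v"
  have P: "degree P \<le> n" "coeff P 0 = 1" "coeff P n = (-1) ^ n * (\<Prod>j<n. ?u j)"
    and P': "degree P' \<le> n" "coeff P' 0 = 1" "coeff P' n = (-1) ^ n * (\<Prod>j<n. ?u j)"
    unfolding P_def P'_def prods using dpoly[of n ?u] dpoly[of n ?v] unz prods by auto
  have "P' \<noteq> P" using dpoly_shiftv_neq[of n y _ N L] y sep neq unfolding P_def P'_def by metis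
  then obtain m0 where m0: "coeff P' m0 \<noteq> coeff P m0" by (auto simp: poly_eq_iff)
  \<comment> \<open>The two polynomials agree in degrees 0 and n, so a differing coefficient lies
    strictly between, where a monomial column can be replaced.\<close>
  have m0': "0 < m0" "m0 < n"
  proof -
    show "0 < m0" using m0 P P' by (cases "m0 = 0") auto
    show "m0 < n"
    proof (rule ccontr)
      assume "\<not> m0 < n"
      hence "m0 = n \<or> m0 > n" by auto
      thus False using m0 P P' coeff_eq_0[of P m0] coeff_eq_0[of P' m0] by auto
    qed
  qed
  have "\<exists>\<kappa>. \<kappa> \<noteq> 0 \<and> (\<forall>x\<in>pdom y n. ((\<lambda>t. Uq n ?u ?v (x * q powi t)) \<longlongrightarrow> \<kappa>) at_bot)"
    by (rule Uq_bot[OF y sum_eq])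
  then obtain \<kappa> where \<kappa>: "\<kappa> \<noteq> 0" "\<And>w. w \<in> pdom y n \<Longrightarrow> ((\<lambda>t. Uq n ?u ?v (w * q powi t)) \<longlongrightarrow> \<kappa>) at_bot"
    by blast
  define z where "z = (\<lambda>i k. x i * q powi (s i * k))"
  define w where "w = (\<lambda>i k. row_weight n ?u ?v (s i) (z i k))"
  have pole: "?u j * z i k * q powi m \<noteq> 1" "?v j * z i k * q powi m \<noteq> 1" if "i < n" "j < n" for i j k m
    unfolding z_def using shiftv_pole[OF x[OF that(1)] y that(2)] by auto
  have row_weight: "row_weight n ?u ?v 1 (z i k) = Uq n ?u ?v (z i k) / den ?u n (z i k)"
    "row_weight n ?u ?v (-1) (z i k) = 1 / Uq n ?u ?v (z i k) / den ?v n (z i k)"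
    "row_weight n ?u ?v 1 (z i k) * den ?v n (z i k) = Uq n ?u ?v (z i k * q)"
    "row_weight n ?u ?v (-1) (z i k) * den ?u n (z i k) = 1 / Uq n ?u ?v (z i k * q)"
    "den ?u n (z i k) \<noteq> 0" "den ?v n (z i k) \<noteq> 0" if "i < n" for i k
    by (rule row_weight_eq; rule pole; (rule that | assumption))+
  \<comment> \<open>For a backward row the variable at k is \<open>x i * q powi (- k)\<close>;
    evaluating at \<open>1 - k\<close> makes the product with \<open>den ?u\<close> the value at k
    and that with \<open>den ?v\<close> the value at k + 1.\<close>
  define V where "V = (\<lambda>i k. if s i = 1 then Uq n ?u ?v (x i * q powi k) else 1 / Uq n ?u ?v (x i * q powi (1 - k)))"
  have V0: "w i k * den ?u n (z i k) = V i k" and V1: "w i k * den ?v n (z i k) = V i (k + 1)" if i: "i < n" for i k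
  proof -
    have zq: "z i k * q = x i * q powi (if s i = 1 then k + 1 else 1 - k)"
      using s[OF i] qpowi_Suc[of k] qpowi_Suc[of "- k"] by (auto simp: z_def mult.assoc)
    consider "s i = 1" | "s i = -1" using s[OF i] by auto
    thus "w i k * den ?u n (z i k) = V i k"
    proof cases
      case 1
      show ?thesis unfolding w_def 1 row_weight(1)[OF i] using row_weight(5)[OF i, of k] by (simp add: V_def 1 z_def)
    next
      case 2
      show ?thesis unfolding w_def 2 row_weight(4)[OF i] zq by (simp add: V_def 2)
    qed
    consider "s i = 1" | "s i = -1" using s[OF i] by auto
    thus "w i k * den ?v n (z i k) = V i (k + 1)"
    proof cases
      case 1
      show ?thesis unfolding w_def 1 row_weight(3)[OF i] zq by (simp add: V_def 1)
    next
      case 2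
      show ?thesis unfolding w_def 2 row_weight(2)[OF i] using row_weight(6)[OF i, of k] by (simp add: V_def 2 z_def)
    qed
  qed
  \<comment> \<open>\<open>Uq\<close> and its reciprocal have finite limits at both ends of the
    orbit and are thus bounded along it, so the decay of the monomial quotient survives the
    weight.\<close>
  have bnd: "\<exists>C\<ge>0. \<forall>k. norm (w i k * z i k ^ m) \<le> C * rho k" if i: "i < n" and m: "0 < m" "m < n" for i m
  proof -
    have x0: "x i \<noteq> 0" using x[OF i] by (simp add: pdom_def)
    have U1: "((\<lambda>t. Uq n ?u ?v (x i * q powi t)) \<longlongrightarrow> 1) at_top" by (rule Uq_top)
    note U2 = \<kappa>(2)[OF x[OF i]]
    obtain B where B: "B > 0" "\<And>t. norm (Uq n ?u ?v (x i * q powi t)) \<le> B"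
      by (rule bounded_range_int[OF U1 U2], rule that, assumption+)
    have I1: "((\<lambda>t. 1 / Uq n ?u ?v (x i * q powi t)) \<longlongrightarrow> 1 / 1) at_top"
      by (intro tendsto_divide tendsto_const U1) auto
    have I2: "((\<lambda>t. 1 / Uq n ?u ?v (x i * q powi t)) \<longlongrightarrow> 1 / \<kappa>) at_bot"
      by (intro tendsto_divide tendsto_const U2 \<kappa>(1))
    obtain B' where B': "B' > 0" "\<And>t. norm (1 / Uq n ?u ?v (x i * q powi t)) \<le> B'"
      by (rule bounded_range_int[OF I1 I2], rule that, assumption+)
    have qb: "\<exists>C\<ge>0. \<forall>w\<in>{x i}. \<forall>k\<in>UNIV. norm ((w * q powi k) ^ m / den (shiftv y K) n (w * q powi k)) \<le> C * rho k" for K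
      using x0 m y shiftv_pole[OF x[OF i] y, where t = 0]
      by (intro quot_bound) (auto simp: shiftv_def)
    show ?thesis
    proof (cases "s i = 1")
      case True
      obtain C where C: "C \<ge> 0" "\<And>k. norm ((x i * q powi k) ^ m / den ?u n (x i * q powi k)) \<le> C * rho k"
        using qb[of N] by auto
      have "norm (w i k * z i k ^ m) \<le> (B * C) * rho k" for k
      proof -
        have "w i k * z i k ^ m = Uq n ?u ?v (x i * q powi k) * ((x i * q powi k) ^ m / den ?u n (x i * q powi k))"
          unfolding w_def True row_weight(1)[OF i] by (simp add: z_def True)
        also have "norm \<dots> \<le> B * (C * rho k)" unfolding norm_mult
          using B C by (intro mult_mono) auto
        finally show ?thesis by (simp add: mult_ac)
      qed
      thus ?thesis using B C by (intro exI[of _ "B * C"]) auto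
    next
      case False
      hence sm: "s i = -1" using s[OF i] by auto
      obtain C where C: "C \<ge> 0" "\<And>k. norm ((x i * q powi k) ^ m / den ?v n (x i * q powi k)) \<le> C * rho k"
        using qb[of L] by auto
      have "norm (w i k * z i k ^ m) \<le> (B' * C) * rho k" for k
      proof -
        have "w i k * z i k ^ m = 1 / Uq n ?u ?v (x i * q powi (- k)) * ((x i * q powi (- k)) ^ m / den ?v n (x i * q powi (- k)))"
          unfolding w_def sm row_weight(2)[OF i] by (simp add: z_def sm)
        also have "norm \<dots> \<le> B' * (C * rho (- k))" unfolding norm_mult
          using B'(1) C(1) by (intro mult_mono B'(2) C(2)) auto
        finally show ?thesis by (simp add: mult_ac)
      qed
      thus ?thesis using B' C by (intro exI[of _ "B' * C"]) auto
    qed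
  qed
  then obtain c where c: "\<And>i m. i < n \<Longrightarrow> 0 < m \<Longrightarrow> m < n \<Longrightarrow> c i m \<ge> 0"
    "\<And>i m k. i < n \<Longrightarrow> 0 < m \<Longrightarrow> m < n \<Longrightarrow> norm (w i k * z i k ^ m) \<le> c i m * rho k"
    by metis
  define C0 where "C0 = (\<Sum>i<n. \<Sum>m\<in>{0<..<n}. c i m)"
  have c_le: "c i m \<le> C0" if "i < n" "0 < m" "m < n" for i m
  proof -
    have "c i m \<le> (\<Sum>m\<in>{0<..<n}. c i m)" using that c(1) by (intro member_le_sum) auto
    also have "\<dots> \<le> C0" unfolding C0_def using that c(1) by (intro member_le_sum sum_nonneg) auto
    finally show ?thesis .
  qed
  have C0: "C0 \<ge> 0" unfolding C0_def using c(1) by (intro sum_nonneg) auto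
  define d where "d = (\<lambda>m. coeff (P' - P) m)"
  \<comment> \<open>The increments of \<open>V\<close> are combinations of the monomial entries with
    coefficients \<open>d m\<close>. The summand 1 makes \<open>C0 * D\<close> dominate the entries
    as well, so that a single constant serves both bounds.\<close>
  define D where "D = 1 + (\<Sum>m\<in>{0<..<n}. norm (d m))"
  have D: "D \<ge> 1" by (auto simp: D_def intro: sum_nonneg)
  have \<psi>: "norm (w i k * z i k ^ m) \<le> (C0 * D) * rho k" if "i < n" "0 < m" "m < n" for i m k
  proof -
    have "norm (w i k * z i k ^ m) \<le> c i m * rho k" by (rule c(2)) (use that in auto)
    also have "\<dots> \<le> (C0 * D) * rho k"
      using c_le[OF that] C0 D mult_left_mono[of 1 D C0] by (intro mult_right_mono) auto
    finally show ?thesis .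
  qed
  have dV: "norm (V i (k + 1) - V i k) \<le> (C0 * D) * rho k" if i: "i < n" for i k
  proof -
    have "poly (P' - P) t = (\<Sum>m\<in>{0<..<n}. d m * t ^ m)" for t
    proof -
      have "poly (P' - P) t = (\<Sum>m\<le>n. d m * t ^ m)"
        unfolding d_def by (rule poly_eq_sum_le) (use P P' in \<open>auto intro: degree_diff_le\<close>)
      also have "\<dots> = (\<Sum>m\<in>{0<..<n}. d m * t ^ m)"
      proof (intro sum.mono_neutral_right ballI)
        fix m assume "m \<in> {..n} - {0<..<n}"
        hence "m = 0 \<or> m = n" by auto
        thus "d m * t ^ m = 0" using P P' by (auto simp: d_def)
      qed auto
      finally show ?thesis .
    qed
    hence pd: "den ?v n t - den ?u n t = (\<Sum>m\<in>{0<..<n}. d m * t ^ m)" for t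
      by (simp add: P_def P'_def poly_dpoly)
    have "V i (k + 1) - V i k = w i k * (den ?v n (z i k) - den ?u n (z i k))"
      unfolding V0[OF i, of k, symmetric] V1[OF i, of k, symmetric] by (rule right_diff_distrib[symmetric])
    also have "\<dots> = (\<Sum>m\<in>{0<..<n}. d m * (w i k * z i k ^ m))"
      unfolding pd sum_distrib_left by (intro sum.cong refl mult.left_commute)
    also have "norm \<dots> \<le> (\<Sum>m\<in>{0<..<n}. norm (d m) * (C0 * rho k))"
    proof (rule sum_norm_le)
      fix m assume m: "m \<in> {0<..<n}"
      have "norm (w i k * z i k ^ m) \<le> c i m * rho k" using m i by (intro c(2)) auto
      also have "\<dots> \<le> C0 * rho k" using m i by (intro mult_right_mono c_le) auto
      finally show "norm (d m * (w i k * z i k ^ m)) \<le> norm (d m) * (C0 * rho k)"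
        by (subst norm_mult) (intro mult_left_mono, auto)
    qed
    also have "\<dots> = C0 * (D - 1) * rho k" by (simp add: D_def sum_distrib_left sum_distrib_right mult_ac)
    also have "\<dots> \<le> C0 * D * rho k" using C0 by (intro mult_right_mono mult_left_mono) auto
    finally show ?thesis .
  qed
  \<comment> \<open>In forward and backward rows alike the limit at the bottom is \<kappa> times the
    limit at the top, so the boundary terms of every minor cancel.\<close>
  have Vlim: "(V i \<longlongrightarrow> (if s i = 1 then 1 else 1 / \<kappa>)) at_top" "(V i \<longlongrightarrow> (if s i = 1 then \<kappa> else 1)) at_bot"
    if i: "i < n" for i
  proof -
    have U1: "((\<lambda>t. Uq n ?u ?v (x i * q powi t)) \<longlongrightarrow> 1) at_top" by (rule Uq_top)
    note U2 = \<kappa>(2)[OF x[OF i]]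
    have "((\<lambda>t. 1 / Uq n ?u ?v (x i * q powi (1 - t))) \<longlongrightarrow> 1 / \<kappa>) at_top"
      by (intro tendsto_divide tendsto_const filterlim_compose[OF U2 filterlim_int_diff_top] \<kappa>(1))
    thus "(V i \<longlongrightarrow> (if s i = 1 then 1 else 1 / \<kappa>)) at_top"
      using U1 by (cases "s i = 1") (auto simp: V_def)
    have "((\<lambda>t. 1 / Uq n ?u ?v (x i * q powi (1 - t))) \<longlongrightarrow> 1 / 1) at_bot"
      by (intro tendsto_divide tendsto_const filterlim_compose[OF U1 filterlim_int_diff_bot]) auto
    thus "(V i \<longlongrightarrow> (if s i = 1 then \<kappa> else 1)) at_bot"
      using U2 by (cases "s i = 1") (auto simp: V_def)
  qed
  have "((\<lambda>k. detf n (\<lambda>i m. if m = 0 then V i (k i) else if m = m0 then V i (k i + 1) else w i (k i) * z i (k i) ^ m)) has_sum 0) (zero_sum n)"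
    using m0' \<kappa>(1) C0 D
    by (intro has_sum_detf_vanish[where \<psi> = "\<lambda>i m k. w i k * z i k ^ m", OF _ _ Vlim _ dV \<psi>]) auto
  moreover have "detf n (\<lambda>i m. if m = 0 then V i (k i) else if m = m0 then V i (k i + 1) else w i (k i) * z i (k i) ^ m) =
      (coeff P' m0 - coeff P m0) * ((1 - (\<Prod>j<n. ?u j) * (\<Prod>i<n. z i (k i))) * vdm n (\<lambda>i. z i (k i)) * (\<Prod>i<n. w i (k i)))" for k
  proof -
    have "detf n (\<lambda>i m. if m = 0 then V i (k i) else if m = m0 then V i (k i + 1) else w i (k i) * z i (k i) ^ m) =
       detf n (\<lambda>i m. w i (k i) * (if m = 0 then poly P (z i (k i)) else if m = m0 then poly P' (z i (k i)) else z i (k i) ^ m))"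
      by (intro detf_cong) (auto simp: P_def P'_def poly_dpoly V0 V1)
    thus ?thesis
      unfolding detf_scale_rows detf_vandermonde_border2[OF P P' m0'] by (simp add: mult_ac)
  qed
  ultimately have "((\<lambda>k. (coeff P' m0 - coeff P m0) * ((1 - (\<Prod>j<n. ?u j) * (\<Prod>i<n. z i (k i))) * vdm n (\<lambda>i. z i (k i)) * (\<Prod>i<n. w i (k i)))) has_sum 0) (zero_sum n)"
    by simp
  from has_sum_cmult_right[OF this, of "1 / (coeff P' m0 - coeff P m0)"]
  show ?thesis using m0 by (simp add: z_def w_def)
qed

section \<open>The diagonal value in symmetric form\<close>

definition sym_theta_det :: "nat \<Rightarrow> (nat \<Rightarrow> complex) \<Rightarrow> (nat \<Rightarrow> complex) \<Rightarrow> complex" where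
  "sym_theta_det n x y = theta_det n x y * vdm n y"

text \<open>With the Vandermonde factor of y restored, x and y enter alike. Invariance under
  q-shifts of y, and the diagonal value of the second sum, are thereby reduced to statements about
  x.\<close>

lemma sym_theta_det_commute: "sym_theta_det n x y = sym_theta_det n y x"
proof -
  have "(\<Prod>i<n. \<Prod>j<n. theta (y j * x i)) = (\<Prod>j<n. \<Prod>i<n. theta (x i * y j))"
    by (subst prod.swap) (simp add: mult.commute)
  thus ?thesis by (simp add: sym_theta_det_def theta_det_def mult_ac)
qed

lemma sym_theta_det_cong: "(\<And>i. i < n \<Longrightarrow> x i = x' i) \<Longrightarrow> sym_theta_det n x y = sym_theta_det n x' y"
proof -
  assume *: "\<And>i. i < n \<Longrightarrow> x i = x' i"
  have "vdm n x = vdm n x'" unfolding vdm_def by (intro prod.cong refl) (use * in auto)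
  moreover have "qratio {..<n} x = qratio {..<n} x'" by (intro qratio_cong) (use * in auto)
  moreover have "(\<Prod>i<n. x i) = (\<Prod>i<n. x' i)" "(\<Prod>i<n. \<Prod>j<n. theta (y j * x i)) = (\<Prod>i<n. \<Prod>j<n. theta (y j * x' i))"
    by (intro prod.cong refl; use * in simp)+
  ultimately show ?thesis by (simp add: sym_theta_det_def theta_det_def)
qed

lemma sym_theta_det_shift1:
  assumes I: "I < n" and x: "\<And>i. i < n \<Longrightarrow> x i \<noteq> 0" and y: "\<And>j. j < n \<Longrightarrow> y j \<noteq> 0"
  shows "sym_theta_det n (x(I := x I * q powi d)) y = sym_theta_det n x y"
proof -
  have step: "sym_theta_det n (x(I := x I * q powi (d + 1))) y = sym_theta_det n (x(I := x I * q powi d)) y" for d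
  proof -
    let ?x = "x(I := x I * q powi d)"
    have "theta_det n (?x(I := q * ?x I)) y = theta_det n ?x y"
      using x I by (intro theta_det_shift I y) auto
    thus ?thesis by (simp add: sym_theta_det_def qpowi_Suc mult_ac)
  qed
  show ?thesis
  proof (induction d rule: int_induct[where k = 0])
    case (step2 d)
    thus ?case using step[of "d - 1"] by (simp only: diff_add_cancel)
  next
    case (step1 d)
    thus ?case using step[of d] by (simp only:)
  qed simp
qed

lemma sym_theta_det_shiftv:
  assumes x: "\<And>i. i < n \<Longrightarrow> x i \<noteq> 0" and y: "\<And>j. j < n \<Longrightarrow> y j \<noteq> 0"
  shows "sym_theta_det n (shiftv x k) y = sym_theta_det n x y"
proof -
  have "sym_theta_det n (\<lambda>i. if i < m then shiftv x k i else x i) y = sym_theta_det n x y" if "m \<le> n" for m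
    using that
  proof (induction m)
    case (Suc m)
    let ?x = "\<lambda>i. if i < m then shiftv x k i else x i"
    have "(\<lambda>i. if i < Suc m then shiftv x k i else x i) = ?x(m := ?x m * q powi k m)"
      by (auto simp: fun_eq_iff shiftv_def less_Suc_eq)
    hence "sym_theta_det n (\<lambda>i. if i < Suc m then shiftv x k i else x i) y = sym_theta_det n ?x y"
      using Suc.prems x y by (simp only:) (intro sym_theta_det_shift1, auto simp: shiftv_def)
    thus ?case using Suc by simp
  qed simp
  from this[of n] have "sym_theta_det n x y = sym_theta_det n (\<lambda>i. if i < n then shiftv x k i else x i) y" by simp
  also have "\<dots> = sym_theta_det n (shiftv x k) y" by (intro sym_theta_det_cong) auto
  finally show ?thesis ..
qed

lemma shiftv_sep:
  assumes "\<And>k. y i / y j * q powi k \<noteq> 1"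
  shows "shiftv y g i / shiftv y g j * q powi m \<noteq> 1"
proof -
  have eq: "shiftv y g i / shiftv y g j * q powi m = y i / y j * q powi (g i - g j + m)"
    by (simp add: shiftv_def power_int_diff qpowi_add)
  show ?thesis unfolding eq by (rule assms)
qed

lemma row_weight_self:
  assumes u: "\<And>j m. j < n \<Longrightarrow> u j * z * q powi m \<noteq> 1" and s: "s \<in> {1, -1}"
  shows "row_weight n u u s z = 1 / den u n z"
proof -
  have "qi (u j * z) \<noteq> 0" if "j < n" for j by (intro qinf_nonzero u that)
  hence "Uq n u u z = 1" unfolding Uq_def by (intro prod.neutral) auto
  thus ?thesis using s row_weight_eq(1,2)[of n u z u] u by auto
qed

end

section \<open>The matrices in symmetric form\<close>

lemma prod_upper_triangle: "(\<Prod>i<r::nat. \<Prod>j\<in>{i<..<r}. g i j) = (\<Prod>j<r. \<Prod>i<j. g i j :: complex)"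
proof (induction r)
  case (Suc r)
  have "(\<Prod>i<Suc r. \<Prod>j\<in>{i<..<Suc r}. g i j) = (\<Prod>i<r. \<Prod>j\<in>{i<..<Suc r}. g i j)"
  proof -
    have "{r<..<Suc r} = {}" by auto
    thus ?thesis by simp
  qed
  also have "\<dots> = (\<Prod>i<r. g i r * (\<Prod>j\<in>{i<..<r}. g i j))"
  proof (intro prod.cong refl)
    fix i assume "i \<in> {..<r}"
    hence "{i<..<Suc r} = insert r {i<..<r}" by auto
    thus "(\<Prod>j\<in>{i<..<Suc r}. g i j) = g i r * (\<Prod>j\<in>{i<..<r}. g i j)" by simp
  qed
  finally show ?case by (simp add: prod.distrib Suc.IH mult.commute)
qed simp

lemma vdm_ratio: "(\<Prod>i<r. \<Prod>j\<in>{i<..<r}. (u i - u j) / (v i - v j)) = vdm r u / vdm r v"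
proof -
  have "(u i - u j) / (v i - v j) = (u j - u i) / (v j - v i)" for i j
    using minus_divide_divide[of "u j - u i" "v j - v i"] by simp
  thus ?thesis
    unfolding prod_upper_triangle vdm_def prod_dividef[symmetric] by (simp only:)
qed

lemma vdm_nonzero: "(\<And>i j. i < j \<Longrightarrow> j < n \<Longrightarrow> z i \<noteq> z j) \<Longrightarrow> vdm n z \<noteq> 0"
  unfolding vdm_def by force

text \<open>Identifies \<open>Z^r\<close> with the vectors of sum zero in \<open>Z^(r+1)\<close>;
  index 0 carries the compensating entry, and the default 0 matches \<open>zero_sum\<close>.\<close>

definition kv :: "int list \<Rightarrow> nat \<Rightarrow> int" where
  "kv l i = (case i of 0 \<Rightarrow> - sum_list l | Suc i \<Rightarrow> if i < length l then l ! i else 0)"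

lemma kv_simps [simp]: "kv l 0 = - sum_list l" "i < length l \<Longrightarrow> kv l (Suc i) = l ! i"
  by (simp_all add: kv_def)

lemma kv_sum: "length l = r \<Longrightarrow> (\<Sum>i<Suc r. kv l i) = 0"
  unfolding sum.lessThan_Suc_shift by (simp add: sum_list_sum_nth atLeast0LessThan)

lemma bij_betw_kv: "bij_betw kv {l. length l = r} (zero_sum (Suc r))"
proof (rule bij_betwI[of _ _ _ "\<lambda>f. map (\<lambda>i. f (Suc i)) [0..<r]"])
  show "kv \<in> {l. length l = r} \<rightarrow> zero_sum (Suc r)"
  proof
    fix l :: "int list" assume "l \<in> {l. length l = r}"
    hence l: "length l = r" by simp
    have "kv l i = 0" if "i \<ge> Suc r" for i using that l by (cases i) (auto simp: kv_def)
    thus "kv l \<in> zero_sum (Suc r)" using kv_sum[OF l] unfolding zero_sum_def by blast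
  qed
  show "map (\<lambda>i. kv l (Suc i)) [0..<r] = l" if "l \<in> {l. length l = r}" for l
    using that by (intro nth_equalityI) auto
  show "kv (map (\<lambda>i. f (Suc i)) [0..<r]) = f" if f: "f \<in> zero_sum (Suc r)" for f
  proof
    fix i
    show "kv (map (\<lambda>i. f (Suc i)) [0..<r]) i = f i"
    proof (cases i)
      case 0
      have "f 0 + (\<Sum>i<r. f (Suc i)) = 0"
        using f unfolding zero_sum_def mem_Collect_eq sum.lessThan_Suc_shift by simp
      thus ?thesis using 0 by (simp add: sum_list_sum_nth atLeast0LessThan)
    next
      case (Suc j)
      thus ?thesis using f by (auto simp: kv_def zero_sum_def)
    qed
  qed
qed auto

lemma kv_neq:
  assumes "length n = r" "length l = r" "n \<noteq> l"
  shows "\<exists>j<r. kv n (Suc j) \<noteq> kv l (Suc j)"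
  using assms nth_equalityI[of n l] by force

section \<open>The generic parameters with index 0 adjoined\<close>

locale generic_nome = nome +
  fixes r :: nat and a b :: complex and c x :: "nat \<Rightarrow> complex"
  assumes generic: "generic_params r q a b c x"
begin

definition C where "C = Cprod r c"

text \<open>The parameters adjoined with index \<open>0\<close> make all factors symmetric: every base occurring in the
  theorem becomes one of \<open>yy j * xx i\<close>, \<open>xx i / xx j\<close>, \<open>yy i / yy j\<close>, and \<open>a\<close> is the product of all of them.\<close>

definition xx :: "nat \<Rightarrow> complex" where "xx i = (case i of 0 \<Rightarrow> b / C | Suc i \<Rightarrow> x i)"
definition yy :: "nat \<Rightarrow> complex" where "yy j = (case j of 0 \<Rightarrow> a / b | Suc j \<Rightarrow> c j / x j)"
text \<open>Only row 0 runs backwards: the exponent of \<open>xx 0\<close> is the sum of k, which is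
  \<open>- kv k 0\<close>.\<close>

definition sg :: "nat \<Rightarrow> int" where "sg i = (if i = 0 then -1 else 1)"
definition zx :: "int list \<Rightarrow> nat \<Rightarrow> complex" where "zx l = shiftv xx (\<lambda>i. sg i * kv l i)"
definition zy :: "int list \<Rightarrow> nat \<Rightarrow> complex" where "zy l = shiftv yy (kv l)"

lemma xy_simps [simp]: "xx 0 = b / C" "xx (Suc i) = x i" "yy 0 = a / b" "yy (Suc i) = c i / x i"
  by (simp_all add: xx_def yy_def)

lemma z_simps:
  "zx l 0 = b / C * q powi (sum_list l)" "i < length l \<Longrightarrow> zx l (Suc i) = x i * q powi (l ! i)"
  "zy l 0 = a / b * q powi (- sum_list l)" "i < length l \<Longrightarrow> zy l (Suc i) = c i / x i * q powi (l ! i)"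
  by (simp_all add: zx_def zy_def shiftv_def sg_def)

lemma params_nonzero: "a \<noteq> 0" "b \<noteq> 0" "C \<noteq> 0" "i < r \<Longrightarrow> c i \<noteq> 0" "i < r \<Longrightarrow> x i \<noteq> 0"
  using generic unfolding generic_params_def Let_def C_def Cprod_def by auto

lemma generic_bases:
  "a * q powi m \<noteq> 1" "a / C * q powi m \<noteq> 1"
  "i < r \<Longrightarrow> j < r \<Longrightarrow> c j * x i / x j * q powi m \<noteq> 1"
  "i < r \<Longrightarrow> j < r \<Longrightarrow> i \<noteq> j \<Longrightarrow> x i / x j * q powi m \<noteq> 1"
  "i < r \<Longrightarrow> j < r \<Longrightarrow> i \<noteq> j \<Longrightarrow> c j * x i / (c i * x j) * q powi m \<noteq> 1"
  "i < r \<Longrightarrow> a * x i / b * q powi m \<noteq> 1" "i < r \<Longrightarrow> a * x i / (b * c i) * q powi m \<noteq> 1"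
  "i < r \<Longrightarrow> b * c i / (a * x i) * q powi m \<noteq> 1" "i < r \<Longrightarrow> C * x i / b * q powi m \<noteq> 1"
  "i < r \<Longrightarrow> b * c i / (C * x i) * q powi m \<noteq> 1" "i < r \<Longrightarrow> b / (C * x i) * q powi m \<noteq> 1"
  using generic unfolding generic_params_def Let_def C_def by blast+

lemma xx_nonzero: "i < Suc r \<Longrightarrow> xx i \<noteq> 0"
  using params_nonzero by (cases i) auto

lemma yy_nonzero: "i < Suc r \<Longrightarrow> yy i \<noteq> 0"
  using params_nonzero by (cases i) auto

lemma yyxx_pole:
  assumes "i < Suc r" "j < Suc r"
  shows "yy j * xx i * q powi m \<noteq> 1"
proof -
  consider i' j' where "i = Suc i'" "j = Suc j'" | j' where "i = 0" "j = Suc j'"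
    | i' where "i = Suc i'" "j = 0" | "i = 0" "j = 0"
    by (cases i; cases j) auto
  thus ?thesis
  proof cases
    case 1
    hence eq: "yy j * xx i = c j' * x i' / x j'" by simp
    show ?thesis unfolding eq using assms 1 by (intro generic_bases) auto
  next
    case 2
    hence eq: "yy j * xx i = b * c j' / (C * x j')" by (simp add: mult.commute)
    show ?thesis unfolding eq using assms 2 by (intro generic_bases) auto
  next
    case 3
    hence eq: "yy j * xx i = a * x i' / b" by simp
    show ?thesis unfolding eq using assms 3 by (intro generic_bases) auto
  next
    case 4
    hence eq: "yy j * xx i = a / C" using params_nonzero by simp
    show ?thesis unfolding eq by (rule generic_bases)
  qed
qed

lemma xx_sep:
  assumes "i < Suc r" "j < Suc r" "i \<noteq> j"
  shows "xx i / xx j * q powi m \<noteq> 1"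
proof (cases i; cases j)
  fix i' j' assume "i = Suc i'" "j = Suc j'"
  thus ?thesis using assms generic_bases(4)[of i' j' m] by simp
next
  fix j' assume "i = 0" "j = Suc j'"
  thus ?thesis using assms generic_bases(11)[of j' m] by simp
next
  fix i' assume "i = Suc i'" "j = 0"
  thus ?thesis using assms generic_bases(9)[of i' m] by (simp add: mult_ac)
qed (use assms in auto)

lemma yy_sep:
  assumes "i < Suc r" "j < Suc r" "i \<noteq> j"
  shows "yy i / yy j * q powi m \<noteq> 1"
proof (cases i; cases j)
  fix i' j' assume "i = Suc i'" "j = Suc j'"
  thus ?thesis using assms generic_bases(5)[of j' i' m] by (simp add: mult_ac)
next
  fix j' assume "i = 0" "j = Suc j'"
  thus ?thesis using assms generic_bases(7)[of j' m] by (simp add: mult_ac)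
next
  fix i' assume "i = Suc i'" "j = 0"
  thus ?thesis using assms generic_bases(8)[of i' m] by (simp add: mult_ac)
qed (use assms in auto)

lemma prod_xx_yy: "(\<Prod>i<Suc r. xx i) * (\<Prod>j<Suc r. yy j) = a"
proof -
  have "(\<Prod>i<r. x i) \<noteq> 0" using params_nonzero by auto
  moreover have "(\<Prod>i<r. c i) = C" by (simp add: C_def Cprod_def)
  ultimately show ?thesis
    unfolding prod.lessThan_Suc_shift using params_nonzero by (simp add: prod_dividef)
qed

lemma in_pdom: "i < Suc r \<Longrightarrow> xx i \<in> pdom yy (Suc r)" "i < Suc r \<Longrightarrow> yy i \<in> pdom xx (Suc r)"
  using yyxx_pole xx_nonzero yy_nonzero by (auto simp: pdom_def theta_zero_iff mult.commute)

section \<open>Matching the constants with the theta quotient\<close>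

definition pref :: complex where
  "pref = qi (a*q/C) * qi (C*q/a) / (qi (a*q) * qi (q/a))
   * (\<Prod>i<r. \<Prod>j<r. qi (q*c j*x i/x j) * qi (q*x i/(c i*x j))
                     / (qi (q*c j*x i/(c i*x j)) * qi (q*x i/x j)))
   * (\<Prod>i<r. qi (a*x i*q/b) * qi (b*q/(a*x i)) * qi (b*c i*q/(C*x i)) * qi (C*x i*q/(b*c i))
             / (qi (a*x i*q/(b*c i)) * qi (b*c i*q/(a*x i)) * qi (C*x i*q/b) * qi (b*q/(C*x i))))"

lemma qratio_full:
  assumes "\<And>i. i < n \<Longrightarrow> z i \<noteq> 0"
  shows "(\<Prod>i<n. \<Prod>j<n. qi (q * z i / z j)) = qi q ^ n * qratio {..<n} z"
proof -
  have "(\<Prod>i<n. \<Prod>j<n. qi (q * z i / z j)) = (\<Prod>i<n. qi q * (\<Prod>j\<in>{..<n}-{i}. qi (q * z i / z j)))"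
  proof (intro prod.cong refl)
    fix i assume i: "i \<in> {..<n}"
    show "(\<Prod>j<n. qi (q * z i / z j)) = qi q * (\<Prod>j\<in>{..<n}-{i}. qi (q * z i / z j))"
      using i assms[of i] by (subst prod.remove[of _ i]) auto
  qed
  thus ?thesis by (simp add: prod.distrib qratio_def)
qed

lemma qratio_Suc: "qratio {..<Suc n} z = qratio {..<n} (\<lambda>i. z (Suc i)) * (\<Prod>i<n. theta_hat (z 0 / z (Suc i)))"
proof -
  have "{..<Suc n} - {0} = Suc ` {..<n}" unfolding image_Suc_lessThan by auto
  hence bij: "bij_betw Suc {..<n} ({..<Suc n} - {0})" by (simp add: bij_betw_def)
  show ?thesis
    by (subst qratio_remove[of _ 0]) (auto simp: qratio_reindex[OF bij] prod.reindex_bij_betw[OF bij, symmetric] o_def)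
qed

text \<open>The adjoined index absorbs the single and simple products of the prefactor into full
  double products. The diagonal terms i = j of the two double products in its denominator give
  \<open>qi q\<close> r times each, hence the exponent \<open>2 * r\<close>.\<close>

lemma pref_eq:
  "pref = (\<Prod>i<Suc r. \<Prod>j<Suc r. theta_hat (yy j * xx i)) /
     (theta_hat a * (qi q ^ (2 * r) * (qratio {..<Suc r} xx * qratio {..<Suc r} yy)))"
proof -
  note nz = params_nonzero
  have 1: "qi (a*q/C) * qi (C*q/a) / (qi (a*q) * qi (q/a)) = theta_hat (yy 0 * xx 0) / theta_hat a"
    using nz by (simp add: theta_hat_def mult_ac)
  have A: "(\<Prod>i<r. \<Prod>j<r. qi (q*x i/(c i*x j))) = (\<Prod>i<r. \<Prod>j<r. qi (q / (yy (Suc j) * xx (Suc i))))"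
    by (subst prod.swap) (simp add: mult_ac)
  have B: "(\<Prod>i<r. \<Prod>j<r. qi (q*c j*x i/(c i*x j))) = qi q ^ r * qratio {..<r} (\<lambda>i. yy (Suc i))"
  proof -
    have "(\<Prod>i<r. \<Prod>j<r. qi (q*c j*x i/(c i*x j))) = (\<Prod>i<r. \<Prod>j<r. qi (q * yy (Suc i) / yy (Suc j)))"
      by (subst prod.swap) (simp add: mult_ac)
    also have "\<dots> = qi q ^ r * qratio {..<r} (\<lambda>i. yy (Suc i))"
      by (intro qratio_full yy_nonzero) simp
    finally show ?thesis .
  qed
  have D: "(\<Prod>i<r. \<Prod>j<r. qi (q*x i/x j)) = qi q ^ r * qratio {..<r} (\<lambda>i. xx (Suc i))"
    using qratio_full[of r "\<lambda>i. xx (Suc i)"] nz by simp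
  have E: "(\<Prod>i<r. \<Prod>j<r. qi (q*c j*x i/x j)) = (\<Prod>i<r. \<Prod>j<r. qi (q * (yy (Suc j) * xx (Suc i))))"
    by (simp add: mult_ac)
  have 2: "(\<Prod>i<r. \<Prod>j<r. qi (q*c j*x i/x j) * qi (q*x i/(c i*x j)) / (qi (q*c j*x i/(c i*x j)) * qi (q*x i/x j))) =
     (\<Prod>i<r. \<Prod>j<r. theta_hat (yy (Suc j) * xx (Suc i))) /
     ((qi q ^ r * qratio {..<r} (\<lambda>i. yy (Suc i))) * (qi q ^ r * qratio {..<r} (\<lambda>i. xx (Suc i))))"
    unfolding prod_dividef prod.distrib A B D E theta_hat_def by simp
  have 3: "(\<Prod>i<r. qi (a*x i*q/b) * qi (b*q/(a*x i)) * qi (b*c i*q/(C*x i)) * qi (C*x i*q/(b*c i))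
             / (qi (a*x i*q/(b*c i)) * qi (b*c i*q/(a*x i)) * qi (C*x i*q/b) * qi (b*q/(C*x i)))) =
     (\<Prod>i<r. theta_hat (yy 0 * xx (Suc i))) * (\<Prod>i<r. theta_hat (yy (Suc i) * xx 0)) /
     ((\<Prod>i<r. theta_hat (yy 0 / yy (Suc i))) * (\<Prod>i<r. theta_hat (xx 0 / xx (Suc i))))"
    unfolding prod.distrib[symmetric] prod_dividef[symmetric]
    by (intro prod.cong refl) (simp add: theta_hat_def mult_ac)
  have 4: "(\<Prod>i<Suc r. \<Prod>j<Suc r. theta_hat (yy j * xx i)) =
     (theta_hat (yy 0 * xx 0) * (\<Prod>i<r. theta_hat (yy (Suc i) * xx 0))) *
     ((\<Prod>i<r. theta_hat (yy 0 * xx (Suc i))) * (\<Prod>i<r. \<Prod>j<r. theta_hat (yy (Suc j) * xx (Suc i))))"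
    unfolding prod.lessThan_Suc_shift by (simp only: prod.distrib)
  have Q: "qi q ^ (2 * r) = qi q ^ r * qi q ^ r" by (simp add: mult_2 power_add)
  show ?thesis
    unfolding pref_def 1 2 3 4 qratio_Suc Q by (simp add: mult_ac del: xy_simps)
qed

text \<open>Each shifted factorial is a quotient \<open>qi u / qi (u * q powi m)\<close>.
  \<open>Fb\<close> and \<open>Gb\<close> collect the unshifted parts in f and g, \<open>Fk\<close>
  and \<open>Gk\<close> the parts depending on the indices. Factors containing \<open>xx 0\<close>
  stand opposite to the others.\<close>

definition Fb :: complex where
  "Fb = (\<Prod>j<Suc r. qi (yy j * xx 0)) * (\<Prod>i<r. \<Prod>j<Suc r. 1 / qi (q * (yy j * xx (Suc i))))"
definition Gb :: complex where
  "Gb = (\<Prod>j<Suc r. 1 / qi (q * (yy j * xx 0))) * (\<Prod>i<r. \<Prod>j<Suc r. qi (yy j * xx (Suc i)))"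
definition Fk :: "(nat \<Rightarrow> complex) \<Rightarrow> (nat \<Rightarrow> complex) \<Rightarrow> complex" where
  "Fk v u = (\<Prod>j<Suc r. 1 / qi (v j * u 0)) * (\<Prod>i<r. \<Prod>j<Suc r. qi (q * (v j * u (Suc i))))"
definition Gk :: "(nat \<Rightarrow> complex) \<Rightarrow> (nat \<Rightarrow> complex) \<Rightarrow> complex" where
  "Gk u v = (\<Prod>j<Suc r. qi (q * (v j * u 0))) * (\<Prod>i<r. \<Prod>j<Suc r. 1 / qi (v j * u (Suc i)))"

lemma qi_nonzero: "i < Suc r \<Longrightarrow> j < Suc r \<Longrightarrow> qi (yy j * xx i) \<noteq> 0" "i < Suc r \<Longrightarrow> j < Suc r \<Longrightarrow> qi (q * (yy j * xx i)) \<noteq> 0"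
proof -
  assume ij: "i < Suc r" "j < Suc r"
  show "qi (yy j * xx i) \<noteq> 0" by (intro qinf_nonzero yyxx_pole ij)
  have "q * (yy j * xx i) * q powi m \<noteq> 1" for m
    using yyxx_pole[OF ij, of "m + 1"] by (simp add: qpowi_Suc mult_ac)
  thus "qi (q * (yy j * xx i)) \<noteq> 0" by (intro qinf_nonzero)
qed

lemma Fb_Gb: "Fb * Gb = (\<Prod>i<Suc r. \<Prod>j<Suc r. 1 - yy j * xx i)"
proof -
  have st: "qi (yy j * xx i) * (1 / qi (q * (yy j * xx i))) = 1 - yy j * xx i" if "i < Suc r" "j < Suc r" for i j
    using qinf_step[of "yy j * xx i"] qi_nonzero[OF that] by (simp add: mult_ac)
  have "Fb * Gb = (\<Prod>j<Suc r. qi (yy j * xx 0) * (1 / qi (q * (yy j * xx 0)))) *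
     (\<Prod>i<r. \<Prod>j<Suc r. qi (yy j * xx (Suc i)) * (1 / qi (q * (yy j * xx (Suc i)))))"
    unfolding Fb_def Gb_def prod.distrib by (simp only: mult_ac)
  also have "\<dots> = (\<Prod>j<Suc r. 1 - yy j * xx 0) * (\<Prod>i<r. \<Prod>j<Suc r. 1 - yy j * xx (Suc i))"
    by (intro arg_cong2[where f = "(*)"] prod.cong refl st) auto
  also have "\<dots> = (\<Prod>i<Suc r. \<Prod>j<Suc r. 1 - yy j * xx i)"
    by (subst (2) prod.lessThan_Suc_shift) simp
  finally show ?thesis .
qed

definition const :: complex where
  "const = (pref * Fb / vdm (Suc r) yy) * (Gb / ((1 - a) * vdm (Suc r) xx))"

lemma qratio_nonzero:
  assumes "\<And>i j m. i < n \<Longrightarrow> j < n \<Longrightarrow> i \<noteq> j \<Longrightarrow> z i / z j * q powi m \<noteq> 1"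
  shows "qratio {..<n} z \<noteq> 0"
proof -
  have "qi (q * z i / z j) \<noteq> 0" if "i < n" "j < n" "i \<noteq> j" for i j
  proof (rule qinf_nonzero)
    fix m show "q * z i / z j * q powi m \<noteq> 1"
      using assms[OF that, of "m + 1"] by (simp add: qpowi_Suc mult_ac)
  qed
  thus ?thesis unfolding qratio_def by auto
qed

text \<open>The finite factors \<open>1 - yy j * xx i\<close> from \<open>Fb * Gb\<close> complete
  the \<open>theta_hat\<close> factors of \<open>pref\<close> to theta functions, and
  \<open>1 - a\<close> does the same for \<open>theta_hat a\<close>; then everything
  cancels.\<close>

lemma const_sym_theta_det: "const * sym_theta_det (Suc r) xx yy = 1"
proof -
  have th: "theta a \<noteq> 0" using theta_zero_iff[of a] params_nonzero generic_bases(1) by auto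
  have tha: "theta a = (1 - a) * theta_hat a" by (rule theta_eq)
  have vx: "vdm (Suc r) xx \<noteq> 0"
    using xx_sep[where m = 0] xx_nonzero by (intro vdm_nonzero) force
  have vy: "vdm (Suc r) yy \<noteq> 0"
    using yy_sep[where m = 0] yy_nonzero by (intro vdm_nonzero) force
  have px: "qratio {..<Suc r} xx \<noteq> 0" by (intro qratio_nonzero xx_sep)
  have py: "qratio {..<Suc r} yy \<noteq> 0" by (intro qratio_nonzero yy_sep)
  define P1 where "P1 = (\<Prod>i<Suc r. \<Prod>j<Suc r. 1 - yy j * xx i)"
  define P2 where "P2 = (\<Prod>i<Suc r. \<Prod>j<Suc r. theta_hat (yy j * xx i))"
  have P: "(\<Prod>i<Suc r. \<Prod>j<Suc r. theta (yy j * xx i)) = P1 * P2"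
    unfolding P1_def P2_def theta_eq prod.distrib ..
  have "theta (yy j * xx i) \<noteq> 0" if "i < Suc r" "j < Suc r" for i j
    using in_pdom(1)[OF that(1)] that by (simp add: pdom_def)
  hence "P1 * P2 \<noteq> 0" unfolding P[symmetric] by auto
  hence P12: "P1 \<noteq> 0" "P2 \<noteq> 0" by auto
  have FG: "Fb * Gb = P1" unfolding P1_def by (rule Fb_Gb)
  have "const * sym_theta_det (Suc r) xx yy = (pref * (Fb * Gb) / (vdm (Suc r) yy * ((1 - a) * vdm (Suc r) xx))) *
      (theta a * (vdm (Suc r) xx * qratio {..<Suc r} xx) * qratio {..<Suc r} yy * qi q ^ (2 * r) / (P1 * P2) * vdm (Suc r) yy)"
    unfolding const_def sym_theta_det_def theta_det_def prod_xx_yy P by simp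
  also have "\<dots> = 1"
  proof -
    have alg: "P2 / (ta * (Q * (p1 * p2))) * P1 / (v2 * (s * v1)) * (s * ta * (v1 * p1) * p2 * Q / (P1 * P2) * v2) = 1"
      if "ta \<noteq> 0" "Q \<noteq> 0" "p1 \<noteq> 0" "p2 \<noteq> 0" "v1 \<noteq> 0" "v2 \<noteq> 0" "s \<noteq> 0" for ta Q p1 p2 v1 v2 s :: complex
      using that P12 by (simp add: field_simps)
    show ?thesis
      unfolding FG tha pref_eq P2_def[symmetric]
      using th tha vx vy px py qinf_q_nonzero by (intro alg) auto
  qed
  finally show ?thesis .
qed


section \<open>Rewriting the entries of f and g\<close>

lemma powers_zyzx: "zy n j * zx k i = yy j * xx i * q powi (kv n j + sg i * kv k i)"
  by (simp add: zx_def zy_def shiftv_def qpowi_add mult_ac)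

text \<open>The factors \<open>1 - z (Suc i) / z 0\<close> are the differences with index 0,
  normalised by \<open>z 0\<close>; they enlarge the Vandermonde product at the cost of a power of
  t.\<close>

lemma vdm_Suc_ratio:
  assumes "z 0 \<noteq> 0" "w 0 \<noteq> 0" "z 0 = w 0 * t"
  shows "vdm n (\<lambda>i. z (Suc i)) / vdm n (\<lambda>i. w (Suc i)) * (\<Prod>i<n. (1 - z (Suc i) / z 0) / (1 - w (Suc i) / w 0)) =
     vdm (Suc n) z / vdm (Suc n) w / t ^ n"
proof -
  have t: "t \<noteq> 0" using assms by auto
  have eq: "(1 - z (Suc i) / z 0) / (1 - w (Suc i) / w 0) = (z (Suc i) - z 0) / (w (Suc i) - w 0) * (1 / t)" for i
  proof -
    have "(1 - z (Suc i) / z 0) = (z (Suc i) - z 0) * (- 1 / z 0)" "(1 - w (Suc i) / w 0) = (w (Suc i) - w 0) * (- 1 / w 0)"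
      using assms(1,2) by (simp_all add: field_simps)
    hence "(1 - z (Suc i) / z 0) / (1 - w (Suc i) / w 0) = (z (Suc i) - z 0) / (w (Suc i) - w 0) * ((- 1 / z 0) / (- 1 / w 0))"
      by simp
    also have "(- 1 / z 0) / (- 1 / w 0) = 1 / t" using assms t by simp
    finally show ?thesis .
  qed
  have "(\<Prod>i<n. (1 - z (Suc i) / z 0) / (1 - w (Suc i) / w 0)) =
      (\<Prod>i<n. z (Suc i) - z 0) / (\<Prod>i<n. w (Suc i) - w 0) * (1 / t) ^ n"
    unfolding eq by (simp add: prod.distrib prod_dividef power_one_over)
  thus ?thesis unfolding vdm_Suc_shift by (simp add: power_one_over mult_ac)
qed

text \<open>The variant for g, where the differences are normalised by \<open>z (Suc i)\<close>
  instead of \<open>z 0\<close>.\<close>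

lemma vdm_Suc_ratio':
  assumes "\<And>i. i < n \<Longrightarrow> z (Suc i) \<noteq> 0" "\<And>i. i < n \<Longrightarrow> w (Suc i) \<noteq> 0"
  shows "vdm n (\<lambda>i. z (Suc i)) / vdm n (\<lambda>i. w (Suc i)) * (\<Prod>i<n. (1 - z 0 / z (Suc i)) / (1 - w 0 / w (Suc i))) =
     vdm (Suc n) z / vdm (Suc n) w * ((\<Prod>i<n. w (Suc i)) / (\<Prod>i<n. z (Suc i)))"
proof -
  have "(1 - z 0 / z (Suc i)) / (1 - w 0 / w (Suc i)) = (z (Suc i) - z 0) / (w (Suc i) - w 0) * (w (Suc i) / z (Suc i))" if "i < n" for i
  proof -
    have "1 - z 0 / z (Suc i) = (z (Suc i) - z 0) / z (Suc i)" "1 - w 0 / w (Suc i) = (w (Suc i) - w 0) / w (Suc i)"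
      using assms that by (simp_all add: field_simps)
    thus ?thesis by simp
  qed
  hence "(\<Prod>i<n. (1 - z 0 / z (Suc i)) / (1 - w 0 / w (Suc i))) =
      (\<Prod>i<n. (z (Suc i) - z 0) / (w (Suc i) - w 0) * (w (Suc i) / z (Suc i)))"
    by (intro prod.cong) auto
  thus ?thesis unfolding vdm_Suc_shift by (simp add: prod.distrib prod_dividef mult_ac)
qed

text \<open>The power of \<open>q powi sum_list n\<close> is left over from completing the
  Vandermonde product, because \<open>yy 0\<close> is shifted by
  \<open>q powi (- sum_list n)\<close>.\<close>

lemma fmat_eq:
  assumes n: "length n = r" and k: "length k = r"
  shows "fmat r q a b c x n k = pref * Fb / vdm (Suc r) yy * (q powi sum_list n) ^ r * vdm (Suc r) (zy n) * Fk (zy n) (zx k)"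
proof -
  note nz = params_nonzero
  let ?N = "sum_list n" and ?K = "sum_list k"
  have z: "zy n (Suc i) = c i / x i * q powi (n ! i)" "zx k (Suc i) = x i * q powi (k ! i)" if "i < r" for i
    using that n k by (simp_all add: z_simps)
  have 1: "(\<Prod>i<r. \<Prod>j\<in>{i<..<r}. (c i * q powi (n!i) / x i - c j * q powi (n!j) / x j) / (c i / x i - c j / x j)) =
     vdm r (\<lambda>i. zy n (Suc i)) / vdm r (\<lambda>i. yy (Suc i))"
    unfolding vdm_ratio[symmetric] by (intro prod.cong refl) (auto simp: z)
  have 2: "(\<Prod>i<r. (1 - b * c i * q powi (n!i + ?N) / (a * x i)) / (1 - b * c i / (a * x i))) =
     (\<Prod>i<r. (1 - zy n (Suc i) / zy n 0) / (1 - yy (Suc i) / yy 0))"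
  proof (intro prod.cong refl)
    fix i assume "i \<in> {..<r}"
    hence i: "i < r" by simp
    have "zy n (Suc i) / zy n 0 = b * c i * q powi (n!i + ?N) / (a * x i)"
      unfolding z_simps(3) z(1)[OF i] using nz(1,2) by (simp add: power_int_minus qpowi_add field_simps)
    thus "(1 - b * c i * q powi (n!i + ?N) / (a * x i)) / (1 - b * c i / (a * x i)) =
      (1 - zy n (Suc i) / zy n 0) / (1 - yy (Suc i) / yy 0)"
      by (simp add: mult_ac)
  qed
  have 12: "(\<Prod>i<r. \<Prod>j\<in>{i<..<r}. (c i * q powi (n!i) / x i - c j * q powi (n!j) / x j) / (c i / x i - c j / x j)) *
     (\<Prod>i<r. (1 - b * c i * q powi (n!i + ?N) / (a * x i)) / (1 - b * c i / (a * x i))) =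
     vdm (Suc r) (zy n) / vdm (Suc r) yy * (q powi ?N) ^ r"
  proof -
    have "zy n 0 \<noteq> 0" "yy 0 \<noteq> 0" "zy n 0 = yy 0 * q powi (- ?N)"
      using nz by (auto simp: z_simps)
    hence "vdm r (\<lambda>i. zy n (Suc i)) / vdm r (\<lambda>i. yy (Suc i)) * (\<Prod>i<r. (1 - zy n (Suc i) / zy n 0) / (1 - yy (Suc i) / yy 0)) =
      vdm (Suc r) (zy n) / vdm (Suc r) yy / (q powi (- ?N)) ^ r"
      by (rule vdm_Suc_ratio)
    thus ?thesis unfolding 1 2 by (simp add: power_int_minus power_inverse divide_inverse)
  qed
  have 3: "qpoch (a/C) q (?K - ?N) = qi (yy 0 * xx 0) * (1 / qi (zy n 0 * zx k 0))"
  proof -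
    have "a / C * q powi (?K - ?N) = zy n 0 * zx k 0"
      unfolding powers_zyzx using nz by (simp add: sg_def add.commute)
    thus ?thesis using nz by (simp add: qpoch_def)
  qed
  have 4: "1 / qpoch (q*c j*x i/x j) q (n!j + k!i) =
     1 / qi (q * (yy (Suc j) * xx (Suc i))) * qi (q * (zy n (Suc j) * zx k (Suc i)))" if "i < r" "j < r" for i j
  proof -
    have e1: "q * (zy n (Suc j) * zx k (Suc i)) = q*c j*x i/x j * q powi (n!j + k!i)"
      unfolding powers_zyzx using that n k by (simp add: sg_def)
    have e2: "q * (yy (Suc j) * xx (Suc i)) = q*c j*x i/x j" by simp
    show ?thesis unfolding e1 e2 qpoch_def by simp
  qed
  have 5: "qpoch (b*c i/(C*x i)) q (n!i + ?K) / qpoch (a*x i*q/b) q (k!i - ?N) =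
     qi (yy (Suc i) * xx 0) * (1 / qi (zy n (Suc i) * zx k 0)) *
     (1 / qi (q * (yy 0 * xx (Suc i))) * qi (q * (zy n 0 * zx k (Suc i))))" if i: "i < r" for i
  proof -
    have e1: "zy n (Suc i) * zx k 0 = b*c i/(C*x i) * q powi (n!i + ?K)"
      unfolding powers_zyzx using i n by (simp add: sg_def mult_ac)
    have e2: "yy (Suc i) * xx 0 = b*c i/(C*x i)" by (simp add: mult_ac)
    have e3: "q * (zy n 0 * zx k (Suc i)) = a*x i*q/b * q powi (k!i - ?N)"
      unfolding powers_zyzx using i k by (simp add: sg_def add.commute mult_ac)
    have e4: "q * (yy 0 * xx (Suc i)) = a*x i*q/b" by (simp add: mult_ac)
    show ?thesis unfolding e1 e2 e3 e4 qpoch_def by simp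
  qed
  have 6: "qpoch (a/C) q (?K - ?N) * (\<Prod>i<r. \<Prod>j<r. 1 / qpoch (q*c j*x i/x j) q (n!j + k!i)) *
     (\<Prod>i<r. qpoch (b*c i/(C*x i)) q (n!i + ?K) / qpoch (a*x i*q/b) q (k!i - ?N)) = Fb * Fk (zy n) (zx k)"
  proof -
    have 7: "(\<Prod>i<r. \<Prod>j<r. 1 / qpoch (q*c j*x i/x j) q (n!j + k!i)) =
      (\<Prod>i<r. \<Prod>j<r. 1 / qi (q * (yy (Suc j) * xx (Suc i)))) * (\<Prod>i<r. \<Prod>j<r. qi (q * (zy n (Suc j) * zx k (Suc i))))"
      unfolding prod.distrib[symmetric] by (intro prod.cong refl 4) auto
    have 8: "(\<Prod>i<r. qpoch (b*c i/(C*x i)) q (n!i + ?K) / qpoch (a*x i*q/b) q (k!i - ?N)) =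
      (\<Prod>i<r. qi (yy (Suc i) * xx 0)) * (\<Prod>i<r. 1 / qi (zy n (Suc i) * zx k 0)) *
      ((\<Prod>i<r. 1 / qi (q * (yy 0 * xx (Suc i)))) * (\<Prod>i<r. qi (q * (zy n 0 * zx k (Suc i)))))"
      unfolding prod.distrib[symmetric] by (intro prod.cong refl 5) auto
    show ?thesis
      unfolding 3 7 8 Fb_def Fk_def prod.lessThan_Suc_shift prod.distrib by (simp only: mult_ac)
  qed
  have "fmat r q a b c x n k = pref *
     ((\<Prod>i<r. \<Prod>j\<in>{i<..<r}. (c i * q powi (n!i) / x i - c j * q powi (n!j) / x j) / (c i / x i - c j / x j)) *
     (\<Prod>i<r. (1 - b * c i * q powi (n!i + ?N) / (a * x i)) / (1 - b * c i / (a * x i)))) *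
     (qpoch (a/C) q (?K - ?N) * (\<Prod>i<r. \<Prod>j<r. 1 / qpoch (q*c j*x i/x j) q (n!j + k!i)) *
     (\<Prod>i<r. qpoch (b*c i/(C*x i)) q (n!i + ?K) / qpoch (a*x i*q/b) q (k!i - ?N)))"
    unfolding fmat_def Let_def C_def[symmetric] pref_def by (simp only: mult.assoc)
  thus ?thesis unfolding 6 12 by (simp only: mult_ac times_divide_eq_left times_divide_eq_right)
qed

lemma prod_zx: "length k = r \<Longrightarrow> (\<Prod>i<r. zx k (Suc i)) = (\<Prod>i<r. xx (Suc i)) * q powi sum_list k"
proof -
  assume k: "length k = r"
  have "(\<Prod>i<r. q powi (k ! i)) = q powi sum_list k"
    using k by (simp add: prod_power_int sum_list_sum_nth atLeast0LessThan)
  thus ?thesis using k by (simp add: z_simps prod.distrib)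
qed

lemma prod_zx_yy: "length k = r \<Longrightarrow> (\<Prod>j<Suc r. yy j) * (\<Prod>i<Suc r. zx k i) = a * q powi (2 * sum_list k)"
proof -
  assume k: "length k = r"
  have "(\<Prod>i<Suc r. zx k i) = (\<Prod>i<Suc r. xx i) * q powi (2 * sum_list k)"
    unfolding prod.lessThan_Suc_shift prod_zx[OF k] z_simps mult_2 qpowi_add by (simp add: mult_ac)
  hence "(\<Prod>j<Suc r. yy j) * (\<Prod>i<Suc r. zx k i) = ((\<Prod>i<Suc r. xx i) * (\<Prod>j<Suc r. yy j)) * q powi (2 * sum_list k)"
    by (simp only: mult_ac)
  thus ?thesis by (simp only: prod_xx_yy)
qed

text \<open>This explains the explicit power of q in g: its part in k compensates the completion of
  the Vandermonde product in x, and its part in l is the inverse of the power left over in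
  \<open>fmat_eq\<close>.\<close>

lemma gmat_eq:
  assumes k: "length k = r" and l: "length l = r"
  shows "gmat r q a b c x k l = Gb / ((1 - a) * vdm (Suc r) xx) * (q powi (- sum_list l)) ^ r *
     ((1 - (\<Prod>j<Suc r. yy j) * (\<Prod>i<Suc r. zx k i)) * vdm (Suc r) (zx k)) * Gk (zx k) (zy l)"
proof -
  note nz = params_nonzero
  let ?L = "sum_list l" and ?K = "sum_list k"
  have z: "zy l (Suc i) = c i / x i * q powi (l ! i)" "zx k (Suc i) = x i * q powi (k ! i)" if "i < r" for i
    using that l k by (simp_all add: z_simps)
  have 1: "(\<Prod>i<r. \<Prod>j\<in>{i<..<r}. (x i * q powi (k!i) - x j * q powi (k!j)) / (x i - x j)) =
     vdm r (\<lambda>i. zx k (Suc i)) / vdm r (\<lambda>i. xx (Suc i))"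
    unfolding vdm_ratio[symmetric] by (intro prod.cong refl) (auto simp: z)
  have 2: "(\<Prod>i<r. (1 - b * q powi (?K - k!i) / (C * x i)) / (1 - b / (C * x i))) =
     (\<Prod>i<r. (1 - zx k 0 / zx k (Suc i)) / (1 - xx 0 / xx (Suc i)))"
  proof (intro prod.cong refl)
    fix i assume "i \<in> {..<r}"
    hence i: "i < r" by simp
    have "zx k 0 / zx k (Suc i) = b * q powi (?K - k!i) / (C * x i)"
      unfolding z_simps(1) z(2)[OF i] by (simp add: power_int_diff)
    thus "(1 - b * q powi (?K - k!i) / (C * x i)) / (1 - b / (C * x i)) =
      (1 - zx k 0 / zx k (Suc i)) / (1 - xx 0 / xx (Suc i))"
      by simp
  qed
  have px: "(\<Prod>i<r. xx (Suc i)) \<noteq> 0" using nz by auto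
  have 12: "(\<Prod>i<r. \<Prod>j\<in>{i<..<r}. (x i * q powi (k!i) - x j * q powi (k!j)) / (x i - x j)) *
     (\<Prod>i<r. (1 - b * q powi (?K - k!i) / (C * x i)) / (1 - b / (C * x i))) =
     vdm (Suc r) (zx k) / vdm (Suc r) xx * (1 / q powi ?K)"
  proof -
    have "zx k (Suc i) \<noteq> 0" "xx (Suc i) \<noteq> 0" if "i < r" for i using nz that by (auto simp: z)
    hence "vdm r (\<lambda>i. zx k (Suc i)) / vdm r (\<lambda>i. xx (Suc i)) * (\<Prod>i<r. (1 - zx k 0 / zx k (Suc i)) / (1 - xx 0 / xx (Suc i))) =
      vdm (Suc r) (zx k) / vdm (Suc r) xx * ((\<Prod>i<r. xx (Suc i)) / (\<Prod>i<r. zx k (Suc i)))"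
      by (intro vdm_Suc_ratio')
    also have "(\<Prod>i<r. xx (Suc i)) / (\<Prod>i<r. zx k (Suc i)) = 1 / q powi ?K"
      unfolding prod_zx[OF k] using px by simp
    finally show ?thesis unfolding 1 2 .
  qed
  have 3: "1 / qpoch (a*q/C) q (?K - ?L) = 1 / qi (q * (yy 0 * xx 0)) * qi (q * (zy l 0 * zx k 0))"
  proof -
    have e1: "q * (zy l 0 * zx k 0) = a*q/C * q powi (?K - ?L)"
      unfolding powers_zyzx using nz by (simp add: sg_def add.commute mult_ac)
    have e2: "q * (yy 0 * xx 0) = a*q/C" using nz by (simp add: mult_ac)
    show ?thesis unfolding e1 e2 qpoch_def by simp
  qed
  have 4: "qpoch (c j*x i/x j) q (k!i + l!j) =
     qi (yy (Suc j) * xx (Suc i)) * (1 / qi (zy l (Suc j) * zx k (Suc i)))" if "i < r" "j < r" for i j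
  proof -
    have e1: "zy l (Suc j) * zx k (Suc i) = c j*x i/x j * q powi (k!i + l!j)"
      unfolding powers_zyzx using that l k by (simp add: sg_def add.commute)
    have e2: "yy (Suc j) * xx (Suc i) = c j*x i/x j" by simp
    show ?thesis unfolding e1 e2 qpoch_def by simp
  qed
  have 5: "qpoch (a*x i/b) q (k!i - ?L) / qpoch (b*c i*q/(C*x i)) q (?K + l!i) =
     qi (yy 0 * xx (Suc i)) * (1 / qi (zy l 0 * zx k (Suc i))) *
     (1 / qi (q * (yy (Suc i) * xx 0)) * qi (q * (zy l (Suc i) * zx k 0)))" if i: "i < r" for i
  proof -
    have e1: "q * (zy l (Suc i) * zx k 0) = b*c i*q/(C*x i) * q powi (?K + l!i)"
      unfolding powers_zyzx using i l by (simp add: sg_def add.commute mult_ac)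
    have e2: "q * (yy (Suc i) * xx 0) = b*c i*q/(C*x i)" by (simp add: mult_ac)
    have e3: "zy l 0 * zx k (Suc i) = a*x i/b * q powi (k!i - ?L)"
      unfolding powers_zyzx using i k by (simp add: sg_def add.commute mult_ac)
    have e4: "yy 0 * xx (Suc i) = a*x i/b" by simp
    show ?thesis unfolding e1 e2 e3 e4 qpoch_def by simp
  qed
  have 6: "1 / qpoch (a*q/C) q (?K - ?L) * (\<Prod>i<r. \<Prod>j<r. qpoch (c j*x i/x j) q (k!i + l!j)) *
     (\<Prod>i<r. qpoch (a*x i/b) q (k!i - ?L) / qpoch (b*c i*q/(C*x i)) q (?K + l!i)) = Gb * Gk (zx k) (zy l)"
  proof -
    have 7: "(\<Prod>i<r. \<Prod>j<r. qpoch (c j*x i/x j) q (k!i + l!j)) =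
      (\<Prod>i<r. \<Prod>j<r. qi (yy (Suc j) * xx (Suc i))) * (\<Prod>i<r. \<Prod>j<r. 1 / qi (zy l (Suc j) * zx k (Suc i)))"
      unfolding prod.distrib[symmetric] by (intro prod.cong refl 4) auto
    have 8: "(\<Prod>i<r. qpoch (a*x i/b) q (k!i - ?L) / qpoch (b*c i*q/(C*x i)) q (?K + l!i)) =
      (\<Prod>i<r. qi (yy 0 * xx (Suc i))) * (\<Prod>i<r. 1 / qi (zy l 0 * zx k (Suc i))) *
      ((\<Prod>i<r. 1 / qi (q * (yy (Suc i) * xx 0))) * (\<Prod>i<r. qi (q * (zy l (Suc i) * zx k 0))))"
      unfolding prod.distrib[symmetric] by (intro prod.cong refl 5) auto
    show ?thesis
      unfolding 3 7 8 Gb_def Gk_def prod.lessThan_Suc_shift prod.distrib by (simp only: mult_ac)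
  qed
  have 9: "q powi (?K - int r * ?L) = q powi ?K * (q powi (- ?L)) ^ r"
  proof -
    have "q powi (- (int r * ?L)) = (q powi (- ?L)) ^ r"
      using power_int_mult[of q "- ?L" "int r"] by (simp add: mult.commute)
    thus ?thesis using qpowi_add[of ?K "- (int r * ?L)"] by simp
  qed
  have "gmat r q a b c x k l = (1 - a * q powi (2 * ?K)) / (1 - a) *
     ((\<Prod>i<r. \<Prod>j\<in>{i<..<r}. (x i * q powi (k!i) - x j * q powi (k!j)) / (x i - x j)) *
     (\<Prod>i<r. (1 - b * q powi (?K - k!i) / (C * x i)) / (1 - b / (C * x i)))) *
     (1 / qpoch (a*q/C) q (?K - ?L) * (\<Prod>i<r. \<Prod>j<r. qpoch (c j*x i/x j) q (k!i + l!j)) *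
     (\<Prod>i<r. qpoch (a*x i/b) q (k!i - ?L) / qpoch (b*c i*q/(C*x i)) q (?K + l!i))) * q powi (?K - int r * ?L)"
    unfolding gmat_def Let_def C_def[symmetric] by (simp only: mult.assoc)
  also have "\<dots> = Gb / ((1 - a) * vdm (Suc r) xx) * (q powi (- ?L)) ^ r *
     ((1 - a * q powi (2 * ?K)) * vdm (Suc r) (zx k)) * Gk (zx k) (zy l)"
  proof -
    have alg: "A / s * (V / W * (1 / t)) * (G * H) * (t * R) = G / (s * W) * R * (A * V) * H" if "t \<noteq> 0"
      for A s V W t G H R :: complex using that by simp
    show ?thesis unfolding 6 12 9 by (rule alg) simp
  qed
  finally show ?thesis unfolding prod_zx_yy[OF k] .
qed

lemma Fk_Gk_row_weight: "Fk (zy n) (zx k) * Gk (zx k) (zy l) = (\<Prod>i<Suc r. row_weight (Suc r) (zy n) (zy l) (sg i) (zx k i))"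
proof -
  have "(\<Prod>i<Suc r. row_weight (Suc r) (zy n) (zy l) (sg i) (zx k i)) =
     (\<Prod>j<Suc r. qi (q * (zy l j * zx k 0)) / qi (zy n j * zx k 0)) *
     (\<Prod>i<r. \<Prod>j<Suc r. qi (q * (zy n j * zx k (Suc i))) / qi (zy l j * zx k (Suc i)))"
    by (subst prod.lessThan_Suc_shift) (simp only: row_weight_def sg_def, simp)
  also have "\<dots> = Fk (zy n) (zx k) * Gk (zx k) (zy l)"
    unfolding Fk_def Gk_def prod_dividef prod.neutral_const by (simp only: mult_ac times_divide_eq_left times_divide_eq_right mult_1_left mult_1_right) simp
  finally show ?thesis ..
qed

text \<open>Here the summation variables are the shifted y. As \<open>xx 0\<close> occurs opposite
  to the other \<open>xx i\<close>, each of the two parameter vectors takes its entry 0 from one of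
  n, l and its remaining entries from the other; in return all rows run forwards.\<close>

lemma Gk_Fk_row_weight:
  defines "N \<equiv> \<lambda>n l i. if i = (0::nat) then sg i * kv n i else sg i * kv l i"
  shows "Gk (zx n) (zy k) * Fk (zy k) (zx l) =
    (\<Prod>j<Suc r. row_weight (Suc r) (shiftv xx (N n l)) (shiftv xx (N l n)) 1 (zy k j))"
proof -
  have sh: "shiftv xx (N n l) 0 = zx n 0" "shiftv xx (N n l) (Suc i) = zx l (Suc i)" for n l i
    by (simp_all add: N_def shiftv_def zx_def)
  have "(\<Prod>j<Suc r. row_weight (Suc r) (shiftv xx (N n l)) (shiftv xx (N l n)) 1 (zy k j)) =
     (\<Prod>j<Suc r. (qi (q * (zy k j * zx n 0)) * (1 / qi (zy k j * zx l 0))) *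
        (\<Prod>i<r. qi (q * (zy k j * zx l (Suc i))) * (1 / qi (zy k j * zx n (Suc i)))))"
    unfolding row_weight_def by (intro prod.cong refl) (simp only: prod.lessThan_Suc_shift sh mult.commute[of "zx _ _"], simp)
  also have "\<dots> = (\<Prod>j<Suc r. qi (q * (zy k j * zx n 0))) * (\<Prod>j<Suc r. 1 / qi (zy k j * zx l 0)) *
     ((\<Prod>j<Suc r. \<Prod>i<r. qi (q * (zy k j * zx l (Suc i)))) * (\<Prod>j<Suc r. \<Prod>i<r. 1 / qi (zy k j * zx n (Suc i))))"
    by (simp only: prod.distrib)
  also have "\<dots> = Gk (zx n) (zy k) * Fk (zy k) (zx l)"
    unfolding Fk_def Gk_def
    by (subst (3) prod.swap, subst (4) prod.swap) (simp only: mult_ac)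
  finally show ?thesis ..
qed

section \<open>Inversion\<close>


lemma sg: "sg i \<in> {1, -1}"
  by (simp add: sg_def)

lemma prod_zy: "length n = r \<Longrightarrow> (\<Prod>j<Suc r. zy n j) = (\<Prod>j<Suc r. yy j)"
  using kv_sum[of n r] by (simp only: zy_def shiftv_def prod.distrib prod_power_int[OF q_nz]) simp

text \<open>\<open>K\<close> collects what is independent of k. For n = l its two powers of q cancel
  and its Vandermonde factor makes the theta determinant symmetric, so the shifts by n disappear and
  the constant applies.\<close>

lemma has_sum_fg:
  assumes n: "length n = r" and l: "length l = r"
  shows "((\<lambda>k. fmat r q a b c x n k * gmat r q a b c x k l) has_sum (if n = l then 1 else 0)) {k. length k = r}"
proof -
  define S where "S = (\<lambda>k. (1 - (\<Prod>j<Suc r. zy n j) * (\<Prod>i<Suc r. xx i * q powi (sg i * k i))) *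
     vdm (Suc r) (\<lambda>i. xx i * q powi (sg i * k i)) *
     (\<Prod>i<Suc r. row_weight (Suc r) (zy n) (zy l) (sg i) (xx i * q powi (sg i * k i))))"
  define K where "K = const * ((q powi sum_list n) ^ r * (q powi - sum_list l) ^ r) * vdm (Suc r) (zy n)"
  have term_eq: "fmat r q a b c x n k * gmat r q a b c x k l = K * S (kv k)" if k: "length k = r" for k
  proof -
    have z: "(\<lambda>i. xx i * q powi (sg i * kv k i)) = zx k" by (simp add: zx_def shiftv_def fun_eq_iff)
    have z': "xx i * q powi (sg i * kv k i) = zx k i" for i by (simp add: zx_def shiftv_def)
    have S: "S (kv k) = (1 - (\<Prod>j<Suc r. yy j) * (\<Prod>i<Suc r. zx k i)) * vdm (Suc r) (zx k) *
        (Fk (zy n) (zx k) * Gk (zx k) (zy l))"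
      unfolding S_def z' z Fk_Gk_row_weight prod_zy[OF n] ..
    show ?thesis
      unfolding fmat_eq[OF n k] gmat_eq[OF k l] S K_def const_def by (simp only: mult_ac)
  qed
  have "(S has_sum (if n = l then theta_det (Suc r) xx (zy n) else 0)) (zero_sum (Suc r))"
  proof (cases "n = l")
    case True
    have pole: "zy n j * (xx i * q powi t) * q powi m \<noteq> 1" if "i < Suc r" "j < Suc r" for i j t m
      unfolding zy_def using that by (intro shiftv_pole[OF in_pdom(1)] yy_nonzero)
    have diag: "((\<lambda>k. (1 - (\<Prod>j<Suc r. zy n j) * (\<Prod>i<Suc r. xx i * q powi (sg i * k i))) * vdm (Suc r) (\<lambda>i. xx i * q powi (sg i * k i)) *
     (\<Prod>i<Suc r. 1 / den (zy n) (Suc r) (xx i * q powi (sg i * k i)))) has_sum theta_det (Suc r) xx (zy n)) (zero_sum (Suc r))"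
      unfolding zy_def
      by (intro has_sum_diag pdom_shiftv in_pdom shiftv_sep yy_sep sg) (auto intro!: shiftv_nonzero yy_nonzero)
    have row_weight: "(\<Prod>i<Suc r. 1 / den (zy n) (Suc r) (xx i * q powi (sg i * k i))) =
       (\<Prod>i<Suc r. row_weight (Suc r) (zy n) (zy l) (sg i) (xx i * q powi (sg i * k i)))" for k
      unfolding True[symmetric] by (intro prod.cong refl row_weight_self[symmetric] pole sg) auto
    have "(S has_sum theta_det (Suc r) xx (zy n)) (zero_sum (Suc r))"
      unfolding S_def row_weight[symmetric] by (rule diag)
    thus ?thesis using True by simp
  next
    case False
    have "((\<lambda>k. (1 - (\<Prod>j<Suc r. shiftv yy (kv n) j) * (\<Prod>i<Suc r. xx i * q powi (sg i * k i))) * vdm (Suc r) (\<lambda>i. xx i * q powi (sg i * k i)) *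
     (\<Prod>i<Suc r. row_weight (Suc r) (shiftv yy (kv n)) (shiftv yy (kv l)) (sg i) (xx i * q powi (sg i * k i)))) has_sum 0) (zero_sum (Suc r))"
    proof (intro has_sum_offdiag in_pdom yy_sep sg)
      show "(\<Sum>j<Suc r. kv n j) = (\<Sum>j<Suc r. kv l j)" by (simp only: kv_sum[OF n] kv_sum[OF l])
      show "\<exists>j<Suc r. kv n j \<noteq> kv l j" using kv_neq[OF n l False] by (metis Suc_less_eq)
    qed (erule yy_nonzero)
    thus ?thesis using False unfolding S_def zy_def by simp
  qed
  hence "((\<lambda>k. S (kv k)) has_sum (if n = l then theta_det (Suc r) xx (zy n) else 0)) {k. length k = r}"
    by (subst has_sum_reindex_bij_betw[OF bij_betw_kv])
  hence "((\<lambda>k. K * S (kv k)) has_sum K * (if n = l then theta_det (Suc r) xx (zy n) else 0)) {k. length k = r}"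
    by (rule has_sum_cmult_right)
  moreover have "K * (if n = l then theta_det (Suc r) xx (zy n) else 0) = (if n = l then 1 else 0)"
  proof (cases "n = l")
    case True
    have "(q powi sum_list n) ^ r * (q powi - sum_list n) ^ r = 1"
      by (simp add: power_int_minus flip: power_mult_distrib)
    hence "K * theta_det (Suc r) xx (zy n) = const * sym_theta_det (Suc r) xx (zy n)"
      unfolding K_def sym_theta_det_def True[symmetric] by simp
    also have "sym_theta_det (Suc r) xx (zy n) = sym_theta_det (Suc r) xx yy"
      unfolding zy_def sym_theta_det_commute[of "Suc r" xx] by (intro sym_theta_det_shiftv yy_nonzero xx_nonzero)
    finally show ?thesis using True const_sym_theta_det by simp
  qed simp
  ultimately have "((\<lambda>k. K * S (kv k)) has_sum (if n = l then 1 else 0)) {k. length k = r}"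
    by (simp only:)
  thus ?thesis
    by (rule has_sum_cong[THEN iffD1, rotated]) (simp add: term_eq)
qed

text \<open>The Vandermonde product of y now comes from f, and the powers of q in the sum of k from
  g and f cancel. The mixed vectors \<open>N n l\<close> and \<open>N l n\<close> have the same
  total, the sum of n plus the sum of l, as the off-diagonal argument demands.\<close>

lemma has_sum_gf:
  assumes n: "length n = r" and l: "length l = r"
  shows "((\<lambda>k. gmat r q a b c x n k * fmat r q a b c x k l) has_sum (if n = l then 1 else 0)) {k. length k = r}"
proof -
  define N where "N = (\<lambda>n l i. if i = (0::nat) then sg i * kv n i else sg i * kv l i)"
  define S where "S = (\<lambda>k. vdm (Suc r) (\<lambda>j. yy j * q powi (1 * k j)) *
     (\<Prod>j<Suc r. row_weight (Suc r) (shiftv xx (N n l)) (shiftv xx (N l n)) 1 (yy j * q powi (1 * k j))))"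
  define K where "K = const * ((1 - (\<Prod>j<Suc r. yy j) * (\<Prod>i<Suc r. zx n i)) * vdm (Suc r) (zx n))"
  have term_eq: "gmat r q a b c x n k * fmat r q a b c x k l = K * S (kv k)" if k: "length k = r" for k
  proof -
    have z: "(\<lambda>j. yy j * q powi (1 * kv k j)) = zy k" by (simp add: zy_def shiftv_def fun_eq_iff)
    have z': "yy j * q powi (1 * kv k j) = zy k j" for j by (simp add: zy_def shiftv_def)
    have S: "S (kv k) = vdm (Suc r) (zy k) * (Gk (zx n) (zy k) * Fk (zy k) (zx l))"
      unfolding S_def z' z Gk_Fk_row_weight N_def ..
    have "(q powi sum_list k) ^ r * (q powi - sum_list k) ^ r = 1"
      by (simp add: power_int_minus flip: power_mult_distrib)
    moreover have "gmat r q a b c x n k * fmat r q a b c x k l =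
       ((q powi sum_list k) ^ r * (q powi - sum_list k) ^ r) * (K * S (kv k))"
      unfolding fmat_eq[OF k l] gmat_eq[OF n k] S K_def const_def by (simp only: mult_ac)
    ultimately show ?thesis by simp
  qed
  have prod_shift: "(\<Prod>i<Suc r. shiftv xx (N n l) i) * (\<Prod>j<Suc r. yy j) = a * q powi (sum_list n + sum_list l)"
  proof -
    have "(\<Sum>i<Suc r. N n l i) = sum_list n + sum_list l"
      unfolding sum.lessThan_Suc_shift N_def using l
      by (simp add: sg_def sum_list_sum_nth atLeast0LessThan)
    hence "(\<Prod>i<Suc r. shiftv xx (N n l) i) = (\<Prod>i<Suc r. xx i) * q powi (sum_list n + sum_list l)"
      unfolding shiftv_def prod.distrib prod_power_int[OF q_nz] by simp
    hence "(\<Prod>i<Suc r. shiftv xx (N n l) i) * (\<Prod>j<Suc r. yy j) =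
       ((\<Prod>i<Suc r. xx i) * (\<Prod>j<Suc r. yy j)) * q powi (sum_list n + sum_list l)"
      by (simp only: mult_ac)
    thus ?thesis by (simp only: prod_xx_yy)
  qed
  have prod_y: "(\<Prod>j<Suc r. yy j * q powi (1 * k j)) = (\<Prod>j<Suc r. yy j)" if "k \<in> zero_sum (Suc r)" for k
    using that unfolding prod.distrib prod_power_int[OF q_nz] by (simp add: zero_sum_def)
  have nz: "1 - a * q powi m \<noteq> 0" for m using generic_bases(1)[of m] by auto
  have sums: "(\<Sum>j<Suc r. N n l j) = (\<Sum>j<Suc r. N l n j)"
    unfolding sum.lessThan_Suc_shift N_def using n l by (simp add: sg_def sum_list_sum_nth atLeast0LessThan)
  \<comment> \<open>The factor \<open>1 - a * q powi (2 * sum_list n)\<close> supplied by g is not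
    the one the lattice sums require. That one is constant, since the shifts of y add up to 0, and
    nonzero by genericity, so it is inserted here and divided out afterwards.\<close>
  have scaled: "((\<lambda>k. (1 - a * q powi (sum_list n + sum_list l)) * S k) has_sum
      (if n = l then theta_det (Suc r) yy (zx n) else 0)) (zero_sum (Suc r))"
  proof (cases "n = l")
    case True
    have Nz: "shiftv xx (N n l) = zx n" "shiftv xx (N l n) = zx n"
      by (simp_all add: N_def zx_def shiftv_def fun_eq_iff True)
    have pole: "zx n j * (yy i * q powi t) * q powi m \<noteq> 1" if "i < Suc r" "j < Suc r" for i j t m
      unfolding zx_def using that by (intro shiftv_pole[OF in_pdom(2)] xx_nonzero)
    have "((\<lambda>k. (1 - (\<Prod>j<Suc r. zx n j) * (\<Prod>i<Suc r. yy i * q powi (1 * k i))) * vdm (Suc r) (\<lambda>i. yy i * q powi (1 * k i)) *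
     (\<Prod>i<Suc r. 1 / den (zx n) (Suc r) (yy i * q powi (1 * k i)))) has_sum theta_det (Suc r) yy (zx n)) (zero_sum (Suc r))"
      unfolding zx_def
      by (intro has_sum_diag pdom_shiftv in_pdom shiftv_sep xx_sep) (auto intro!: shiftv_nonzero xx_nonzero)
    moreover have "(1 - (\<Prod>j<Suc r. zx n j) * (\<Prod>i<Suc r. yy i * q powi (1 * k i))) * vdm (Suc r) (\<lambda>i. yy i * q powi (1 * k i)) *
     (\<Prod>i<Suc r. 1 / den (zx n) (Suc r) (yy i * q powi (1 * k i))) = (1 - a * q powi (sum_list n + sum_list l)) * S k"
      if k: "k \<in> zero_sum (Suc r)" for k
    proof -
      have "(\<Prod>i<Suc r. 1 / den (zx n) (Suc r) (yy i * q powi (1 * k i))) =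
        (\<Prod>i<Suc r. row_weight (Suc r) (zx n) (zx n) 1 (yy i * q powi (1 * k i)))"
        by (intro prod.cong refl row_weight_self[symmetric] pole) auto
      thus ?thesis
        unfolding S_def Nz prod_shift[unfolded Nz, symmetric] prod_y[OF k] by (simp only: mult.assoc)
    qed
    ultimately show ?thesis using True by (simp cong: has_sum_cong)
  next
    case False
    have "((\<lambda>k. (1 - (\<Prod>j<Suc r. shiftv xx (N n l) j) * (\<Prod>i<Suc r. yy i * q powi (1 * k i))) * vdm (Suc r) (\<lambda>i. yy i * q powi (1 * k i)) *
     (\<Prod>i<Suc r. row_weight (Suc r) (shiftv xx (N n l)) (shiftv xx (N l n)) 1 (yy i * q powi (1 * k i)))) has_sum 0) (zero_sum (Suc r))"
    proof (intro has_sum_offdiag in_pdom xx_sep sums)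
      show "\<exists>j<Suc r. N n l j \<noteq> N l n j"
        using kv_neq[OF n l False] by (auto simp: N_def sg_def)
    qed (erule xx_nonzero | simp)+
    moreover have "(1 - (\<Prod>j<Suc r. shiftv xx (N n l) j) * (\<Prod>i<Suc r. yy i * q powi (1 * k i))) * vdm (Suc r) (\<lambda>i. yy i * q powi (1 * k i)) *
     (\<Prod>i<Suc r. row_weight (Suc r) (shiftv xx (N n l)) (shiftv xx (N l n)) 1 (yy i * q powi (1 * k i))) = (1 - a * q powi (sum_list n + sum_list l)) * S k"
      if k: "k \<in> zero_sum (Suc r)" for k
      unfolding S_def prod_shift[symmetric] prod_y[OF k] by (simp only: mult.assoc)
    ultimately show ?thesis using False by (simp cong: has_sum_cong)
  qed
  let ?A = "1 - a * q powi (sum_list n + sum_list l)"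
  have "((\<lambda>k. ?A * S (kv k)) has_sum (if n = l then theta_det (Suc r) yy (zx n) else 0)) {k. length k = r}"
    using scaled by (subst has_sum_reindex_bij_betw[OF bij_betw_kv])
  from has_sum_cmult_right[OF this, of "K / ?A"]
  have "((\<lambda>k. K * S (kv k)) has_sum K / ?A * (if n = l then theta_det (Suc r) yy (zx n) else 0)) {k. length k = r}"
    using nz[of "sum_list n + sum_list l"] by simp
  moreover have "K / ?A * (if n = l then theta_det (Suc r) yy (zx n) else 0) = (if n = l then 1 else 0)"
  proof (cases "n = l")
    case True
    have "K / ?A * theta_det (Suc r) yy (zx n) = const * sym_theta_det (Suc r) yy (zx n)"
      unfolding K_def sym_theta_det_def prod_zx_yy[OF n] True[symmetric] mult_2[symmetric]
      using nz[of "2 * sum_list n"] by simp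
    also have "sym_theta_det (Suc r) yy (zx n) = sym_theta_det (Suc r) xx yy"
      unfolding zx_def sym_theta_det_commute[of "Suc r" yy] by (intro sym_theta_det_shiftv yy_nonzero xx_nonzero)
    finally show ?thesis using True const_sym_theta_det by simp
  qed simp
  ultimately have "((\<lambda>k. K * S (kv k)) has_sum (if n = l then 1 else 0)) {k. length k = r}"
    by (simp only:)
  thus ?thesis
    by (rule has_sum_cong[THEN iffD1, rotated]) (simp add: term_eq)
qed

end

theorem theorem3p2:
  fixes r :: nat and q a b :: complex and c x :: "nat \<Rightarrow> complex"
  assumes "0 < norm q" and "norm q < 1" and "r \<ge> 1"
    and "generic_params r q a b c x"
  shows "\<forall>n l. length n = r \<longrightarrow> length l = r \<longrightarrow>
           ((\<lambda>k. fmat r q a b c x n k * gmat r q a b c x k l) has_sum (if n = l then 1 else 0))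
             {k. length k = r}
         \<and> ((\<lambda>k. gmat r q a b c x n k * fmat r q a b c x k l) has_sum (if n = l then 1 else 0))
             {k. length k = r}"
proof -
  interpret generic_nome q r a b c x
    using assms by unfold_locales auto
  show ?thesis using has_sum_fg has_sum_gf by blast
qed

end
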